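(* Let $\Phi:\mathbb D\to\mathbb D$ be a continuous map. The following conditions are equivalent: (i) For every indexed sequence $\Lambda\subset\mathbb D$, $\Lambda\in\mathcal C$ implies $\Phi(\Lambda)\in\mathcal C$. (ii) $\Phi$ is a homeomorphism of $\mathbb D$ onto itself, $\Phi^{-1}$ is uniformly continuous with respect to $\rho$, and there is a constant $C_\Phi<\infty$ such that $\|T_\Phi\mu\|_{\mathrm{CM}}\le C_\Phi\|\mu\|_{\mathrm{CM}}$ for every positive Carleson measure $\mu$ on $\mathbb D$.
   Context: $\mathbb D=\{z\in\mathbb C:|z|<1\}$, $\mathbb T=\partial\mathbb D$, and $\rho(z,w)=\left|\frac{z-w}{1-\overline z w}\right|$ is the pseudohyperbolic metric on $\mathbb D$. Sequences are indexed families $\Lambda=(\lambda_j)$ (finite or countably infinite) of points of $\mathbb D$; the image $\Phi(\Lambda)=(\Phi(\lambda_j))$ retains repeated terms. $\mathcal C$ denotes the class of Carleson (interpolating) sequences: $\Lambda=(\lambda_j)\in\mathcal C$ if every bounded scalar sequence $(a_j)$ is of the form $a_j=f(\lambda_j)$ for some $f\in H^\infty(\mathbb D)$. Finite sequences of distinct points belong to $\mathcal C$; a sequence with a repeated term does not. Carleson measures: for an arc $I\subset\mathbb T$ let $|I|$ be its normalized arclength. For $0<|I|<1$ set $S(I)=\{r\zeta:\zeta\in I,\ 0<r<1,\ 1-r\le|I|\}$, and $S(\mathbb T)=\mathbb D$. For a positive Borel measure $\mu$ on $\mathbb D$, $\|\mu\|_{\mathrm{CM}}=\sup_{0<|I|\le1}\mu(S(I))/|I|$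 (with $I=\mathbb T$ when $|I|=1$); $\mu$ is a positive Carleson measure if $\|\mu\|_{\mathrm{CM}}<\infty$. Weighted pushforward: $q_\Phi(z)=\frac{1-|\Phi(z)|^2}{1-|z|^2}$ and $T_\Phi\mu=\Phi_*(q_\Phi\mu)$, i.e. $(T_\Phi\mu)(E)=\int_{\Phi^{-1}(E)}q_\Phi\,d\mu$ for Borel $E\subset\mathbb D$. *)

theory Defs
  imports "HOL-Complex_Analysis.Complex_Analysis"
begin

abbreviation unit_disc :: "complex set" where
  "unit_disc \<equiv> ball 0 1"

abbreviation unit_circle :: "complex set" where
  "unit_circle \<equiv> sphere 0 1"

definition pseudohyperbolic :: "complex \<Rightarrow> complex \<Rightarrow> real" where
  "pseudohyperbolic z w = cmod ((z - w) / (1 - cnj z * w))"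

definition pseudohyp_uniformly_continuous :: "(complex \<Rightarrow> complex) \<Rightarrow> bool" where
  "pseudohyp_uniformly_continuous f \<longleftrightarrow>
    (\<forall>\<epsilon>>0. \<exists>\<delta>>0. \<forall>z\<in>unit_disc. \<forall>w\<in>unit_disc.
       pseudohyperbolic z w < \<delta> \<longrightarrow> pseudohyperbolic (f z) (f w) < \<epsilon>)"

definition H_infinity :: "(complex \<Rightarrow> complex) set" where
  "H_infinity = {f. f holomorphic_on unit_disc \<and> bounded (f ` unit_disc)}"

(* A finite or countably infinite indexed family (lambda_j) is given by an index set
   J of natural numbers and a function on the naturals that only matters on J. *)
definition carleson_sequence :: "nat set \<Rightarrow> (nat \<Rightarrow> complex) \<Rightarrow> bool" where
  "carleson_sequence J \<Lambda> \<longleftrightarrow>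
    \<Lambda> ` J \<subseteq> unit_disc \<and>
    (\<forall>a :: nat \<Rightarrow> complex. bounded (a ` J) \<longrightarrow>
       (\<exists>f\<in>H_infinity. \<forall>j\<in>J. a j = f (\<Lambda> j)))"

definition normalized_arclength :: "complex set \<Rightarrow> real" where
  "normalized_arclength I = measure lborel {t \<in> {0..<1}. cis (2 * pi * t) \<in> I}"

(* Arcs are connected subsets of the circle, with or without their end points. The only
   arc of full length that is admitted is the whole circle. *)
definition carleson_arcs :: "complex set set" where
  "carleson_arcs = {I. I \<subseteq> unit_circle \<and> connected I \<and> 0 < normalized_arclength I \<and>
                       (normalized_arclength I < 1 \<or> I = unit_circle)}"

definition carleson_box :: "complex set \<Rightarrow> complex set" where
  "carleson_box I =
    (if I = unit_circle then unit_disc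
     else {of_real r * \<zeta> | r \<zeta>. \<zeta> \<in> I \<and> 0 < r \<and> r < 1 \<and> 1 - r \<le> normalized_arclength I})"

abbreviation disc_borel :: "complex measure" where
  "disc_borel \<equiv> restrict_space borel unit_disc"

definition carleson_norm :: "complex measure \<Rightarrow> ennreal" where
  "carleson_norm \<mu> =
    (SUP I\<in>carleson_arcs. emeasure \<mu> (carleson_box I) / ennreal (normalized_arclength I))"

definition carleson_measure :: "complex measure \<Rightarrow> bool" where
  "carleson_measure \<mu> \<longleftrightarrow> sets \<mu> = sets disc_borel \<and> carleson_norm \<mu> < \<infinity>"

definition disc_weight :: "(complex \<Rightarrow> complex) \<Rightarrow> complex \<Rightarrow> real" where
  "disc_weight \<Phi> z = (1 - (cmod (\<Phi> z))\<^sup>2) / (1 - (cmod z)\<^sup>2)"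

definition weighted_pushforward ::
    "(complex \<Rightarrow> complex) \<Rightarrow> complex measure \<Rightarrow> complex measure" where
  "weighted_pushforward \<Phi> \<mu> = distr (density \<mu> (\<lambda>z. ennreal (disc_weight \<Phi> z))) disc_borel \<Phi>"

end

theory Submission
  imports Defs
begin

text \<open>
Carleson's theorem turns both conditions into geometry. A sequence is interpolating exactly if it
is separated in the pseudohyperbolic metric and the sums
\<open>\<Sum> (1 - \<rho>(z, \<lambda>\<^sub>j)\<^sup>2)\<close> are bounded uniformly in
\<open>z\<close> (\<open>carleson_sequence_necessary\<close>,
\<open>carleson_sequence_sufficient\<close>). These sums are the Poisson-type integrals of
\<open>\<mu>\<^sub>\<Lambda> = \<Sum> (1 - \<bar>\<lambda>\<^sub>j\<bar>\<^sup>2) \<delta>\<^bsub>\<lambda>\<^sub>j\<^esub>\<close>,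
and such integrals are bounded exactly if the measure is a Carleson measure
(\<open>box_sums_imp_kernel_sum_bound\<close>, \<open>carleson_norm_le\<close>). Necessity is
proved by a gliding hump and the maximum principle for the inverse of a finite Blaschke product;
sufficiency is proved by the explicit interpolating functions of P. Jones and a normal family
argument.

The weight in \<open>T\<^sub>\<Phi>\<close> is chosen so that
\<open>T\<^sub>\<Phi> \<mu>\<^sub>\<Lambda> = \<mu>\<^bsub>\<Phi>(\<Lambda>)\<^esub>\<close>. If
\<open>T\<^sub>\<Phi>\<close> is bounded and the inverse of \<open>\<Phi>\<close> is uniformly
continuous, then the two halves of the geometric description pass from \<open>\<Lambda>\<close> to
\<open>\<Phi>(\<Lambda>)\<close>; this is \<open>bounded_pushforward_preserves_carleson\<close>.

Conversely, let \<open>\<Phi>\<close> preserve interpolating sequences. Finite blocks of points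
that lie ever closer to the circle, with sufficiently large gaps between them, can be united
without losing Carleson's condition (\<open>lacunary_selection\<close>). Single points as blocks
show that \<open>\<Phi>\<close> is proper; since it is injective, invariance of domain makes it a
homeomorphism of the disc. Pairs of points as blocks show that its inverse is uniformly
continuous. Larger blocks show that the kernel sums of \<open>\<Phi>(E)\<close> are bounded
uniformly over all finite separated sets \<open>E\<close> with a fixed Carleson constant
(\<open>uniform_kernel_bound\<close>).

It remains to pass from point sets to arbitrary measures. Distribute a measure of Carleson norm at
most 1 over the Whitney boxes of the disc. Box by box its mass is a fraction, at most 1, of the
mass of a single point of the box. The fractions are rounded to 0 or 1: accumulate them along
every branch of the dyadic tree, starting from a random offset, and select a box whenever the
accumulated sum passes an integer. Each box is selected with probability equal to its fraction, so
some offset loses nothing of the quantity to be bounded, and along every branch the number of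
selected boxes differs from the accumulated fraction by at most 1, so the selected boxes satisfy
Carleson's condition with a fixed constant (\<open>carleson_rounding\<close>). The uniform bound
for point sets now applies to one point from each selected box.
\<close>

section \<open>The pseudohyperbolic metric and Blaschke factors\<close>

text \<open>By the identity \<open>hyp_kernel_eq\<close> below this is
  \<open>(1 - \<bar>z\<bar>\<^sup>2) (1 - \<bar>w\<bar>\<^sup>2) / \<bar>1 - cnj z w\<bar>\<^sup>2\<close>,
  so a sum of kernels over the points of a sequence is the Poisson-type integral at
  \<open>z\<close> of the measure that puts mass \<open>1 - \<bar>w\<bar>\<^sup>2\<close> at each
  point \<open>w\<close>. Away from the diagonal it is also comparable to the logarithm of
  \<open>1 / pseudohyperbolic z w\<close>, which links kernel sums to Blaschke products.\<close>

abbreviation hyp_kernel :: "complex \<Rightarrow> complex \<Rightarrow> real" where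
  "hyp_kernel z w \<equiv> 1 - (pseudohyperbolic z w)\<^sup>2"

lemma one_minus_cnj_mult_nonzero:
  assumes "cmod z < 1" "cmod w \<le> 1"
  shows "1 - cnj z * w \<noteq> 0"
proof
  assume "1 - cnj z * w = 0"
  then have "cmod (cnj z * w) = 1" by simp
  moreover have "cmod (cnj z * w) < 1"
    using mult_mono[of "cmod z" "cmod z" "cmod w" 1] assms by (simp add: norm_mult)
  ultimately show False by simp
qed

lemma cmod_one_minus_cnj_commute: "cmod (1 - cnj z * w) = cmod (1 - cnj w * z)"
  by (metis complex_cnj_cnj complex_cnj_diff complex_cnj_mult complex_cnj_one complex_mod_cnj mult.commute)

lemma cmod_one_minus_cnj_sq:
  "(cmod (1 - cnj z * w))\<^sup>2 - (cmod (z - w))\<^sup>2 = (1 - (cmod z)\<^sup>2) * (1 - (cmod w)\<^sup>2)"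
  by (simp only: cmod_power2) (simp add: power2_eq_square algebra_simps)

lemma one_minus_cmod_mult_le:
  assumes "cmod w \<le> 1"
  shows "1 - cmod z \<le> cmod (1 - cnj z * w)"
proof -
  have "1 - cmod z \<le> 1 - cmod z * cmod w"
    using mult_left_mono[OF assms, of "cmod z"] by simp
  also have "\<dots> \<le> cmod (1 - cnj z * w)"
    using norm_triangle_ineq2[of 1 "cnj z * w"] by (simp add: norm_mult)
  finally show ?thesis .
qed

lemma pseudohyperbolic_commute: "pseudohyperbolic z w = pseudohyperbolic w z"
  unfolding pseudohyperbolic_def norm_divide
  by (metis cmod_one_minus_cnj_commute norm_minus_commute)

lemma pseudohyperbolic_nonneg [simp]: "0 \<le> pseudohyperbolic z w"
  by (simp add: pseudohyperbolic_def)

lemma pseudohyperbolic_self [simp]: "pseudohyperbolic z z = 0"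
  by (simp add: pseudohyperbolic_def)

lemma hyp_kernel_commute: "hyp_kernel z w = hyp_kernel w z"
  by (simp add: pseudohyperbolic_commute)

lemma hyp_kernel_eq:
  assumes "cmod z < 1" "cmod w \<le> 1"
  shows "hyp_kernel z w = (1 - (cmod z)\<^sup>2) * (1 - (cmod w)\<^sup>2) / (cmod (1 - cnj z * w))\<^sup>2"
proof -
  have "cmod (1 - cnj z * w) \<noteq> 0" using one_minus_cnj_mult_nonzero[OF assms] by simp
  then show ?thesis
    unfolding pseudohyperbolic_def norm_divide cmod_one_minus_cnj_sq[symmetric]
    by (simp add: power_divide field_simps)
qed

lemma hyp_kernel_nonneg:
  assumes "cmod z < 1" "cmod w \<le> 1"
  shows "0 \<le> hyp_kernel z w"
  unfolding hyp_kernel_eq[OF assms]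
  using assms by (intro divide_nonneg_nonneg mult_nonneg_nonneg) (auto simp: power_le_one)

lemma hyp_kernel_pos:
  assumes "cmod z < 1" "cmod w < 1"
  shows "0 < hyp_kernel z w"
  using assms one_minus_cnj_mult_nonzero[of z w] hyp_kernel_eq[of z w]
  by (simp add: power_less_one_iff abs_square_less_1)

lemma hyp_kernel_le_1: "hyp_kernel z w \<le> 1"
  by simp

lemma pseudohyperbolic_le_1:
  assumes "cmod z < 1" "cmod w \<le> 1"
  shows "pseudohyperbolic z w \<le> 1"
  using hyp_kernel_nonneg[OF assms] by (simp add: abs_square_le_1)

lemma pseudohyperbolic_eq_0_iff:
  assumes "cmod z < 1" "cmod w < 1"
  shows "pseudohyperbolic z w = 0 \<longleftrightarrow> z = w"
  using one_minus_cnj_mult_nonzero[of z w] assms by (auto simp: pseudohyperbolic_def)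

lemma cmod_diff_le_pseudohyperbolic:
  assumes "cmod z < 1" "cmod w < 1"
  shows "cmod (z - w) \<le> 2 * pseudohyperbolic z w"
proof -
  have nz: "cmod (1 - cnj z * w) > 0" using one_minus_cnj_mult_nonzero[of z w] assms by simp
  have "cmod (1 - cnj z * w) \<le> 1 + cmod z * cmod w"
    using norm_triangle_ineq4[of 1 "cnj z * w"] by (simp add: norm_mult)
  also have "\<dots> \<le> 2"
    using mult_mono[of "cmod z" 1 "cmod w" 1] assms by simp
  finally have "cmod (z - w) * cmod (1 - cnj z * w) \<le> cmod (z - w) * 2"
    by (intro mult_left_mono) auto
  then show ?thesis
    using nz by (simp add: pseudohyperbolic_def norm_divide field_simps)
qed

text \<open>Points whose distances to the circle are very different hardly interact; geometrically decreasing
  distances therefore give geometric series of kernels.\<close>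

lemma hyp_kernel_le_ratio:
  assumes "cmod z < 1" "cmod w < 1"
  shows "hyp_kernel z w \<le> 4 * ((1 - cmod w) / (1 - cmod z))"
proof -
  define x y where "x = cmod z" and "y = cmod w"
  have xy: "0 \<le> x" "x < 1" "0 \<le> y" "y < 1" using assms by (auto simp: x_def y_def)
  have le: "1 - x \<le> cmod (1 - cnj z * w)"
    unfolding x_def using assms by (intro one_minus_cmod_mult_le) auto
  then have "hyp_kernel z w \<le> (1 - x\<^sup>2) * (1 - y\<^sup>2) / (1 - x)\<^sup>2"
    unfolding hyp_kernel_eq[OF assms(1) less_imp_le[OF assms(2)]] x_def[symmetric] y_def[symmetric]
    using xy by (intro divide_left_mono mult_nonneg_nonneg mult_pos_pos power_mono)
      (auto simp: power_le_one intro!: zero_less_power)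
  also have "(1 - x\<^sup>2) * (1 - y\<^sup>2) = (1 + x) * (1 + y) * ((1 - x) * (1 - y))"
    by (simp add: power2_eq_square algebra_simps)
  also have "\<dots> \<le> 4 * ((1 - x) * (1 - y))"
    using xy mult_mono[of "1 + x" 2 "1 + y" 2] by (intro mult_right_mono) auto
  finally show ?thesis
    using xy by (simp add: divide_right_mono x_def y_def power2_eq_square)
qed

lemma one_minus_cmod_sq_le_hyp_kernel:
  assumes "cmod z < 1" "cmod w < 1"
  shows "1 - (cmod w)\<^sup>2 \<le> 4 * hyp_kernel z w / (1 - (cmod z)\<^sup>2)"
proof -
  have pos: "1 - (cmod z)\<^sup>2 > 0" "1 - (cmod w)\<^sup>2 > 0"
    using assms by (auto simp: abs_square_less_1)
  have nz: "cmod (1 - cnj z * w) > 0" using one_minus_cnj_mult_nonzero[of z w] assms by simp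
  have "cmod (1 - cnj z * w) \<le> 1 + cmod z * cmod w"
    using norm_triangle_ineq4[of 1 "cnj z * w"] by (simp add: norm_mult)
  also have "\<dots> \<le> 2"
    using mult_mono[of "cmod z" 1 "cmod w" 1] assms by simp
  finally have "(cmod (1 - cnj z * w))\<^sup>2 \<le> 2\<^sup>2" by (intro power_mono) auto
  then have "(1 - (cmod w)\<^sup>2) * (cmod (1 - cnj z * w))\<^sup>2 \<le> (1 - (cmod w)\<^sup>2) * 4"
    using pos by (intro mult_left_mono) auto
  then have "1 - (cmod w)\<^sup>2 \<le> 4 * (1 - (cmod w)\<^sup>2) / (cmod (1 - cnj z * w))\<^sup>2"
    using nz by (subst pos_le_divide_eq) (auto simp: mult.commute)
  also have "\<dots> = 4 * hyp_kernel z w / (1 - (cmod z)\<^sup>2)"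
    using pos assms by (simp only: hyp_kernel_eq less_imp_le) simp
  finally show ?thesis .
qed

lemma Moebius_norm: "cmod (Moebius_function 0 a z) = pseudohyperbolic z a"
  by (simp add: Moebius_function_simple pseudohyperbolic_def norm_divide
      cmod_one_minus_cnj_commute[of a z] norm_minus_commute)

lemma Moebius_norm_circle:
  assumes "cmod a < 1" "cmod z = 1"
  shows "cmod (Moebius_function 0 a z) = 1"
proof -
  have "(cmod (1 - cnj a * z))\<^sup>2 = (cmod (a - z))\<^sup>2"
    using cmod_one_minus_cnj_sq[of a z] assms by simp
  then have "cmod (1 - cnj a * z) = cmod (z - a)"
    by (simp add: norm_minus_commute)
  then show ?thesis
    using one_minus_cnj_mult_nonzero[of a z] assms
    by (auto simp: Moebius_function_simple norm_divide)
qed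

lemma Moebius_continuous_on_cball:
  assumes "cmod a < 1"
  shows "continuous_on (cball 0 1) (Moebius_function 0 a)"
  unfolding Moebius_function_def
  using one_minus_cnj_mult_nonzero[OF assms]
  by (intro continuous_intros) auto

lemma Moebius_holomorphic:
  assumes "cmod a < 1"
  shows "Moebius_function 0 a holomorphic_on ball 0 1"
  by (rule Moebius_function_holomorphic[OF assms])

text \<open>After moving the zero to the origin this is the Schwarz lemma. That lemma needs a strict bound, so
  it is applied with every \<open>M' > M\<close>.\<close>

lemma blaschke_division:
  assumes holf: "f holomorphic_on ball 0 1" and le: "\<And>z. cmod z < 1 \<Longrightarrow> cmod (f z) \<le> M"
    and a: "cmod a < 1" and fa: "f a = 0"
  obtains g where "g holomorphic_on ball 0 1" "\<And>z. cmod z < 1 \<Longrightarrow> cmod (g z) \<le> M"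
    "\<And>z. cmod z < 1 \<Longrightarrow> f z = Moebius_function 0 a z * g z"
proof -
  define F where "F = f \<circ> Moebius_function 0 (-a)"
  have a': "cmod (-a) < 1" using a by simp
  have holF: "F holomorphic_on ball 0 1"
    unfolding F_def
    by (rule holomorphic_on_compose_gen[OF Moebius_holomorphic[OF a'] holf])
       (use Moebius_function_norm_lt_1[OF a'] in auto)
  have F0: "F 0 = 0" by (simp add: F_def Moebius_function_simple fa)
  have leF: "cmod (F z) \<le> M" if "cmod z < 1" for z
    unfolding F_def using le[OF Moebius_function_norm_lt_1[OF a' that]] by simp
  obtain h where h: "h holomorphic_on ball 0 1" "\<And>z. cmod z < 1 \<Longrightarrow> F z = z * h z" "deriv F 0 = h 0"
    using Schwarz3[OF holF F0] by blast
  have leh: "cmod (h z) \<le> M" if z: "cmod z < 1" for z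
  proof (rule dense_ge)
    fix M' assume M': "M < M'"
    have M'0: "M' > 0" using M' leF[of 0] norm_ge_zero[of "F 0"] by (simp del: norm_ge_zero)
    define G where "G = (\<lambda>z. F z / of_real M')"
    have holG: "G holomorphic_on ball 0 1"
      unfolding G_def using M'0 by (intro holomorphic_intros holF) auto
    have G0: "G 0 = 0" by (simp add: G_def F0)
    have ltG: "cmod (G w) < 1" if "cmod w < 1" for w
      using leF[OF that] M' M'0 by (simp add: G_def norm_divide)
    show "cmod (h z) \<le> M'"
    proof (cases "z = 0")
      case True
      have "deriv G 0 = deriv F 0 / of_real M'"
        unfolding G_def
        by (intro deriv_cdivide_right holomorphic_on_imp_differentiable_at[OF holF]) auto
      then have "cmod (h 0) / M' \<le> 1"
        using Schwarz_Lemma(2)[OF holG G0 ltG, of 0] M'0 h(3) by (simp add: norm_divide)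
      then show ?thesis using M'0 True by (simp add: field_simps)
    next
      case False
      have "cmod (G z) \<le> cmod z" using Schwarz_Lemma(1)[OF holG G0 ltG z] .
      then have "cmod z * cmod (h z) \<le> cmod z * M'"
        using M'0 by (simp add: G_def h(2)[OF z] norm_divide norm_mult field_simps)
      then show ?thesis using False by simp
    qed
  qed
  show thesis
  proof
    show "(h \<circ> Moebius_function 0 a) holomorphic_on ball 0 1"
      by (rule holomorphic_on_compose_gen[OF Moebius_holomorphic[OF a] h(1)])
         (use Moebius_function_norm_lt_1[OF a] in auto)
    fix z :: complex assume z: "cmod z < 1"
    have m: "cmod (Moebius_function 0 a z) < 1" using Moebius_function_norm_lt_1[OF a z] .
    show "cmod ((h \<circ> Moebius_function 0 a) z) \<le> M" using leh[OF m] by simp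
    have "F (Moebius_function 0 a z) = f z"
      unfolding F_def using Moebius_function_compose[of "-a" a z] a z by simp
    then show "f z = Moebius_function 0 a z * (h \<circ> Moebius_function 0 a) z"
      using h(2)[OF m] by simp
  qed
qed

text \<open>Dividing out the zeros one after the other costs nothing in the bound.\<close>

lemma blaschke_bound:
  assumes "finite F" "inj_on \<Lambda> F" "\<And>j. j \<in> F \<Longrightarrow> cmod (\<Lambda> j) < 1"
    and "f holomorphic_on ball 0 1" "\<And>z. cmod z < 1 \<Longrightarrow> cmod (f z) \<le> M"
    and "\<And>j. j \<in> F \<Longrightarrow> f (\<Lambda> j) = 0" and z: "cmod z < 1"
  shows "cmod (f z) \<le> M * (\<Prod>j\<in>F. pseudohyperbolic z (\<Lambda> j))"
  using assms(1-6)
proof (induction F arbitrary: f rule: finite_induct)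
  case empty
  then show ?case using z by simp
next
  case (insert i F)
  obtain g where g: "g holomorphic_on ball 0 1" "\<And>z. cmod z < 1 \<Longrightarrow> cmod (g z) \<le> M"
    "\<And>z. cmod z < 1 \<Longrightarrow> f z = Moebius_function 0 (\<Lambda> i) z * g z"
    using blaschke_division[of f M "\<Lambda> i"] insert.prems by auto
  have "cmod (g z) \<le> M * (\<Prod>j\<in>F. pseudohyperbolic z (\<Lambda> j))"
  proof (rule insert.IH)
    show "inj_on \<Lambda> F" using insert.prems by (simp add: inj_on_insert)
    fix j assume j: "j \<in> F"
    show lt: "cmod (\<Lambda> j) < 1" using insert.prems j by simp
    have "\<Lambda> j \<noteq> \<Lambda> i" using insert.prems(1) insert.hyps j by (auto simp: inj_on_def)
    then have "Moebius_function 0 (\<Lambda> i) (\<Lambda> j) \<noteq> 0"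
      using one_minus_cnj_mult_nonzero[of "\<Lambda> i" "\<Lambda> j"] insert.prems(2)[of i] lt
      by (simp add: Moebius_function_simple)
    then show "g (\<Lambda> j) = 0"
      using g(3)[OF lt] insert.prems(5)[of j] j by simp
  qed (use g in auto)
  then have "pseudohyperbolic z (\<Lambda> i) * cmod (g z)
      \<le> pseudohyperbolic z (\<Lambda> i) * (M * (\<Prod>j\<in>F. pseudohyperbolic z (\<Lambda> j)))"
    by (intro mult_left_mono) auto
  then show ?case
    using g(3)[OF z] insert.hyps by (simp add: norm_mult Moebius_norm mult_ac)
qed

text \<open>The difference \<open>f z - f a\<close> is bounded by 2 and vanishes at \<open>a\<close>. This
  weak form of the Schwarz--Pick lemma transports lower bounds from a point to a pseudohyperbolic
  disc around it.\<close>

lemma bounded_holomorphic_lipschitz: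
  assumes "f holomorphic_on ball 0 1" "\<And>z. cmod z < 1 \<Longrightarrow> cmod (f z) \<le> 1"
    and "cmod a < 1" "cmod z < 1"
  shows "cmod (f z - f a) \<le> 2 * pseudohyperbolic z a"
proof -
  have "cmod (f z - f a) \<le> 2 * (\<Prod>j\<in>{a}. pseudohyperbolic z j)"
  proof (rule blaschke_bound[where f = "\<lambda>z. f z - f a" and \<Lambda> = "\<lambda>w. w"])
    show "(\<lambda>z. f z - f a) holomorphic_on ball 0 1"
      by (intro holomorphic_intros assms)
    fix w :: complex assume "cmod w < 1"
    then show "cmod (f w - f a) \<le> 2"
      using norm_triangle_ineq4[of "f w" "f a"] assms(2)[of w] assms(2)[of a] assms(3) by linarith
  qed (use assms in auto)
  then show ?thesis by simp
qed

text \<open>\<open>\<rho>\<^sup>2 = 1 - hyp_kernel\<close> and \<open>1 - x \<le> exp (- x)\<close>.\<close>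

lemma sum_kernel_le_of_prod_ge:
  assumes "finite F" "0 < p" "p \<le> (\<Prod>j\<in>F. pseudohyperbolic z (\<Lambda> j))"
  shows "(\<Sum>j\<in>F. hyp_kernel z (\<Lambda> j)) \<le> - 2 * ln p"
proof -
  have "p\<^sup>2 \<le> (\<Prod>j\<in>F. pseudohyperbolic z (\<Lambda> j))\<^sup>2"
    using assms by (intro power_mono) auto
  also have "\<dots> = (\<Prod>j\<in>F. (pseudohyperbolic z (\<Lambda> j))\<^sup>2)"
    by (simp add: prod_power_distrib)
  also have "\<dots> \<le> (\<Prod>j\<in>F. exp (- hyp_kernel z (\<Lambda> j)))"
  proof (intro prod_mono conjI)
    fix j
    show "(pseudohyperbolic z (\<Lambda> j))\<^sup>2 \<le> exp (- hyp_kernel z (\<Lambda> j))"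
      using exp_ge_add_one_self[of "- hyp_kernel z (\<Lambda> j)"] by simp
  qed auto
  also have "\<dots> = exp (- (\<Sum>j\<in>F. hyp_kernel z (\<Lambda> j)))"
    using assms(1) by (simp only: sum_negf[symmetric] exp_sum)
  finally have "ln (p\<^sup>2) \<le> - (\<Sum>j\<in>F. hyp_kernel z (\<Lambda> j))"
    using assms(2) by (metis ln_exp ln_le_cancel_iff exp_gt_zero zero_less_power)
  then show ?thesis using assms(2) by (simp add: ln_realpow)
qed

text \<open>\<open>\<rho>\<^sup>2 = 1 - hyp_kernel\<close> and the Weierstrass product inequality.\<close>

lemma prod_ge_of_sum_kernel_le:
  assumes "finite F" "\<And>j. j \<in> F \<Longrightarrow> pseudohyperbolic z (\<Lambda> j) \<le> 1"
    and "(\<Sum>j\<in>F. hyp_kernel z (\<Lambda> j)) \<le> 3/4"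
  shows "1/2 \<le> (\<Prod>j\<in>F. pseudohyperbolic z (\<Lambda> j))"
proof -
  have "1 - (\<Sum>j\<in>F. hyp_kernel z (\<Lambda> j)) \<le> (\<Prod>j\<in>F. 1 - hyp_kernel z (\<Lambda> j))"
    by (rule Weierstrass_prod_ineq) (use assms in \<open>auto simp: abs_square_le_1\<close>)
  also have "\<dots> = (\<Prod>j\<in>F. pseudohyperbolic z (\<Lambda> j))\<^sup>2"
    by (simp add: prod_power_distrib)
  finally have "(1/2)\<^sup>2 \<le> (\<Prod>j\<in>F. pseudohyperbolic z (\<Lambda> j))\<^sup>2"
    using assms(3) by (simp add: power2_eq_square)
  then show ?thesis by (rule power2_le_imp_le) (auto intro: prod_nonneg)
qed

section \<open>Interpolating sequences are separated with bounded kernel sums\<close>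

text \<open>Separation and the following bound together are Carleson's geometric description of interpolating
  sequences; that description is the content of this section and the next one. The index type is
  arbitrary, so that the identity on a set of points is covered as well as a sequence.\<close>

definition pseudohyp_separated :: "real \<Rightarrow> 'i set \<Rightarrow> ('i \<Rightarrow> complex) \<Rightarrow> bool" where
  "pseudohyp_separated \<delta> J \<Lambda> \<longleftrightarrow>
    (\<forall>i\<in>J. \<forall>j\<in>J. i \<noteq> j \<longrightarrow> \<delta> \<le> pseudohyperbolic (\<Lambda> i) (\<Lambda> j))"

text \<open>This is the statement that
  \<open>\<Sum> (1 - \<bar>\<Lambda> j\<bar>\<^sup>2) \<delta>\<^bsub>\<Lambda> j\<^esub>\<close>
  is a Carleson measure, expressed by test functions instead of boxes. Finite partial sums avoid
  any question of convergence.\<close>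

definition kernel_bounded :: "real \<Rightarrow> 'i set \<Rightarrow> ('i \<Rightarrow> complex) \<Rightarrow> bool" where
  "kernel_bounded K J \<Lambda> \<longleftrightarrow>
    (\<forall>z\<in>unit_disc. \<forall>F. finite F \<longrightarrow> F \<subseteq> J \<longrightarrow> (\<Sum>j\<in>F. hyp_kernel z (\<Lambda> j)) \<le> K)"

lemma pseudohyp_separatedD:
  "pseudohyp_separated \<delta> J \<Lambda> \<Longrightarrow> i \<in> J \<Longrightarrow> j \<in> J \<Longrightarrow> i \<noteq> j \<Longrightarrow> \<delta> \<le> pseudohyperbolic (\<Lambda> i) (\<Lambda> j)"
  by (auto simp: pseudohyp_separated_def)

lemma kernel_boundedD:
  "kernel_bounded K J \<Lambda> \<Longrightarrow> cmod z < 1 \<Longrightarrow> finite F \<Longrightarrow> F \<subseteq> J \<Longrightarrow> (\<Sum>j\<in>F. hyp_kernel z (\<Lambda> j)) \<le> K"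
  by (auto simp: kernel_bounded_def)

lemma kernel_boundedI:
  "(\<And>z F. cmod z < 1 \<Longrightarrow> finite F \<Longrightarrow> F \<subseteq> J \<Longrightarrow> (\<Sum>j\<in>F. hyp_kernel z (\<Lambda> j)) \<le> K)
    \<Longrightarrow> kernel_bounded K J \<Lambda>"
  by (auto simp: kernel_bounded_def)

lemma geometric_tail_bound:
  fixes r :: real
  assumes r: "0 \<le> r" "r < 1" and X: "finite X" "\<And>i. i \<in> X \<Longrightarrow> n \<le> i"
  shows "(\<Sum>i\<in>X. r ^ i) \<le> r ^ n / (1 - r)"
proof -
  have "(\<Sum>i\<in>X. r ^ i) = (\<Sum>i\<in>(\<lambda>i. i - n) ` X. r ^ (i + n))"
    using X(2) by (intro sum.reindex_bij_witness[of _ "\<lambda>i. i + n" "\<lambda>i. i - n"]) auto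
  also have "\<dots> = (\<Sum>i\<in>(\<lambda>i. i - n) ` X. r ^ i) * r ^ n"
    by (simp add: power_add sum_distrib_right)
  also have "\<dots> \<le> (\<Sum>i. r ^ i) * r ^ n"
    using r X(1) by (intro mult_right_mono sum_le_suminf summable_geometric) auto
  also have "\<dots> = r ^ n / (1 - r)"
    using r by (subst suminf_geometric) auto
  finally show ?thesis .
qed

text \<open>Each of the two tails is at most \<open>4/15\<close>. The bound \<open>3/4\<close> is what
  \<open>prod_ge_of_sum_kernel_le\<close> asks for.\<close>

lemma sum_geometric_off_diagonal:
  assumes "finite G" "n \<notin> G"
  shows "(\<Sum>m\<in>G. 4 * (1/16) ^ (if m < n then n - m else m - n)) \<le> (3/4 :: real)"
proof -
  let ?r = "1/16 :: real"
  have "(\<Sum>m\<in>G. ?r ^ (if m < n then n - m else m - n))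
      = (\<Sum>m\<in>G \<inter> {..<n}. ?r ^ (n - m)) + (\<Sum>m\<in>G \<inter> {n<..}. ?r ^ (m - n))"
  proof -
    have "m < n \<or> n < m" if "m \<in> G" for m
      using assms(2) that by (metis nat_neq_iff)
    then have "G = (G \<inter> {..<n}) \<union> (G \<inter> {n<..})"
      by auto
    then have "(\<Sum>m\<in>G. ?r ^ (if m < n then n - m else m - n))
      = (\<Sum>m\<in>(G \<inter> {..<n}) \<union> (G \<inter> {n<..}). ?r ^ (if m < n then n - m else m - n))"
      by simp
    also have "\<dots> = (\<Sum>m\<in>G \<inter> {..<n}. ?r ^ (if m < n then n - m else m - n))
        + (\<Sum>m\<in>G \<inter> {n<..}. ?r ^ (if m < n then n - m else m - n))"
      using assms(1) by (intro sum.union_disjoint) auto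
    also have "\<dots> = (\<Sum>m\<in>G \<inter> {..<n}. ?r ^ (n - m)) + (\<Sum>m\<in>G \<inter> {n<..}. ?r ^ (m - n))"
      by (intro arg_cong2[of _ _ _ _ "(+)"] sum.cong) auto
    finally show ?thesis .
  qed
  also have "(\<Sum>m\<in>G \<inter> {..<n}. ?r ^ (n - m)) = (\<Sum>i\<in>(\<lambda>m. n - m) ` (G \<inter> {..<n}). ?r ^ i)"
    by (subst sum.reindex) (auto simp: inj_on_def)
  also have "\<dots> \<le> ?r ^ 1 / (1 - ?r)"
    using assms(1) by (intro geometric_tail_bound) auto
  also have "(\<Sum>m\<in>G \<inter> {n<..}. ?r ^ (m - n)) = (\<Sum>i\<in>(\<lambda>m. m - n) ` (G \<inter> {n<..}). ?r ^ i)"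
    by (subst sum.reindex) (auto simp: inj_on_def)
  also have "\<dots> \<le> ?r ^ 1 / (1 - ?r)"
    using assms(1) by (intro geometric_tail_bound) auto
  finally show ?thesis by (simp add: sum_distrib_left[symmetric])
qed

text \<open>The usual proof obtains a uniform interpolation constant from the open mapping theorem. Here a
  gliding hump replaces it. For a single index \<open>k\<close> the product of the distances to
  the other points is positive, by interpolation of the indicator of \<open>k\<close>. If these
  products had infimum 0, one could choose indices \<open>\<kappa> n\<close> whose products tend
  to 0 but whose points approach the circle so quickly that, among themselves, they have products
  at least \<open>1/2\<close>. A bounded function interpolating the indicator of the range of
  \<open>\<kappa>\<close> vanishes at all the other points, where nearly all of the smallness
  comes from; by \<open>blaschke_bound\<close> it cannot take the value 1 at every
  \<open>\<Lambda> (\<kappa> n)\<close>.\<close>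

lemma carleson_sequence_uniformly_separated:
  assumes C: "carleson_sequence J \<Lambda>"
  obtains \<delta> where "0 < \<delta>" "\<delta> \<le> 1"
    "\<And>k F. k \<in> J \<Longrightarrow> finite F \<Longrightarrow> F \<subseteq> J - {k} \<Longrightarrow> \<delta> \<le> (\<Prod>j\<in>F. pseudohyperbolic (\<Lambda> k) (\<Lambda> j))"
proof -
  have D: "cmod (\<Lambda> j) < 1" if "j \<in> J" for j
    using C that by (auto simp: carleson_sequence_def)
  have interp: "\<exists>f M. f holomorphic_on ball 0 1 \<and> (\<forall>z. cmod z < 1 \<longrightarrow> cmod (f z) \<le> M) \<and>
      (\<forall>j\<in>J. f (\<Lambda> j) = (if j \<in> A then 1 else 0))" for A
  proof -
    have "bounded ((\<lambda>j. if j \<in> A then 1 else 0 :: complex) ` J)"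
      by (rule boundedI[of _ 1]) auto
    then obtain f where f: "f \<in> H_infinity" "\<forall>j\<in>J. (if j \<in> A then 1 else 0) = f (\<Lambda> j)"
      using C unfolding carleson_sequence_def by blast
    from f(1) obtain M where "\<forall>x\<in>f ` unit_disc. cmod x \<le> M"
      unfolding H_infinity_def bounded_iff by blast
    then show ?thesis using f unfolding H_infinity_def
      by (intro exI[of _ f] exI[of _ M]) auto
  qed
  have inj: "inj_on \<Lambda> J"
  proof (rule inj_onI)
    fix i j assume ij: "i \<in> J" "j \<in> J" "\<Lambda> i = \<Lambda> j"
    show "i = j" using interp[of "{i}"] ij by (metis singletonD singletonI zero_neq_one)
  qed
  have bound: "1 \<le> M * (\<Prod>j\<in>F. pseudohyperbolic (\<Lambda> k) (\<Lambda> j))"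
    if "f holomorphic_on ball 0 1" "\<forall>z. cmod z < 1 \<longrightarrow> cmod (f z) \<le> M"
      "\<forall>j\<in>J. f (\<Lambda> j) = (if j \<in> A then 1 else 0)" "k \<in> J" "k \<in> A" "finite F" "F \<subseteq> J - A" for f M A k F
  proof -
    have "cmod (f (\<Lambda> k)) \<le> M * (\<Prod>j\<in>F. pseudohyperbolic (\<Lambda> k) (\<Lambda> j))"
      using that D by (intro blaschke_bound inj_on_subset[OF inj]) auto
    then show ?thesis using that by simp
  qed
  have pointwise: "\<exists>d>0. \<forall>F. finite F \<longrightarrow> F \<subseteq> J - {k} \<longrightarrow> d \<le> (\<Prod>j\<in>F. pseudohyperbolic (\<Lambda> k) (\<Lambda> j))"
    if k: "k \<in> J" for k
  proof -
    obtain f M where f: "f holomorphic_on ball 0 1" "\<forall>z. cmod z < 1 \<longrightarrow> cmod (f z) \<le> M"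
      "\<forall>j\<in>J. f (\<Lambda> j) = (if j \<in> {k} then 1 else 0)" using interp[of "{k}"] by blast
    have "1 \<le> M" using bound[OF f, of k "{}"] k by simp
    then show ?thesis using bound[OF f, of k] k
      by (intro exI[of _ "1/M"]) (auto simp: field_simps)
  qed
  have fin: "finite {j \<in> J. s \<le> 1 - cmod (\<Lambda> j)}" if s: "s > 0" for s
  proof (rule ccontr)
    assume inf: "infinite {j \<in> J. s \<le> 1 - cmod (\<Lambda> j)}"
    then obtain k where k: "k \<in> J" by (metis (no_types, lifting) Collect_empty_eq finite.emptyI)
    obtain d where d: "d > 0"
      "\<And>F. finite F \<Longrightarrow> F \<subseteq> J - {k} \<Longrightarrow> d \<le> (\<Prod>j\<in>F. pseudohyperbolic (\<Lambda> k) (\<Lambda> j))"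
      using pointwise[OF k] by blast
    define c where "c = s * (1 - (cmod (\<Lambda> k))\<^sup>2) / 4"
    have c: "c > 0" unfolding c_def using s D[OF k] by (simp add: abs_square_less_1)
    obtain n :: nat where n: "real n * c > - 2 * ln d"
      using c by (metis reals_Archimedean3)
    have "infinite ({j \<in> J. s \<le> 1 - cmod (\<Lambda> j)} - {k})" using inf by simp
    then obtain F where F: "F \<subseteq> {j \<in> J. s \<le> 1 - cmod (\<Lambda> j)} - {k}" "finite F" "card F = n"
      using infinite_arbitrarily_large[of _ n] by blast
    have "c \<le> hyp_kernel (\<Lambda> k) (\<Lambda> j)" if "j \<in> F" for j
    proof -
      have j: "j \<in> J" "s \<le> 1 - cmod (\<Lambda> j)" using that F(1) by auto
      have "(cmod (\<Lambda> j))\<^sup>2 \<le> cmod (\<Lambda> j)"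
        using D[OF j(1)] by (simp add: power2_eq_square mult_left_le)
      then have "s \<le> 4 * hyp_kernel (\<Lambda> k) (\<Lambda> j) / (1 - (cmod (\<Lambda> k))\<^sup>2)"
        using one_minus_cmod_sq_le_hyp_kernel[OF D[OF k] D[OF j(1)]] j(2) by linarith
      moreover have "1 - (cmod (\<Lambda> k))\<^sup>2 > 0" using D[OF k] by (simp add: abs_square_less_1)
      ultimately show ?thesis by (simp add: c_def field_simps)
    qed
    then have "real n * c \<le> (\<Sum>j\<in>F. hyp_kernel (\<Lambda> k) (\<Lambda> j))"
      using sum_bounded_below[of F c "\<lambda>j. hyp_kernel (\<Lambda> k) (\<Lambda> j)"] F(3) by simp
    also have "\<dots> \<le> - 2 * ln d"
    proof (rule sum_kernel_le_of_prod_ge[OF F(2) d(1)])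
      show "d \<le> (\<Prod>j\<in>F. pseudohyperbolic (\<Lambda> k) (\<Lambda> j))"
        by (rule d(2)[OF F(2)]) (use F(1) in blast)
    qed
    finally show False using n by simp
  qed
  have "\<exists>\<delta>. 0 < \<delta> \<and> \<delta> \<le> 1 \<and> (\<forall>k F. k \<in> J \<longrightarrow> finite F \<longrightarrow> F \<subseteq> J - {k} \<longrightarrow>
      \<delta> \<le> (\<Prod>j\<in>F. pseudohyperbolic (\<Lambda> k) (\<Lambda> j)))"
  proof (rule ccontr)
    assume "\<not> ?thesis"
    then have neg: "\<exists>k F. k \<in> J \<and> finite F \<and> F \<subseteq> J - {k} \<and>
        (\<Prod>j\<in>F. pseudohyperbolic (\<Lambda> k) (\<Lambda> j)) < \<epsilon>" if "0 < \<epsilon>" "\<epsilon> \<le> 1" for \<epsilon>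
      using that by (meson not_le)
    have select: "\<exists>k\<in>J. 1 - cmod (\<Lambda> k) \<le> s \<and> (\<exists>F. finite F \<and> F \<subseteq> J - {k} \<and>
        (\<Prod>j\<in>F. pseudohyperbolic (\<Lambda> k) (\<Lambda> j)) < \<epsilon>)" if "0 < \<epsilon>" "0 < s" for \<epsilon> s
    proof -
      define T where "T = {j \<in> J. s \<le> 1 - cmod (\<Lambda> j)}"
      have "\<forall>k\<in>T. \<exists>d>0. \<forall>F. finite F \<longrightarrow> F \<subseteq> J - {k} \<longrightarrow> d \<le> (\<Prod>j\<in>F. pseudohyperbolic (\<Lambda> k) (\<Lambda> j))"
        using pointwise by (auto simp: T_def)
      then obtain d where d: "\<And>k. k \<in> T \<Longrightarrow> d k > 0"
        "\<And>k F. k \<in> T \<Longrightarrow> finite F \<Longrightarrow> F \<subseteq> J - {k} \<Longrightarrow> d k \<le> (\<Prod>j\<in>F. pseudohyperbolic (\<Lambda> k) (\<Lambda> j))"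
        by metis
      have finT: "finite T" unfolding T_def using fin that by blast
      \<comment> \<open>Only finitely many points lie at distance at least \<open>s\<close> from the
        circle, and their products have a positive minimum.\<close>
      define \<epsilon>' where "\<epsilon>' = Min (insert (min \<epsilon> 1) (d ` T))"
      have "\<epsilon>' > 0" unfolding \<epsilon>'_def using finT d(1) that by (subst Min_gr_iff) auto
      moreover have le: "\<epsilon>' \<le> min \<epsilon> 1" "\<And>k. k \<in> T \<Longrightarrow> \<epsilon>' \<le> d k"
        unfolding \<epsilon>'_def using finT by (meson Min_le finite_imageI finite_insert insertI1 insertI2 imageI)+
      ultimately obtain k F where kF: "k \<in> J" "finite F" "F \<subseteq> J - {k}"
        "(\<Prod>j\<in>F. pseudohyperbolic (\<Lambda> k) (\<Lambda> j)) < \<epsilon>'" using neg[of \<epsilon>'] by auto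
      have "k \<notin> T" using d(2)[of k F] kF le(2)[of k] by fastforce
      then show ?thesis using kF le(1) unfolding T_def
        by (intro bexI[of _ k] conjI exI[of _ F]) auto
    qed
    \<comment> \<open>The ratio 16 keeps the kernel sums among the chosen points below
      \<open>3/4\<close>.\<close>
    have "\<exists>\<kappa>. \<forall>n. (\<kappa> n \<in> J \<and> (\<exists>F. finite F \<and> F \<subseteq> J - {\<kappa> n} \<and>
        (\<Prod>j\<in>F. pseudohyperbolic (\<Lambda> (\<kappa> n)) (\<Lambda> j)) < 1 / (real n + 1))) \<and>
        1 - cmod (\<Lambda> (\<kappa> (Suc n))) \<le> (1 - cmod (\<Lambda> (\<kappa> n))) / 16"
    proof (rule dependent_nat_choice, goal_cases)
      case 1
      then show ?case using select[of 1 1] by auto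
    next
      case (2 k n)
      then show ?case using select[of "1 / (real (Suc n) + 1)" "(1 - cmod (\<Lambda> k)) / 16"] D[of k] by auto
    qed
    then obtain \<kappa> where \<kappa>: "\<And>n. \<kappa> n \<in> J" "\<And>n. \<exists>F. finite F \<and> F \<subseteq> J - {\<kappa> n} \<and>
        (\<Prod>j\<in>F. pseudohyperbolic (\<Lambda> (\<kappa> n)) (\<Lambda> j)) < 1 / (real n + 1)"
      "\<And>n. 1 - cmod (\<Lambda> (\<kappa> (Suc n))) \<le> (1 - cmod (\<Lambda> (\<kappa> n))) / 16" by blast
    have decay: "1 - cmod (\<Lambda> (\<kappa> (n + m))) \<le> (1/16) ^ m * (1 - cmod (\<Lambda> (\<kappa> n)))" for n m
    proof (induction m)
      case (Suc m)
      then show ?case using \<kappa>(3)[of "n + m"] by simp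
    qed simp
    have kernel: "hyp_kernel (\<Lambda> (\<kappa> n)) (\<Lambda> (\<kappa> m)) \<le> 4 * (1/16) ^ (if m < n then n - m else m - n)"
      for n m
    proof -
      have *: "hyp_kernel (\<Lambda> (\<kappa> n)) (\<Lambda> (\<kappa> (n + i))) \<le> 4 * (1/16) ^ i" for n i
      proof -
        have "(1 - cmod (\<Lambda> (\<kappa> (n + i)))) / (1 - cmod (\<Lambda> (\<kappa> n))) \<le> (1/16) ^ i"
          using decay[of n i] D[OF \<kappa>(1)[of n]] by (simp add: field_simps)
        then show ?thesis
          using hyp_kernel_le_ratio[OF D[OF \<kappa>(1)[of n]] D[OF \<kappa>(1)[of "n + i"]]] by linarith
      qed
      show ?thesis using *[of n "m - n"] *[of m "n - m"]
        by (cases "m < n") (auto simp: hyp_kernel_commute)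
    qed
    have injk: "inj \<kappa>"
    proof (rule linorder_injI)
      fix n m :: nat assume "n < m"
      then obtain i where i: "m = n + Suc i" using less_iff_Suc_add by auto
      have "(1/16::real) ^ Suc i < 1" by (rule power_Suc_less_one) auto
      then have "(1/16) ^ Suc i * (1 - cmod (\<Lambda> (\<kappa> n))) < 1 * (1 - cmod (\<Lambda> (\<kappa> n)))"
        using D[OF \<kappa>(1)[of n]] by (intro mult_strict_right_mono) auto
      then show "\<kappa> n \<noteq> \<kappa> m" using decay[of n "Suc i"] i by auto
    qed
    obtain f M where f: "f holomorphic_on ball 0 1" "\<forall>z. cmod z < 1 \<longrightarrow> cmod (f z) \<le> M"
      "\<forall>j\<in>J. f (\<Lambda> j) = (if j \<in> range \<kappa> then 1 else 0)" using interp[of "range \<kappa>"] by blast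
    have "real n + 1 \<le> 2 * M" for n
    proof -
      obtain F where F: "finite F" "F \<subseteq> J - {\<kappa> n}"
        "(\<Prod>j\<in>F. pseudohyperbolic (\<Lambda> (\<kappa> n)) (\<Lambda> j)) < 1 / (real n + 1)" using \<kappa>(2) by blast
      define G where "G = \<kappa> -` F"
      have G: "finite G" "n \<notin> G" "F \<inter> range \<kappa> = \<kappa> ` G"
        using F injk by (auto simp: G_def intro: finite_vimageI)
      let ?r = "\<lambda>j. pseudohyperbolic (\<Lambda> (\<kappa> n)) (\<Lambda> j)"
      have "(\<Sum>j\<in>\<kappa> ` G. hyp_kernel (\<Lambda> (\<kappa> n)) (\<Lambda> j)) = (\<Sum>m\<in>G. hyp_kernel (\<Lambda> (\<kappa> n)) (\<Lambda> (\<kappa> m)))"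
        using injk by (subst sum.reindex) (auto simp: inj_on_def)
      also have "\<dots> \<le> (\<Sum>m\<in>G. 4 * (1/16) ^ (if m < n then n - m else m - n))"
        by (intro sum_mono kernel)
      also have "\<dots> \<le> 3/4" by (rule sum_geometric_off_diagonal[OF G(1,2)])
      finally have half: "1/2 \<le> (\<Prod>j\<in>F \<inter> range \<kappa>. ?r j)"
        unfolding G(3) using G(1) D \<kappa>(1)
        by (intro prod_ge_of_sum_kernel_le) (auto intro!: pseudohyperbolic_le_1 less_imp_le[OF D])
      have M: "1 \<le> M * (\<Prod>j\<in>F - range \<kappa>. ?r j)"
        using F by (intro bound[OF f]) (auto simp: \<kappa>)
      have M0: "M > 0"
        using M by (metis less_le_trans mult_nonpos_nonneg not_le prod_nonneg pseudohyperbolic_nonneg zero_less_one)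
      have "1 * (1/2) \<le> (M * (\<Prod>j\<in>F - range \<kappa>. ?r j)) * (\<Prod>j\<in>F \<inter> range \<kappa>. ?r j)"
        using M half by (intro mult_mono) auto
      also have "\<dots> = M * ((\<Prod>j\<in>F \<inter> range \<kappa>. ?r j) * (\<Prod>j\<in>F - range \<kappa>. ?r j))" by simp
      also have "\<dots> = M * (\<Prod>j\<in>F. ?r j)"
        by (subst prod.Int_Diff[OF F(1), of _ "range \<kappa>"]) simp
      also have "\<dots> \<le> M * (1 / (real n + 1))"
        using F(3) M0 by (intro mult_left_mono) auto
      finally show ?thesis by (simp add: field_simps)
    qed
    moreover obtain n :: nat where "real n > 2 * M" using reals_Archimedean2 by blast
    ultimately show False by (smt (verit))
  qed
  then show thesis using that by blast
qed

text \<open>Near \<open>\<Lambda> k\<close> the product without the \<open>k\<close>-th factor stays close to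
  its value at \<open>\<Lambda> k\<close>, by \<open>bounded_holomorphic_lipschitz\<close>; the
  radius \<open>\<delta>/4\<close> makes the loss at most \<open>\<delta>/2\<close>. Hence the
  full product is at least \<open>\<delta>/4 * \<delta>/2\<close> on the boundary circles of these
  discs. Outside the discs the product has no zeros and modulus 1 on the unit circle, so the
  maximum principle for its inverse spreads the bound.\<close>

lemma
  assumes F: "finite F" "\<And>j. j \<in> F \<Longrightarrow> cmod (\<Lambda> j) < 1"
    and \<delta>: "0 < \<delta>" "\<delta> \<le> 1"
    and sep: "\<And>k. k \<in> F \<Longrightarrow> \<delta> \<le> (\<Prod>j\<in>F - {k}. pseudohyperbolic (\<Lambda> k) (\<Lambda> j))"
    and z: "cmod z < 1"
  shows blaschke_product_near: "\<And>k. k \<in> F \<Longrightarrow> pseudohyperbolic z (\<Lambda> k) \<le> \<delta>/4 \<Longrightarrow>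
      \<delta>/2 \<le> (\<Prod>j\<in>F - {k}. pseudohyperbolic z (\<Lambda> j))"
    and blaschke_product_far: "(\<And>j. j \<in> F \<Longrightarrow> \<delta>/4 < pseudohyperbolic z (\<Lambda> j)) \<Longrightarrow>
      \<delta>\<^sup>2/8 \<le> (\<Prod>j\<in>F. pseudohyperbolic z (\<Lambda> j))"
proof -
  define B where "B = (\<lambda>G z. \<Prod>j\<in>G. Moebius_function 0 (\<Lambda> j) z)"
  have Bn: "cmod (B G z) = (\<Prod>j\<in>G. pseudohyperbolic z (\<Lambda> j))" for G z
    by (simp add: B_def prod_norm[symmetric] Moebius_norm)
  have holB: "B G holomorphic_on ball 0 1" if "G \<subseteq> F" for G
    unfolding B_def using F that by (intro holomorphic_on_prod Moebius_holomorphic) auto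
  have contB: "continuous_on (cball 0 1) (B G)" if "G \<subseteq> F" for G
    unfolding B_def using F that by (intro continuous_on_prod Moebius_continuous_on_cball) auto
  have B1: "cmod (B G w) \<le> 1" if "G \<subseteq> F" "cmod w < 1" for G w
    unfolding Bn using that F(2)
    by (intro prod_le_1 conjI pseudohyperbolic_le_1) (auto intro: less_imp_le)
  have near: "\<delta>/2 \<le> (\<Prod>j\<in>F - {k}. pseudohyperbolic z (\<Lambda> j))"
    if k: "k \<in> F" "pseudohyperbolic z (\<Lambda> k) \<le> \<delta>/4" and z: "cmod z < 1" for k z
  proof -
    have "cmod (B (F - {k}) z - B (F - {k}) (\<Lambda> k)) \<le> 2 * pseudohyperbolic z (\<Lambda> k)"
      using F z k by (intro bounded_holomorphic_lipschitz holB B1) auto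
    moreover have "\<delta> \<le> cmod (B (F - {k}) (\<Lambda> k))" using sep[OF k(1)] by (simp add: Bn)
    ultimately have "\<delta>/2 \<le> cmod (B (F - {k}) z)"
      using k(2) norm_triangle_ineq2[of "B (F - {k}) (\<Lambda> k)" "B (F - {k}) z"]
      by (simp add: norm_minus_commute)
    then show ?thesis by (simp add: Bn)
  qed
  show "\<delta>/2 \<le> (\<Prod>j\<in>F - {k}. pseudohyperbolic z (\<Lambda> j))"
    if "k \<in> F" "pseudohyperbolic z (\<Lambda> k) \<le> \<delta>/4" for k
    using near[OF that z] .
  assume far: "\<And>j. j \<in> F \<Longrightarrow> \<delta>/4 < pseudohyperbolic z (\<Lambda> j)"
  define U where "U = ball 0 1 \<inter> (\<Inter>j\<in>F. {w \<in> ball 0 1. \<delta>/4 < cmod (Moebius_function 0 (\<Lambda> j) w)})"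
  define V where "V = cball 0 1 \<inter> (\<Inter>j\<in>F. {w \<in> cball 0 1. \<delta>/4 \<le> cmod (Moebius_function 0 (\<Lambda> j) w)})"
  have "open {w \<in> ball 0 1. \<delta>/4 < cmod (Moebius_function 0 (\<Lambda> j) w)}" if "j \<in> F" for j
  proof -
    have "continuous_on (ball 0 1) (\<lambda>w. cmod (Moebius_function 0 (\<Lambda> j) w))"
      using F(2)[OF that]
      by (intro continuous_on_norm holomorphic_on_imp_continuous_on Moebius_holomorphic)
    then have "open ((\<lambda>w. cmod (Moebius_function 0 (\<Lambda> j) w)) -` {\<delta>/4<..} \<inter> ball 0 1)"
      using continuous_on_open_vimage[OF open_ball] open_greaterThan by blast
    moreover have "(\<lambda>w. cmod (Moebius_function 0 (\<Lambda> j) w)) -` {\<delta>/4<..} \<inter> ball 0 1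
        = {w \<in> ball 0 1. \<delta>/4 < cmod (Moebius_function 0 (\<Lambda> j) w)}" by auto
    ultimately show ?thesis by simp
  qed
  then have opU: "open U" unfolding U_def using F(1) by (intro open_Int open_INT) auto
  have "closed {w \<in> cball 0 1. \<delta>/4 \<le> cmod (Moebius_function 0 (\<Lambda> j) w)}" if "j \<in> F" for j
  proof -
    have "continuous_on (cball 0 1) (\<lambda>w. cmod (Moebius_function 0 (\<Lambda> j) w))"
      using F(2)[OF that] by (intro continuous_on_norm Moebius_continuous_on_cball)
    then have "closed (cball 0 1 \<inter> (\<lambda>w. cmod (Moebius_function 0 (\<Lambda> j) w)) -` {\<delta>/4..})"
      by (rule continuous_closed_preimage) auto
    moreover have "cball 0 1 \<inter> (\<lambda>w. cmod (Moebius_function 0 (\<Lambda> j) w)) -` {\<delta>/4..}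
        = {w \<in> cball 0 1. \<delta>/4 \<le> cmod (Moebius_function 0 (\<Lambda> j) w)}" by auto
    ultimately show ?thesis by simp
  qed
  then have clV: "closed V" unfolding V_def using F(1) by (intro closed_Int closed_INT) auto
  have "U \<subseteq> V" by (auto simp: U_def V_def less_imp_le)
  then have UV: "closure U \<subseteq> V" using clV by (rule closure_minimal)
  have Bnz: "B F w \<noteq> 0" if "w \<in> V" for w
    using that \<delta> F(1) by (force simp: V_def B_def)
  have "cmod (inverse (B F z)) \<le> 8/\<delta>\<^sup>2"
  proof (rule maximum_modulus_frontier[where f = "\<lambda>w. inverse (B F w)" and S = U and \<xi> = z])
    show "(\<lambda>w. inverse (B F w)) holomorphic_on interior U"
    proof (rule holomorphic_on_inverse)
      show "B F holomorphic_on interior U"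
        by (rule holomorphic_on_subset[OF holB[OF order_refl]]) (use interior_subset in \<open>auto simp: U_def\<close>)
      show "B F w \<noteq> 0" if "w \<in> interior U" for w
        using that interior_subset \<open>U \<subseteq> V\<close> Bnz by blast
    qed
    show "continuous_on (closure U) (\<lambda>w. inverse (B F w))"
    proof (intro continuous_on_inverse)
      show "continuous_on (closure U) (B F)"
        by (rule continuous_on_subset[OF contB[OF order_refl]]) (use UV in \<open>auto simp: V_def\<close>)
      show "\<forall>w\<in>closure U. B F w \<noteq> 0" using UV Bnz by blast
    qed
    show "bounded U" by (rule bounded_subset[OF bounded_ball[of 0 1]]) (auto simp: U_def)
    show "z \<in> U" using z far by (auto simp: U_def Moebius_norm)
    fix w assume "w \<in> frontier U"
    then have w: "w \<in> V" "w \<notin> U" using UV opU by (auto simp: frontier_def interior_open)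
    have "\<delta>\<^sup>2/8 \<le> cmod (B F w)"
    proof (cases "cmod w = 1")
      case True
      then have "cmod (B F w) = 1"
        using F(2) by (simp add: B_def prod_norm[symmetric] Moebius_norm_circle)
      moreover have "\<delta>\<^sup>2 \<le> 1" using \<delta> by (simp add: power_le_one)
      ultimately show ?thesis by simp
    next
      case False
      then have w1: "cmod w < 1" using w(1) by (auto simp: V_def)
      obtain k where k: "k \<in> F" "pseudohyperbolic w (\<Lambda> k) = \<delta>/4"
        using w w1 by (force simp: U_def V_def Moebius_norm)
      have "\<delta>/4 * (\<delta>/2) \<le> pseudohyperbolic w (\<Lambda> k) * (\<Prod>j\<in>F - {k}. pseudohyperbolic w (\<Lambda> j))"
        using near[OF k(1) _ w1] k(2) \<delta> by (intro mult_mono) auto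
      also have "\<dots> = cmod (B F w)"
        unfolding Bn using F(1) k(1) by (simp add: prod.remove)
      finally show ?thesis by (simp add: power2_eq_square)
    qed
    then show "cmod (inverse (B F w)) \<le> 8/\<delta>\<^sup>2"
      unfolding norm_inverse using \<delta> Bnz[OF w(1)] by (simp add: field_simps)
  qed
  moreover have "cmod (B F z) > 0" using far \<delta> by (force simp: Bn intro!: prod_pos)
  ultimately show "\<delta>\<^sup>2/8 \<le> (\<Prod>j\<in>F. pseudohyperbolic z (\<Lambda> j))"
    unfolding norm_inverse Bn[symmetric] using \<delta> by (simp add: field_simps)
qed

text \<open>A lower bound for a Blaschke product at \<open>z\<close> is an upper bound for the kernel sum at
  \<open>z\<close>. If \<open>z\<close> is close to one of the points, that point is left out of
  the product and contributes at most 1 to the sum.\<close>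

theorem carleson_sequence_necessary:
  assumes C: "carleson_sequence J \<Lambda>"
  obtains \<delta> K where "0 < \<delta>" "pseudohyp_separated \<delta> J \<Lambda>" "kernel_bounded K J \<Lambda>"
proof -
  have D: "cmod (\<Lambda> j) < 1" if "j \<in> J" for j
    using C that by (auto simp: carleson_sequence_def)
  obtain \<delta> where \<delta>: "0 < \<delta>" "\<delta> \<le> 1" and sep:
    "\<And>k F. k \<in> J \<Longrightarrow> finite F \<Longrightarrow> F \<subseteq> J - {k} \<Longrightarrow> \<delta> \<le> (\<Prod>j\<in>F. pseudohyperbolic (\<Lambda> k) (\<Lambda> j))"
    using carleson_sequence_uniformly_separated[OF C] by blast
  define K where "K = max (1 - 2 * ln (\<delta>/2)) (- 2 * ln (\<delta>\<^sup>2/8))"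
  show thesis
  proof
    show "0 < \<delta>" by fact
    show "pseudohyp_separated \<delta> J \<Lambda>"
      unfolding pseudohyp_separated_def
    proof (intro ballI impI)
      fix i j assume "i \<in> J" "j \<in> J" "i \<noteq> j"
      then show "\<delta> \<le> pseudohyperbolic (\<Lambda> i) (\<Lambda> j)" using sep[of i "{j}"] by auto
    qed
    show "kernel_bounded K J \<Lambda>"
    proof (rule kernel_boundedI)
      fix z F assume z: "cmod z < 1" and F: "finite F" "F \<subseteq> J"
      have sepF: "\<delta> \<le> (\<Prod>j\<in>F - {k}. pseudohyperbolic (\<Lambda> k) (\<Lambda> j))" if "k \<in> F" for k
        using sep[of k "F - {k}"] that F by blast
      have DF: "cmod (\<Lambda> j) < 1" if "j \<in> F" for j using D F that by blast
      show "(\<Sum>j\<in>F. hyp_kernel z (\<Lambda> j)) \<le> K"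
      proof (cases "\<exists>k\<in>F. pseudohyperbolic z (\<Lambda> k) \<le> \<delta>/4")
        case True
        then obtain k where k: "k \<in> F" "pseudohyperbolic z (\<Lambda> k) \<le> \<delta>/4" by blast
        have "(\<Sum>j\<in>F - {k}. hyp_kernel z (\<Lambda> j)) \<le> - 2 * ln (\<delta>/2)"
          using F \<delta> blaschke_product_near[OF F(1) DF \<delta> sepF z k]
          by (intro sum_kernel_le_of_prod_ge) auto
        moreover have "(\<Sum>j\<in>F. hyp_kernel z (\<Lambda> j))
            = hyp_kernel z (\<Lambda> k) + (\<Sum>j\<in>F - {k}. hyp_kernel z (\<Lambda> j))"
          using F(1) k(1) by (rule sum.remove)
        ultimately have "(\<Sum>j\<in>F. hyp_kernel z (\<Lambda> j)) \<le> 1 - 2 * ln (\<delta>/2)"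
          using hyp_kernel_le_1[of z "\<Lambda> k"] by linarith
        then show ?thesis by (simp add: K_def)
      next
        case False
        have "(\<Sum>j\<in>F. hyp_kernel z (\<Lambda> j)) \<le> - 2 * ln (\<delta>\<^sup>2/8)"
          using F \<delta> blaschke_product_far[OF F(1) DF \<delta> sepF z] False
          by (intro sum_kernel_le_of_prod_ge) (auto simp: not_le)
        then show ?thesis by (simp add: K_def)
      qed
    qed
  qed
qed

section \<open>Separated sequences with bounded kernel sums are interpolating\<close>

text \<open>With the terms ordered by \<open>s\<close>, this is a lower Riemann sum of
  \<open>\<integral> exp (- x) dx\<close> over the half-line. Ties in the order only enlarge the
  tails.\<close>

lemma sum_mult_exp_tail_le_1:
  fixes u s :: "'i \<Rightarrow> real"
  assumes "finite F" "\<And>k. 0 \<le> u k"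
  shows "(\<Sum>k\<in>F. u k * exp (- (\<Sum>m\<in>{m\<in>F. s k \<le> s m}. u m))) \<le> 1"
proof -
  have "(\<Sum>k\<in>F. u k * exp (- (\<Sum>m\<in>{m\<in>F. s k \<le> s m}. u m))) \<le> 1 - exp (- (\<Sum>k\<in>F. u k))"
    using assms(1)
  proof (induction F rule: finite_ranking_induct[where f = "\<lambda>k. - s k"])
    case empty
    then show ?case by simp
  next
    case (insert x S)
    show ?case
    proof (cases "x \<in> S")
      case True
      then show ?thesis using insert by (simp add: insert_absorb)
    next
      case False
      let ?U = "\<Sum>k\<in>S. u k"
      have x: "{m \<in> insert x S. s x \<le> s m} = insert x S" using insert.hyps(2) by auto
      have "(\<Sum>k\<in>S. u k * exp (- (\<Sum>m\<in>{m\<in>insert x S. s k \<le> s m}. u m)))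
          \<le> (\<Sum>k\<in>S. u k * exp (- (\<Sum>m\<in>{m\<in>S. s k \<le> s m}. u m)))"
        using insert.hyps(1) assms(2)
        by (intro sum_mono mult_left_mono) (auto intro!: sum_mono2)
      moreover have "u x * exp (- (u x + ?U)) \<le> exp (- ?U) - exp (- (u x + ?U))"
      proof -
        have "(1 + u x) * exp (- (u x + ?U)) \<le> exp (u x) * exp (- (u x + ?U))"
          by (intro mult_right_mono exp_ge_add_one_self) auto
        also have "\<dots> = exp (- ?U)" by (simp add: exp_add[symmetric])
        finally show ?thesis by (simp add: algebra_simps)
      qed
      ultimately show ?thesis
        using insert.IH unfolding sum.insert[OF insert.hyps(1) False] x by linarith
    qed
  qed
  then show ?thesis using exp_ge_zero[of "- (\<Sum>k\<in>F. u k)"] by linarith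
qed

lemma Re_cayley:
  assumes "w \<noteq> 1"
  shows "Re ((1 + w) / (1 - w)) = (1 - (cmod w)\<^sup>2) / (cmod (1 - w))\<^sup>2"
proof -
  have "(1 + w) / (1 - w) = ((1 + w) * cnj (1 - w)) / of_real ((cmod (1 - w))\<^sup>2)"
    using complex_div_cnj[of "1 + w" "1 - w"] by simp
  then have "Re ((1 + w) / (1 - w)) = Re ((1 + w) * cnj (1 - w)) / (cmod (1 - w))\<^sup>2"
    by (simp only: Re_divide_of_real)
  also have "Re ((1 + w) * cnj (1 - w)) = 1 - (cmod w)\<^sup>2"
    unfolding cmod_power2 by (simp add: power2_eq_square algebra_simps)
  finally show ?thesis .
qed

text \<open>This is P. Jones's explicit formula. The Blaschke quotient
  \<open>b k z / b k (\<Lambda> k)\<close> provides the zeros and the value 1. The square provides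
  the factor \<open>u k\<close>, and the exponential, whose exponent is a sum of Cayley transforms
  over the points at least as close to the circle as \<open>\<Lambda> k\<close>, provides
  \<open>exp (- \<Sum> u m)\<close> over these points. So the sum of all moduli is controlled by
  \<open>sum_mult_exp_tail_le_1\<close>, with a constant that does not depend on the number of
  points.\<close>

lemma jones_interpolation:
  fixes \<Lambda> :: "'i \<Rightarrow> complex"
  assumes F: "finite F" "\<And>j. j \<in> F \<Longrightarrow> cmod (\<Lambda> j) < 1"
    and \<delta>: "0 < \<delta>"
    and sep: "\<And>k. k \<in> F \<Longrightarrow> \<delta> \<le> (\<Prod>j\<in>F - {k}. pseudohyperbolic (\<Lambda> k) (\<Lambda> j))"
    and K: "\<And>k. k \<in> F \<Longrightarrow> (\<Sum>j\<in>F. hyp_kernel (\<Lambda> k) (\<Lambda> j)) \<le> K"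
  obtains G where "\<And>k. k \<in> F \<Longrightarrow> G k holomorphic_on ball 0 1"
    "\<And>k j. k \<in> F \<Longrightarrow> j \<in> F \<Longrightarrow> G k (\<Lambda> j) = (if j = k then 1 else 0)"
    "\<And>z. cmod z < 1 \<Longrightarrow> (\<Sum>k\<in>F. cmod (G k z)) \<le> exp (2 * K) / \<delta>"
proof -
  define b where "b = (\<lambda>k z. \<Prod>j\<in>F - {k}. Moebius_function 0 (\<Lambda> j) z)"
  define h where "h = (\<lambda>m z. (1 + cnj (\<Lambda> m) * z) / (1 - cnj (\<Lambda> m) * z))"
  define A where "A = (\<lambda>k. {m \<in> F. cmod (\<Lambda> k) \<le> cmod (\<Lambda> m)})"
  define E where "E = (\<lambda>k z. \<Sum>m\<in>A k. of_real (1 - (cmod (\<Lambda> m))\<^sup>2) * h m z)"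
  define G where "G = (\<lambda>k z. b k z / b k (\<Lambda> k) *
     (of_real (1 - (cmod (\<Lambda> k))\<^sup>2) / (1 - cnj (\<Lambda> k) * z))\<^sup>2 * exp (E k (\<Lambda> k) - E k z))"
  have nz: "1 - cnj (\<Lambda> k) * z \<noteq> 0" if "k \<in> F" "cmod z < 1" for k z
    using one_minus_cnj_mult_nonzero[OF F(2)[OF that(1)], of z] that(2) by simp
  have one_pos: "0 < 1 - (cmod (\<Lambda> k))\<^sup>2" if "k \<in> F" for k
    using F(2)[OF that] by (simp add: abs_square_less_1)
  have bn: "cmod (b k z) = (\<Prod>j\<in>F - {k}. pseudohyperbolic z (\<Lambda> j))" for k z
    by (simp add: b_def prod_norm[symmetric] Moebius_norm)
  have b_self: "\<delta> \<le> cmod (b k (\<Lambda> k))" if "k \<in> F" for k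
    using sep[OF that] by (simp add: bn)
  have Reh: "Re (h m z) = (1 - (cmod (\<Lambda> m))\<^sup>2 * (cmod z)\<^sup>2) / (cmod (1 - cnj (\<Lambda> m) * z))\<^sup>2"
    if "m \<in> F" "cmod z < 1" for m z
    unfolding h_def using nz[OF that] by (subst Re_cayley) (auto simp: norm_mult power_mult_distrib)
  show thesis
  proof
    fix k assume k: "k \<in> F"
    have AF: "A k \<subseteq> F" by (auto simp: A_def)
    have "h m holomorphic_on ball 0 1" if "m \<in> F" for m
      unfolding h_def using nz[OF that] by (intro holomorphic_intros) auto
    then have "E k holomorphic_on ball 0 1"
      unfolding E_def using AF by (intro holomorphic_intros) auto
    moreover have "b k holomorphic_on ball 0 1"
      unfolding b_def using F(2) by (intro holomorphic_intros Moebius_holomorphic) auto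
    ultimately show "G k holomorphic_on ball 0 1"
      unfolding G_def using nz[OF k] b_self[OF k] \<delta> by (intro holomorphic_intros) auto
  next
    fix k j assume kj: "k \<in> F" "j \<in> F"
    show "G k (\<Lambda> j) = (if j = k then 1 else 0)"
    proof (cases "j = k")
      case True
      have "b k (\<Lambda> k) \<noteq> 0" using b_self[OF kj(1)] \<delta> by auto
      moreover have "of_real (1 - (cmod (\<Lambda> k))\<^sup>2) = 1 - cnj (\<Lambda> k) * \<Lambda> k"
        by (simp only: of_real_diff of_real_1 complex_norm_square) (simp add: mult.commute)
      ultimately show ?thesis
        using True nz[OF kj(1) F(2)[OF kj(1)]] by (simp add: G_def)
    next
      case False
      then have "b k (\<Lambda> j) = 0"
        unfolding b_def using F(1) kj by (intro prod_zero) (auto simp: Moebius_function_simple)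
      then show ?thesis using False by (simp add: G_def)
    qed
  next
    fix z :: complex assume z: "cmod z < 1"
    define u where "u = (\<lambda>m. if m \<in> F then ((1 - (cmod (\<Lambda> m))\<^sup>2) / cmod (1 - cnj (\<Lambda> m) * z))\<^sup>2 else 0)"
    have "cmod (G k z) \<le> exp (2 * K) / \<delta> * (u k * exp (- (\<Sum>m\<in>A k. u m)))" if k: "k \<in> F" for k
    proof -
      \<comment> \<open>The real part of the Cayley term of \<open>\<Lambda> m\<close> at
        \<open>z\<close>, with its weight, is at least \<open>u m\<close>.\<close>
      have lower: "(\<Sum>m\<in>A k. u m) \<le> Re (E k z)"
        unfolding E_def Re_sum
      proof (rule sum_mono)
        fix m assume "m \<in> A k"
        then have m: "m \<in> F" by (simp add: A_def)
        have "(cmod (\<Lambda> m))\<^sup>2 * (cmod z)\<^sup>2 \<le> (cmod (\<Lambda> m))\<^sup>2 * 1"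
          using z by (intro mult_left_mono) (auto simp: abs_square_le_1)
        then have "(1 - (cmod (\<Lambda> m))\<^sup>2) / (cmod (1 - cnj (\<Lambda> m) * z))\<^sup>2 \<le> Re (h m z)"
          unfolding Reh[OF m z] by (intro divide_right_mono) auto
        then have "(1 - (cmod (\<Lambda> m))\<^sup>2) * ((1 - (cmod (\<Lambda> m))\<^sup>2) / (cmod (1 - cnj (\<Lambda> m) * z))\<^sup>2)
            \<le> (1 - (cmod (\<Lambda> m))\<^sup>2) * Re (h m z)"
          using one_pos[OF m] by (intro mult_left_mono) auto
        then show "u m \<le> Re (of_real (1 - (cmod (\<Lambda> m))\<^sup>2) * h m z)"
          using m by (simp add: u_def power_divide power2_eq_square)
      qed
      have upper: "Re (E k (\<Lambda> k)) \<le> 2 * K"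
      proof -
        have "Re (E k (\<Lambda> k)) \<le> (\<Sum>m\<in>A k. 2 * hyp_kernel (\<Lambda> k) (\<Lambda> m))"
          unfolding E_def Re_sum
        proof (rule sum_mono)
          fix m assume "m \<in> A k"
          then have m: "m \<in> F" "cmod (\<Lambda> k) \<le> cmod (\<Lambda> m)" by (auto simp: A_def)
          \<comment> \<open>This is where the ordering by modulus enters: for \<open>cmod (\<Lambda> m) \<ge> cmod (\<Lambda> k)\<close> the
             real part of the Cayley term at \<open>\<Lambda> k\<close> is at most twice the kernel.\<close>
          have "(cmod (\<Lambda> k))\<^sup>2 * (cmod (\<Lambda> k))\<^sup>2 \<le> (cmod (\<Lambda> m))\<^sup>2 * (cmod (\<Lambda> k))\<^sup>2"
            using m(2) by (intro mult_right_mono power_mono) auto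
          moreover have "0 \<le> (1 - (cmod (\<Lambda> k))\<^sup>2) * (1 - (cmod (\<Lambda> k))\<^sup>2)" by simp
          ultimately have le: "1 - (cmod (\<Lambda> m))\<^sup>2 * (cmod (\<Lambda> k))\<^sup>2 \<le> 2 * (1 - (cmod (\<Lambda> k))\<^sup>2)"
            by (simp add: algebra_simps)
          have "Re (of_real (1 - (cmod (\<Lambda> m))\<^sup>2) * h m (\<Lambda> k)) = (1 - (cmod (\<Lambda> m))\<^sup>2) *
              (1 - (cmod (\<Lambda> m))\<^sup>2 * (cmod (\<Lambda> k))\<^sup>2) / (cmod (1 - cnj (\<Lambda> m) * \<Lambda> k))\<^sup>2"
            using Reh[OF m(1) F(2)[OF k]] by simp
          also have "\<dots> \<le> (1 - (cmod (\<Lambda> m))\<^sup>2) *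
              (2 * (1 - (cmod (\<Lambda> k))\<^sup>2)) / (cmod (1 - cnj (\<Lambda> m) * \<Lambda> k))\<^sup>2"
            using le one_pos[OF m(1)] by (intro divide_right_mono mult_left_mono) auto
          also have "\<dots> = 2 * hyp_kernel (\<Lambda> m) (\<Lambda> k)"
            using F(2) m(1) k by (subst hyp_kernel_eq) (auto simp: less_imp_le)
          finally show "Re (of_real (1 - (cmod (\<Lambda> m))\<^sup>2) * h m (\<Lambda> k)) \<le> 2 * hyp_kernel (\<Lambda> k) (\<Lambda> m)"
            by (simp add: hyp_kernel_commute)
        qed
        also have "\<dots> \<le> (\<Sum>m\<in>F. 2 * hyp_kernel (\<Lambda> k) (\<Lambda> m))"
        proof (rule sum_mono2[OF F(1)])
          show "A k \<subseteq> F" by (auto simp: A_def)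
          show "0 \<le> 2 * hyp_kernel (\<Lambda> k) (\<Lambda> m)" if "m \<in> F - A k" for m
            using hyp_kernel_nonneg[of "\<Lambda> k" "\<Lambda> m"] F(2) k that by (auto simp: less_imp_le)
        qed
        also have "\<dots> \<le> 2 * K" using K[OF k] unfolding sum_distrib_left[symmetric] by simp
        finally show ?thesis .
      qed
      have "cmod (b k z) \<le> 1"
        unfolding bn using F(2) z
        by (intro prod_le_1 conjI pseudohyperbolic_le_1) (auto intro: less_imp_le)
      then have "cmod (b k z) / cmod (b k (\<Lambda> k)) \<le> 1 / \<delta>"
        using b_self[OF k] \<delta> by (intro frac_le) auto
      moreover have "cmod ((of_real (1 - (cmod (\<Lambda> k))\<^sup>2) / (1 - cnj (\<Lambda> k) * z))\<^sup>2) = u k"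
        using k one_pos[OF k] by (simp only: norm_power norm_divide norm_of_real u_def) simp
      moreover have "cmod (exp (E k (\<Lambda> k) - E k z)) \<le> exp (2 * K) * exp (- (\<Sum>m\<in>A k. u m))"
        using lower upper by (simp add: exp_add[symmetric])
      moreover have "cmod (G k z) = cmod (b k z) / cmod (b k (\<Lambda> k)) *
         cmod ((of_real (1 - (cmod (\<Lambda> k))\<^sup>2) / (1 - cnj (\<Lambda> k) * z))\<^sup>2) * cmod (exp (E k (\<Lambda> k) - E k z))"
        by (simp only: G_def norm_mult norm_divide)
      ultimately have "cmod (G k z) \<le> 1 / \<delta> * u k * (exp (2 * K) * exp (- (\<Sum>m\<in>A k. u m)))"
        using \<delta> by (simp only:) (intro mult_mono mult_nonneg_nonneg; simp add: u_def)
      then show ?thesis by (simp add: mult_ac)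
    qed
    then have "(\<Sum>k\<in>F. cmod (G k z)) \<le> (\<Sum>k\<in>F. exp (2 * K) / \<delta> * (u k * exp (- (\<Sum>m\<in>A k. u m))))"
      by (rule sum_mono)
    also have "\<dots> = exp (2 * K) / \<delta> * (\<Sum>k\<in>F. u k * exp (- (\<Sum>m\<in>A k. u m)))"
      by (simp only: sum_distrib_left)
    also have "\<dots> \<le> exp (2 * K) / \<delta> * 1"
      unfolding A_def using \<delta> F(1)
      by (intro mult_left_mono sum_mult_exp_tail_le_1) (auto simp: u_def)
    finally show "(\<Sum>k\<in>F. cmod (G k z)) \<le> exp (2 * K) / \<delta>" by simp
  qed
qed

text \<open>Since \<open>\<rho> \<ge> \<delta>\<close>, one has
  \<open>- ln (\<rho>\<^sup>2) \<le> (1 - \<rho>\<^sup>2) / \<delta>\<^sup>2\<close>; the kernel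
  sum thus controls the logarithm of the product.\<close>

lemma prod_ge_of_separated:
  assumes F: "finite F" and \<delta>: "0 < \<delta>" "\<And>j. j \<in> F \<Longrightarrow> \<delta> \<le> pseudohyperbolic z (\<Lambda> j)"
    and K: "(\<Sum>j\<in>F. hyp_kernel z (\<Lambda> j)) \<le> K" and le1: "\<And>j. j \<in> F \<Longrightarrow> pseudohyperbolic z (\<Lambda> j) \<le> 1"
  shows "exp (- K / \<delta>\<^sup>2 / 2) \<le> (\<Prod>j\<in>F. pseudohyperbolic z (\<Lambda> j))"
proof (rule power2_le_imp_le)
  have "(exp (- K / \<delta>\<^sup>2 / 2))\<^sup>2 = exp (- K / \<delta>\<^sup>2)"
    by (simp add: exp_double[symmetric])
  also have "\<dots> \<le> exp (\<Sum>j\<in>F. - hyp_kernel z (\<Lambda> j) / \<delta>\<^sup>2)"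
    using K \<delta>(1) by (simp only: exp_le_cancel_iff sum_negf sum_divide_distrib[symmetric] minus_divide_left[symmetric])
      (simp add: divide_right_mono)
  also have "\<dots> = (\<Prod>j\<in>F. exp (- hyp_kernel z (\<Lambda> j) / \<delta>\<^sup>2))"
    using F by (simp only: exp_sum)
  also have "\<dots> \<le> (\<Prod>j\<in>F. (pseudohyperbolic z (\<Lambda> j))\<^sup>2)"
  proof (intro prod_mono conjI)
    fix j assume j: "j \<in> F"
    define r where "r = (pseudohyperbolic z (\<Lambda> j))\<^sup>2"
    have r: "\<delta>\<^sup>2 \<le> r" "r > 0" "r \<le> 1"
      using \<delta>(1) \<delta>(2)[OF j] le1[OF j] unfolding r_def by (auto intro!: power_mono simp: power_le_one)
    have "ln (1 / r) \<le> 1 / r - 1" using r by (intro ln_le_minus_one) auto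
    also have "\<dots> = (1 - r) / r" using r by (simp add: field_simps)
    also have "\<dots> \<le> (1 - r) / \<delta>\<^sup>2" using r \<delta>(1) by (intro divide_left_mono) auto
    finally have "- (1 - r) / \<delta>\<^sup>2 \<le> ln r"
      using r unfolding minus_divide_left[symmetric] by (simp add: ln_div)
    then have "exp (- (1 - r) / \<delta>\<^sup>2) \<le> r" using r(2) by (metis exp_le_cancel_iff exp_ln)
    then show "exp (- hyp_kernel z (\<Lambda> j) / \<delta>\<^sup>2) \<le> (pseudohyperbolic z (\<Lambda> j))\<^sup>2"
      by (simp add: r_def)
  qed auto
  finally show "(exp (- K / \<delta>\<^sup>2 / 2))\<^sup>2 \<le> (\<Prod>j\<in>F. pseudohyperbolic z (\<Lambda> j))\<^sup>2"
    by (simp add: prod_power_distrib)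
qed (auto intro: prod_nonneg)

text \<open>Jones's functions solve the problem on the first \<open>n\<close> points with a bound independent
  of \<open>n\<close>; Montel's theorem gives a limit that solves it on all points.\<close>

theorem carleson_sequence_sufficient:
  assumes D: "\<Lambda> ` J \<subseteq> unit_disc"
    and \<delta>: "0 < \<delta>" and sep: "pseudohyp_separated \<delta> J \<Lambda>" and K: "kernel_bounded K J \<Lambda>"
  shows "carleson_sequence J \<Lambda>"
  unfolding carleson_sequence_def
proof (intro conjI allI impI)
  show "\<Lambda> ` J \<subseteq> unit_disc" by fact
  fix a :: "nat \<Rightarrow> complex" assume "bounded (a ` J)"
  then obtain A where A: "\<And>j. j \<in> J \<Longrightarrow> cmod (a j) \<le> A" by (auto simp: bounded_iff)
  define A' where "A' = max A 0"
  have A': "\<And>j. j \<in> J \<Longrightarrow> cmod (a j) \<le> A'" "0 \<le> A'" using A by (auto simp: A'_def le_max_iff_disj)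
  have D': "cmod (\<Lambda> j) < 1" if "j \<in> J" for j using D that by auto
  define d where "d = exp (- K / \<delta>\<^sup>2 / 2)"
  define M where "M = A' * (exp (2 * K) / d)"
  have "\<exists>f. f holomorphic_on ball 0 1 \<and> (\<forall>z. cmod z < 1 \<longrightarrow> cmod (f z) \<le> M) \<and>
      (\<forall>j\<in>J \<inter> {..<n}. f (\<Lambda> j) = a j)" for n
  proof -
    define F where "F = J \<inter> {..<n}"
    have F: "finite F" "F \<subseteq> J" by (auto simp: F_def)
    have "d \<le> (\<Prod>j\<in>F - {k}. pseudohyperbolic (\<Lambda> k) (\<Lambda> j))" if k: "k \<in> F" for k
      unfolding d_def
    proof (rule prod_ge_of_separated[OF _ \<delta>])
      show "\<delta> \<le> pseudohyperbolic (\<Lambda> k) (\<Lambda> j)" if "j \<in> F - {k}" for j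
        using pseudohyp_separatedD[OF sep, of k j] k that F by blast
      show "pseudohyperbolic (\<Lambda> k) (\<Lambda> j) \<le> 1" if "j \<in> F - {k}" for j
        using k that F by (intro pseudohyperbolic_le_1 less_imp_le D') auto
      show "(\<Sum>j\<in>F - {k}. hyp_kernel (\<Lambda> k) (\<Lambda> j)) \<le> K"
        using F k by (intro kernel_boundedD[OF K] D') auto
    qed (use F in auto)
    moreover have "(\<Sum>j\<in>F. hyp_kernel (\<Lambda> k) (\<Lambda> j)) \<le> K" if "k \<in> F" for k
      using F that by (intro kernel_boundedD[OF K] D') auto
    moreover have "0 < d" by (simp add: d_def)
    ultimately obtain G where G: "\<And>k. k \<in> F \<Longrightarrow> G k holomorphic_on ball 0 1"
      "\<And>k j. k \<in> F \<Longrightarrow> j \<in> F \<Longrightarrow> G k (\<Lambda> j) = (if j = k then 1 else 0)"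
      "\<And>z. cmod z < 1 \<Longrightarrow> (\<Sum>k\<in>F. cmod (G k z)) \<le> exp (2 * K) / d"
      using jones_interpolation[OF F(1), of \<Lambda> d K] D' F(2) by blast
    let ?f = "\<lambda>z. \<Sum>k\<in>F. a k * G k z"
    have "?f holomorphic_on ball 0 1" by (intro holomorphic_intros G) auto
    moreover have "cmod (?f z) \<le> M" if z: "cmod z < 1" for z
    proof -
      have "cmod (?f z) \<le> (\<Sum>k\<in>F. A' * cmod (G k z))"
        using F A' by (intro sum_norm_le) (auto simp: norm_mult intro!: mult_right_mono)
      also have "\<dots> \<le> M"
        unfolding M_def sum_distrib_left[symmetric] using G(3)[OF z] A'(2) by (intro mult_left_mono)
      finally show ?thesis .
    qed
    moreover have "?f (\<Lambda> j) = a j" if "j \<in> F" for j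
      using that F(1) by (simp add: G(2) if_distrib[of "\<lambda>x. _ * x"] sum.delta cong: if_cong)
    ultimately show ?thesis unfolding F_def by blast
  qed
  then obtain f where f: "\<And>n. f n holomorphic_on ball 0 1" "\<And>n z. cmod z < 1 \<Longrightarrow> cmod (f n z) \<le> M"
    "\<And>n j. j \<in> J \<Longrightarrow> j < n \<Longrightarrow> f n (\<Lambda> j) = a j"
    by (metis (no_types, lifting) Int_iff lessThan_iff)
  define H where "H = {h. h holomorphic_on ball 0 1 \<and> (\<forall>z. cmod z < 1 \<longrightarrow> cmod (h z) \<le> M)}"
  have HB: "\<exists>B. \<forall>h\<in>H. \<forall>z\<in>C. cmod (h z) \<le> B" if "compact C" "C \<subseteq> ball 0 1" for C
    using that(2) by (intro exI[of _ M]) (force simp: H_def)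
  have fH: "range f \<subseteq> H" using f by (auto simp: H_def)
  have Hh: "h holomorphic_on ball 0 1" if "h \<in> H" for h using that by (simp add: H_def)
  obtain g r where g: "g holomorphic_on ball 0 1" "strict_mono (r :: nat \<Rightarrow> nat)"
    "\<And>x. x \<in> ball 0 1 \<Longrightarrow> (\<lambda>n. f (r n) x) \<longlonglongrightarrow> g x"
    using Montel[OF open_ball Hh HB fH] by metis
  have "cmod (g z) \<le> M" if "cmod z < 1" for z
    using that f(2) by (intro LIMSEQ_le_const2[OF tendsto_norm[OF g(3)]]) auto
  then have "g \<in> H_infinity"
    using g(1) by (auto simp: H_infinity_def bounded_iff intro!: exI[of _ M])
  moreover have "a j = g (\<Lambda> j)" if j: "j \<in> J" for j
  proof -
    have "eventually (\<lambda>n. f (r n) (\<Lambda> j) = a j) sequentially"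
      using eventually_gt_at_top[of j]
    proof eventually_elim
      case (elim n)
      then show ?case using f(3)[OF j, of "r n"] seq_suble[OF g(2), of n] by linarith
    qed
    then have "(\<lambda>n. f (r n) (\<Lambda> j)) \<longlonglongrightarrow> a j" by (rule tendsto_eventually)
    then show ?thesis using g(3)[of "\<Lambda> j"] D'[OF j] LIMSEQ_unique by auto
  qed
  ultimately show "\<exists>f\<in>H_infinity. \<forall>j\<in>J. a j = f (\<Lambda> j)" by blast
qed

section \<open>Dyadic boxes\<close>

text \<open>The argument in units of full turns, in the interval from 0 to 1, as in the definition of
  normalized arclength.\<close>

definition turn :: "complex \<Rightarrow> real" where
  "turn w = Arg2pi w / (2 * pi)"

definition dyadic_pos :: "nat \<Rightarrow> complex \<Rightarrow> nat" where
  "dyadic_pos n w = nat \<lfloor>2 ^ n * turn w\<rfloor>"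

text \<open>For \<open>0 < n\<close> this is the Carleson box over the arc of arguments between
  \<open>k / 2 ^ n\<close> and \<open>(k + 1) / 2 ^ n\<close> turns. The single box of level 0 is
  the whole disc, including the origin.\<close>

definition dyadic_box :: "nat \<Rightarrow> nat \<Rightarrow> complex set" where
  "dyadic_box n k = {w \<in> unit_disc. 1 - cmod w \<le> 1 / 2 ^ n \<and> dyadic_pos n w = k}"

lemma turn_bounds: "0 \<le> turn w" "turn w < 1"
  using Arg2pi_ge_0[of w] Arg2pi_lt_2pi[of w] by (auto simp: turn_def field_simps)

lemma turn_polar: "w = of_real (cmod w) * cis (2 * pi * turn w)"
  using Arg2pi_eq[of w] by (simp add: turn_def cis_conv_exp)

lemma turn_cis: "0 < r \<Longrightarrow> 0 \<le> t \<Longrightarrow> t < 1 \<Longrightarrow> turn (of_real r * cis (2 * pi * t)) = t"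
  unfolding turn_def
  by (subst Arg2pi_unique[of r "2 * pi * t"]) (auto simp: cis_conv_exp)

lemma dyadic_pos_bounds:
  "real (dyadic_pos n w) \<le> 2 ^ n * turn w" "2 ^ n * turn w < real (dyadic_pos n w) + 1"
proof -
  have "real (dyadic_pos n w) = of_int \<lfloor>2 ^ n * turn w\<rfloor>"
    unfolding dyadic_pos_def using turn_bounds(1)[of w] by simp
  then show "real (dyadic_pos n w) \<le> 2 ^ n * turn w" "2 ^ n * turn w < real (dyadic_pos n w) + 1"
    by linarith+
qed

lemma dyadic_pos_eq_iff:
  "dyadic_pos n w = k \<longleftrightarrow> real k \<le> 2 ^ n * turn w \<and> 2 ^ n * turn w < real k + 1"
  using dyadic_pos_bounds[of n w] by (auto simp: dyadic_pos_def) linarith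

lemma dyadic_pos_less: "dyadic_pos n w < 2 ^ n"
proof -
  have "2 ^ n * turn w < 2 ^ n * 1" using turn_bounds(2)[of w] by (intro mult_strict_left_mono) auto
  then have "real (dyadic_pos n w) < 2 ^ n" using dyadic_pos_bounds(1)[of n w] by linarith
  then show ?thesis by (metis of_nat_less_iff of_nat_numeral of_nat_power)
qed

lemma dyadic_pos_0 [simp]: "dyadic_pos 0 w = 0"
  using dyadic_pos_less[of 0 w] by simp

lemma dyadic_pos_div:
  assumes "n \<le> m"
  shows "dyadic_pos m w div 2 ^ (m - n) = dyadic_pos n w"
proof -
  define q where "q = dyadic_pos m w div 2 ^ (m - n)"
  have m: "(2::real) ^ m = 2 ^ (m - n) * 2 ^ n"
    using assms by (simp add: power_add[symmetric])
  have "q * 2 ^ (m - n) \<le> dyadic_pos m w"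
    unfolding q_def by simp
  then have "real (q * 2 ^ (m - n)) \<le> real (dyadic_pos m w)"
    by (simp only: of_nat_le_iff)
  then have "real q * 2 ^ (m - n) \<le> real (dyadic_pos m w)" by simp
  then have "2 ^ (m - n) * real q \<le> 2 ^ (m - n) * (2 ^ n * turn w)"
    using dyadic_pos_bounds(1)[of m w] unfolding m by (simp only: mult_ac)
  then have 1: "real q \<le> 2 ^ n * turn w" by (subst (asm) mult_le_cancel_left_pos) auto
  have "dyadic_pos m w < (q + 1) * 2 ^ (m - n)"
    unfolding q_def using dividend_less_div_times[of "2 ^ (m - n)" "dyadic_pos m w"]
    by (simp add: algebra_simps)
  then have "dyadic_pos m w + 1 \<le> (q + 1) * 2 ^ (m - n)" by simp
  then have "real (dyadic_pos m w + 1) \<le> real ((q + 1) * 2 ^ (m - n))"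
    by (simp only: of_nat_le_iff)
  then have "real (dyadic_pos m w) + 1 \<le> (real q + 1) * 2 ^ (m - n)"
    by (simp add: algebra_simps)
  then have "2 ^ (m - n) * (2 ^ n * turn w) < 2 ^ (m - n) * (real q + 1)"
    using dyadic_pos_bounds(2)[of m w] unfolding m by (simp only: mult_ac)
  then have 2: "2 ^ n * turn w < real q + 1" by (subst (asm) mult_less_cancel_left_pos) auto
  have "dyadic_pos n w = q" using 1 2 by (simp add: dyadic_pos_eq_iff)
  then show ?thesis by (simp add: q_def)
qed

lemma dyadic_box_empty: "2 ^ n \<le> k \<Longrightarrow> dyadic_box n k = {}"
  using dyadic_pos_less by (auto simp: dyadic_box_def) (meson leD)

lemma dyadic_box_0: "dyadic_box 0 0 = unit_disc"
  by (auto simp: dyadic_box_def)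

lemma exists_dyadic_scale:
  fixes s :: real
  assumes "0 < s" "s \<le> 1"
  shows "\<exists>n. 1 / 2 ^ Suc n < s \<and> s \<le> 1 / 2 ^ n"
proof -
  define n where "n = (LEAST n. 1 / 2 ^ Suc n < s)"
  obtain m where "(1/2::real) ^ m < s" using real_arch_pow_inv[of s "1/2"] assms by auto
  moreover have "(1/2::real) ^ Suc m \<le> (1/2) ^ m" by simp
  ultimately have "1 / 2 ^ Suc m < s" unfolding power_one_over[symmetric] by linarith
  then have n: "1 / 2 ^ Suc n < s" unfolding n_def by (rule LeastI)
  moreover have "s \<le> 1 / 2 ^ n"
  proof (cases n)
    case 0
    then show ?thesis using assms by simp
  next
    case (Suc m)
    then have "\<not> 1 / 2 ^ Suc m < s"
      using not_less_Least[of m "\<lambda>n. 1 / 2 ^ Suc n < s"] unfolding n_def[symmetric]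
      by (simp only: lessI) blast
    then show ?thesis using Suc by simp
  qed
  ultimately show ?thesis by blast
qed

text \<open>A crude form of Jordan's inequality, stated for the distance of \<open>\<tau>\<close> from the
  integers.\<close>

lemma le_abs_sin_pi:
  assumes "0 \<le> h" "h \<le> \<bar>\<tau>\<bar>" "\<bar>\<tau>\<bar> \<le> 1 - h"
  shows "h \<le> \<bar>sin (pi * \<tau>)\<bar>"
proof -
  have lower: "t \<le> sin (pi * t)" if t: "0 \<le> t" "t \<le> 1/2" for t :: real
  proof (cases "t \<le> 1/3")
    case True
    show ?thesis
    proof (cases "t = 0")
      case False
      then have t0: "0 < pi * t" using t by simp
      have "\<exists>x>0. x < pi * t \<and> sin (pi * t) - sin 0 = (pi * t - 0) * cos x"
        using t0 by (intro MVT2) auto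
      then obtain x where x: "0 < x" "x < pi * t" "sin (pi * t) = pi * t * cos x" by auto
      have "pi * t \<le> pi / 3" using True by simp
      then have "cos (pi / 3) \<le> cos x"
        using x pi_gt_zero by (intro cos_monotone_0_pi_le) linarith+
      then have "pi * t * (1/2) \<le> sin (pi * t)"
        unfolding x(3) using t0 by (intro mult_left_mono) (auto simp: cos_60)
      moreover have "2 * t \<le> pi * t" using t pi_ge_two by (intro mult_right_mono) auto
      ultimately show ?thesis by linarith
    qed auto
  next
    case False
    have "sin (pi / 6) \<le> sin (pi * t)"
    proof (rule sin_monotone_2pi_le)
      show "pi / 6 \<le> pi * t" using False pi_gt_zero by (simp add: field_simps)
      show "pi * t \<le> pi / 2" using t by simp
    qed (use pi_gt_zero in linarith)
    then show ?thesis using t by (simp add: sin_30)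
  qed
  show ?thesis
  proof (cases "\<bar>\<tau>\<bar> \<le> 1/2")
    case True
    then have "\<bar>\<tau>\<bar> \<le> sin (pi * \<bar>\<tau>\<bar>)" by (intro lower) auto
    also have "\<dots> \<le> \<bar>sin (pi * \<tau>)\<bar>" by (cases "\<tau> \<ge> 0") auto
    finally show ?thesis using assms by linarith
  next
    case False
    then have "1 - \<bar>\<tau>\<bar> \<le> sin (pi * (1 - \<bar>\<tau>\<bar>))" using assms by (intro lower) auto
    also have "\<dots> = sin (pi * \<bar>\<tau>\<bar>)" by (simp add: right_diff_distrib)
    also have "\<dots> \<le> \<bar>sin (pi * \<tau>)\<bar>" by (cases "\<tau> \<ge> 0") auto
    finally show ?thesis using assms by linarith
  qed
qed

lemma cmod_one_minus_cnj_polar: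
  "(cmod (1 - cnj z * w))\<^sup>2 = (1 - cmod z * cmod w)\<^sup>2
     + 4 * (cmod z * cmod w) * (sin (pi * (turn w - turn z)))\<^sup>2"
proof -
  define s \<theta> where "s = cmod z * cmod w" and "\<theta> = pi * (turn w - turn z)"
  have "cnj z * w = of_real (cmod z) * cis (- (2 * pi * turn z)) * (of_real (cmod w) * cis (2 * pi * turn w))"
    by (subst turn_polar[of z], subst turn_polar[of w]) (simp add: cis_cnj)
  also have "\<dots> = of_real s * (cis (- (2 * pi * turn z)) * cis (2 * pi * turn w))"
    by (simp add: s_def)
  also have "\<dots> = of_real s * cis (2 * \<theta>)"
    by (simp add: \<theta>_def cis_mult algebra_simps)
  finally have polar: "cnj z * w = of_real s * cis (2 * \<theta>)" .
  have alg: "(1 - s * c)\<^sup>2 + (s * d)\<^sup>2 = 1 - 2 * s * c + s\<^sup>2 * (d\<^sup>2 + c\<^sup>2)" for c d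
    by (simp add: power2_eq_square algebra_simps)
  have alg': "1 - 2 * s * (1 - 2 * c\<^sup>2) + s\<^sup>2 * 1 = (1 - s)\<^sup>2 + 4 * s * c\<^sup>2" for c :: real
    by (simp add: power2_eq_square algebra_simps)
  have "(cmod (1 - cnj z * w))\<^sup>2 = (1 - s * cos (2 * \<theta>))\<^sup>2 + (s * sin (2 * \<theta>))\<^sup>2"
    by (simp add: polar cmod_power2)
  also have "\<dots> = 1 - 2 * s * cos (2 * \<theta>) + s\<^sup>2 * ((sin (2 * \<theta>))\<^sup>2 + (cos (2 * \<theta>))\<^sup>2)"
    by (rule alg)
  also have "\<dots> = (1 - s)\<^sup>2 + 4 * s * (sin \<theta>)\<^sup>2"
    by (simp only: sin_cos_squared_add) (simp only: cos_double_sin alg')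
  finally show ?thesis by (simp add: s_def \<theta>_def)
qed

text \<open>Two points at comparable distance from the circle whose arguments differ by at least that
  distance.\<close>

lemma pseudohyperbolic_ge_angular:
  assumes z: "cmod z < 1" "1/2 \<le> cmod z" "1 - cmod z \<le> h"
    and w: "cmod w < 1" "1/2 \<le> cmod w" "1 - cmod w \<le> h"
    and h: "0 < h" "h \<le> \<bar>turn w - turn z\<bar>" "\<bar>turn w - turn z\<bar> \<le> 1 - h"
  shows "1/3 \<le> pseudohyperbolic z w"
proof -
  define x y where "x = cmod z" and "y = cmod w"
  have xy: "1/2 \<le> x" "x < 1" "1 - x \<le> h" "1/2 \<le> y" "y < 1" "1 - y \<le> h"
    using z w by (auto simp: x_def y_def)
  define N where "N = (1 - x * y)\<^sup>2"
  define S where "S = 4 * (x * y) * (sin (pi * (turn w - turn z)))\<^sup>2"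
  have xy4: "1/2 * (1/2) \<le> x * y" using xy by (intro mult_mono) auto
  have xy1: "x * y < 1" using mult_strict_mono[of x 1 y 1] xy by simp
  have "h\<^sup>2 \<le> \<bar>sin (pi * (turn w - turn z))\<bar>\<^sup>2"
    using h by (intro power_mono le_abs_sin_pi) auto
  then have "1 * h\<^sup>2 \<le> 4 * (x * y) * (sin (pi * (turn w - turn z)))\<^sup>2"
    using xy4 by (intro mult_mono) auto
  then have S: "h\<^sup>2 \<le> S" by (simp add: S_def)
  have "1 - x * y = (1 - x) + x * (1 - y)" by (simp add: algebra_simps)
  also have "\<dots> \<le> h + 1 * h" using xy h by (intro add_mono mult_mono) auto
  finally have "N \<le> (2 * h)\<^sup>2" unfolding N_def using xy1 by (intro power_mono) auto
  then have N: "N \<le> 4 * S" "N > 0" using S xy1 by (auto simp: N_def power_mult_distrib)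
  have "(1 - x\<^sup>2) * (1 - y\<^sup>2) \<le> N"
    unfolding N_def using zero_le_power2[of "x - y"] by (simp add: power2_eq_square algebra_simps)
  then have "hyp_kernel z w \<le> N / (N + S)"
    unfolding hyp_kernel_eq[OF z(1) less_imp_le[OF w(1)]] cmod_one_minus_cnj_polar
    using N by (simp add: divide_right_mono x_def[symmetric] y_def[symmetric] N_def[symmetric] S_def[symmetric])
  also have "\<dots> \<le> 4/5" using N by (simp add: field_simps)
  finally have "(1/3)\<^sup>2 \<le> (pseudohyperbolic z w)\<^sup>2" by (simp add: power2_eq_square)
  then show ?thesis by (rule power2_le_imp_le) simp
qed

text \<open>Two points whose distances to the circle differ by a factor of at least 2.\<close>

lemma pseudohyperbolic_ge_radial:
  assumes "cmod z < 1" "cmod w < 1" "1 - cmod w \<le> (1 - cmod z) / 2"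
  shows "1/3 \<le> pseudohyperbolic z w"
proof -
  define x y where "x = cmod z" and "y = cmod w"
  have xy: "0 \<le> x" "x < 1" "y < 1" "1 - y \<le> (1 - x) / 2"
    using assms by (auto simp: x_def y_def)
  then have y0: "0 \<le> y" by (simp add: y_def)
  have xy1: "x * y < 1" using mult_strict_mono'[of x 1 y 1] xy y0 by simp
  have "1 - x * y = (1 - x) + x * (1 - y)" by (simp add: algebra_simps)
  moreover have "x * (1 - y) \<le> 1 * ((1 - x) / 2)" using xy by (intro mult_mono) auto
  ultimately have "1 - x * y \<le> (1 - x) + (1 - x) / 2" by linarith
  then have "(1 - x * y) / 3 \<le> (1 - x) / 2" by (simp add: field_simps)
  moreover have "y - x = (1 - x) - (1 - y)" by simp
  ultimately have "(1 - x * y) / 3 \<le> y - x" using xy(4) by (simp only:) (simp add: field_simps)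
  then have "((1 - x * y) / 3)\<^sup>2 \<le> (y - x)\<^sup>2" using xy1 by (intro power_mono) auto
  moreover have "(1 - x\<^sup>2) * (1 - y\<^sup>2) = (1 - x * y)\<^sup>2 - (y - x)\<^sup>2"
    by (simp add: power2_eq_square algebra_simps)
  ultimately have num: "(1 - x\<^sup>2) * (1 - y\<^sup>2) \<le> 8/9 * (1 - x * y)\<^sup>2"
    by (simp add: power_divide)
  have "(1 - x * y)\<^sup>2 \<le> (cmod (1 - cnj z * w))\<^sup>2"
    unfolding cmod_one_minus_cnj_polar x_def y_def by simp
  then have "hyp_kernel z w \<le> (1 - x\<^sup>2) * (1 - y\<^sup>2) / (1 - x * y)\<^sup>2"
    unfolding hyp_kernel_eq[OF assms(1) less_imp_le[OF assms(2)]] x_def[symmetric] y_def[symmetric]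
    using xy xy1 y0 by (intro divide_left_mono mult_nonneg_nonneg mult_pos_pos)
      (auto simp: power_le_one zero_less_power)
  also have "\<dots> \<le> 8/9" using num xy1 by (subst pos_divide_le_eq) auto
  finally have "(1/3)\<^sup>2 \<le> (pseudohyperbolic z w)\<^sup>2" by (simp add: power2_eq_square)
  then show ?thesis by (rule power2_le_imp_le) simp
qed

text \<open>The standard passage from boxes to the Poisson-type kernel: with \<open>2 ^ - n0\<close>
  comparable to \<open>1 - \<bar>z\<bar>\<close>, the kernel is at most of order
  \<open>2 ^ - n0 * 4 ^ n\<close> at the points that are in the boxes of level \<open>n\<close>
  around \<open>z\<close> but not in those of level \<open>n + 1\<close>, while their mass is at
  most of order \<open>2 ^ - n\<close>. Summing over \<open>n \<le> n0\<close> gives a geometric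
  series.\<close>

lemma box_sums_imp_kernel_sum_bound:
  fixes w :: "'i \<Rightarrow> complex" and c :: "'i \<Rightarrow> real"
  assumes F: "finite F" "\<And>j. j \<in> F \<Longrightarrow> cmod (w j) < 1" "\<And>j. j \<in> F \<Longrightarrow> 0 \<le> c j"
    and box: "\<And>n k. (\<Sum>j | j \<in> F \<and> w j \<in> dyadic_box n k. c j) \<le> A / 2 ^ n"
    and z: "cmod z < 1"
  shows "(\<Sum>j\<in>F. c j * ((1 - (cmod z)\<^sup>2) / (cmod (1 - cnj z * w j))\<^sup>2)) \<le> 80 * A"
proof -
  have A: "0 \<le> A"
  proof -
    have "0 \<le> (\<Sum>j | j \<in> F \<and> w j \<in> dyadic_box 0 0. c j)" using F by (intro sum_nonneg) auto
    then show ?thesis using box[of 0 0] by simp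
  qed
  obtain n0 where n0: "1 / 2 ^ Suc n0 < 1 - cmod z" "1 - cmod z \<le> 1 / 2 ^ n0"
    using exists_dyadic_scale[of "1 - cmod z"] z by auto
  \<comment> \<open>Besides the box above \<open>z\<close> and its two neighbours, the first and the last box of the
     level are included, so that arcs which wrap around the point 1 need no special treatment.\<close>
  define X where "X = (\<lambda>n. {0, 2 ^ n - 1, dyadic_pos n z - 1, dyadic_pos n z, dyadic_pos n z + 1})"
  define U where "U = (\<lambda>n. \<Union>k\<in>X n. dyadic_box n k)"
  have level: "\<exists>n\<le>n0. w j \<in> U n \<and> 1 / (cmod (1 - cnj z * w j))\<^sup>2 \<le> 4 * 4 ^ n" if j: "j \<in> F" for j
  proof -
    define v where "v = w j"
    have v: "cmod v < 1" using F(2)[OF j] by (simp add: v_def)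
    have inv: "1 / (cmod (1 - cnj z * v))\<^sup>2 \<le> 4 * 4 ^ n" if "1 / 2 ^ Suc n \<le> cmod (1 - cnj z * v)" for n
    proof -
      have "(1 / 2 ^ Suc n)\<^sup>2 \<le> (cmod (1 - cnj z * v))\<^sup>2" using that by (intro power_mono) auto
      then have "1 / (cmod (1 - cnj z * v))\<^sup>2 \<le> 1 / (1 / 2 ^ Suc n)\<^sup>2"
        by (intro divide_left_mono mult_pos_pos zero_less_power)
           (use one_minus_cnj_mult_nonzero[of z v] z v in auto)
      also have "\<dots> = 4 * 4 ^ n"
        by (simp add: power2_eq_square power_divide power_mult_distrib[symmetric])
      finally show ?thesis .
    qed
    \<comment> \<open>The deepest level, not below that of \<open>z\<close>, at which the point is
      still in the boxes around \<open>z\<close>.\<close>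
    define N where "N = {n. n \<le> n0 \<and> v \<in> U n}"
    have finN: "finite N" by (simp add: N_def)
    have "v \<in> U 0" unfolding U_def X_def using v dyadic_box_0 by auto
    then have "0 \<in> N" by (simp add: N_def)
    define n where "n = Max N"
    have "n \<in> N" unfolding n_def using Max_in[OF finN] \<open>0 \<in> N\<close> by blast
    then have n: "n \<le> n0" "v \<in> U n" by (auto simp: N_def)
    have "1 / (cmod (1 - cnj z * v))\<^sup>2 \<le> 4 * 4 ^ n"
    proof (cases "n = n0")
      case True
      have "1 - cmod z \<le> cmod (1 - cnj z * v)" using v by (intro one_minus_cmod_mult_le) auto
      then show ?thesis using n0 True by (intro inv) auto
    next
      case False
      have "Suc n \<notin> N" using Max_ge[OF finN, of "Suc n"] by (auto simp: n_def)
      then have notU: "v \<notin> U (Suc n)" using False n(1) by (auto simp: N_def)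
      define m where "m = Suc n"
      show ?thesis
      proof (cases "1 - cmod v \<le> 1 / 2 ^ m")
        case False
        have "1 - cmod v \<le> cmod (1 - cnj v * z)" using z by (intro one_minus_cmod_mult_le) auto
        then have "1 - cmod v \<le> cmod (1 - cnj z * v)" by (simp add: cmod_one_minus_cnj_commute)
        then show ?thesis using False by (intro inv) (auto simp: m_def)
      next
        case True
        define q where "q = dyadic_pos m v"
        define p where "p = dyadic_pos m z"
        have "q \<notin> X m" using notU True v unfolding U_def m_def q_def by (auto simp: dyadic_box_def)
        then have q: "q \<noteq> 0" "q \<noteq> 2 ^ m - 1" "q \<noteq> p - 1" "q \<noteq> p" "q \<noteq> p + 1"
          by (auto simp: X_def p_def)
        have q2: "q < 2 ^ m" by (simp add: q_def dyadic_pos_less)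
        have bq: "real q \<le> 2 ^ m * turn v" "2 ^ m * turn v < real q + 1"
          and bp: "real p \<le> 2 ^ m * turn z" "2 ^ m * turn z < real p + 1"
          using dyadic_pos_bounds by (auto simp: q_def p_def)
        have "real q + 2 \<le> real p \<or> real p + 2 \<le> real q"
          using q by linarith
        then have "1 \<le> \<bar>2 ^ m * turn v - 2 ^ m * turn z\<bar>" using bq bp by linarith
        then have "2 ^ m * (1 / 2 ^ m) \<le> 2 ^ m * \<bar>turn v - turn z\<bar>"
          by (simp add: abs_mult right_diff_distrib[symmetric])
        then have low: "1 / 2 ^ m \<le> \<bar>turn v - turn z\<bar>" by (subst (asm) mult_le_cancel_left_pos) auto
        have "q + 2 \<le> 2 ^ m" using q(2) q2 by linarith
        then have "real q + 2 \<le> 2 ^ m" by (metis of_nat_add of_nat_le_iff of_nat_numeral of_nat_power)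
        then have "2 ^ m * turn v < 2 ^ m * (1 - 1 / 2 ^ m)" using bq by (simp add: right_diff_distrib)
        moreover have "2 ^ m * (1 / 2 ^ m) \<le> 2 ^ m * turn v" using bq(1) q(1) by simp
        ultimately have "turn v \<le> 1 - 1 / 2 ^ m" "1 / 2 ^ m \<le> turn v"
          by (simp_all only: mult_less_cancel_left_pos mult_le_cancel_left_pos zero_less_power zero_less_numeral less_imp_le)
        then have high: "\<bar>turn v - turn z\<bar> \<le> 1 - 1 / 2 ^ m" using turn_bounds[of z] by linarith
        have half: "(1::real) / 2 ^ m \<le> 1 / 2"
          by (simp add: m_def field_simps)
        have "(1::real) / 2 ^ n0 \<le> 1 / 2 ^ m"
          using False n(1) by (intro divide_left_mono power_increasing) (auto simp: m_def)
        then have "1/2 \<le> cmod z" "1/2 \<le> cmod v" using half n0(2) True by linarith+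
        then have "1/2 * (1/2) \<le> cmod z * cmod v" by (intro mult_mono) auto
        moreover have "(1 / 2 ^ m)\<^sup>2 \<le> \<bar>sin (pi * (turn v - turn z))\<bar>\<^sup>2"
          using low high by (intro power_mono le_abs_sin_pi) auto
        ultimately have "1 * (1 / 2 ^ m)\<^sup>2 \<le> 4 * (cmod z * cmod v) * (sin (pi * (turn v - turn z)))\<^sup>2"
          by (intro mult_mono) auto
        also have "\<dots> \<le> (cmod (1 - cnj z * v))\<^sup>2"
          unfolding cmod_one_minus_cnj_polar by simp
        finally have "(1 / 2 ^ m)\<^sup>2 \<le> (cmod (1 - cnj z * v))\<^sup>2" by simp
        then have "1 / 2 ^ m \<le> cmod (1 - cnj z * v)"
          by (rule power2_le_imp_le) simp
        then show ?thesis by (intro inv) (simp add: m_def)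
      qed
    qed
    then show ?thesis using n by (auto simp: v_def)
  qed
  have Usum: "(\<Sum>j | j \<in> F \<and> w j \<in> U n. c j) \<le> 5 * (A / 2 ^ n)" for n
  proof -
    have cardX: "card (X n) \<le> 5" unfolding X_def by (intro card_insert_le_m1) auto
    have finX: "finite (X n)" by (simp add: X_def)
    have "(\<Sum>j | j \<in> F \<and> w j \<in> U n. c j) \<le> (\<Sum>k\<in>X n. \<Sum>j | j \<in> F \<and> w j \<in> dyadic_box n k. c j)"
    proof -
      have "{j. j \<in> F \<and> w j \<in> U n} = (\<Union>k\<in>X n. {j. j \<in> F \<and> w j \<in> dyadic_box n k})"
        by (auto simp: U_def)
      moreover have "(\<Sum>j\<in>(\<Union>k\<in>X n. {j. j \<in> F \<and> w j \<in> dyadic_box n k}). c j)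
          = (\<Sum>k\<in>X n. \<Sum>j | j \<in> F \<and> w j \<in> dyadic_box n k. c j)"
        using F(1) finX by (intro sum.UNION_disjoint) (auto simp: dyadic_box_def)
      ultimately show ?thesis by simp
    qed
    also have "\<dots> \<le> (\<Sum>k\<in>X n. A / 2 ^ n)" by (intro sum_mono box)
    also have "\<dots> = real (card (X n)) * (A / 2 ^ n)" by simp
    also have "\<dots> \<le> 5 * (A / 2 ^ n)" using cardX A by (intro mult_right_mono) auto
    finally show ?thesis .
  qed
  define P where "P = 1 - (cmod z)\<^sup>2"
  have P: "0 \<le> P" "P \<le> 2 / 2 ^ n0"
  proof -
    show "0 \<le> P" using z by (simp add: P_def abs_square_le_1)
    have "P = (1 + cmod z) * (1 - cmod z)" by (simp add: P_def power2_eq_square algebra_simps)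
    also have "\<dots> \<le> 2 * (1 / 2 ^ n0)" using z n0 by (intro mult_mono) auto
    finally show "P \<le> 2 / 2 ^ n0" by simp
  qed
  have "(\<Sum>j\<in>F. c j * (P / (cmod (1 - cnj z * w j))\<^sup>2))
      \<le> (\<Sum>j\<in>F. \<Sum>n\<le>n0. if w j \<in> U n then c j * (P * (4 * 4 ^ n)) else 0)"
  proof (rule sum_mono)
    fix j assume j: "j \<in> F"
    obtain n where n: "n \<le> n0" "w j \<in> U n" "1 / (cmod (1 - cnj z * w j))\<^sup>2 \<le> 4 * 4 ^ n"
      using level[OF j] by blast
    have "P * (1 / (cmod (1 - cnj z * w j))\<^sup>2) \<le> P * (4 * 4 ^ n)"
      using n(3) P(1) by (rule mult_left_mono)
    then have "c j * (P / (cmod (1 - cnj z * w j))\<^sup>2) \<le> c j * (P * (4 * 4 ^ n))"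
      using F(3)[OF j] by (intro mult_left_mono) auto
    also have "\<dots> = (if w j \<in> U n then c j * (P * (4 * 4 ^ n)) else 0)" using n by simp
    also have "\<dots> \<le> (\<Sum>n\<le>n0. if w j \<in> U n then c j * (P * (4 * 4 ^ n)) else 0)"
      using n(1) F(3)[OF j] P(1)
      by (intro member_le_sum[of n "{..n0}" "\<lambda>n. if w j \<in> U n then c j * (P * (4 * 4 ^ n)) else 0"]) auto
    finally show "c j * (P / (cmod (1 - cnj z * w j))\<^sup>2)
        \<le> (\<Sum>n\<le>n0. if w j \<in> U n then c j * (P * (4 * 4 ^ n)) else 0)" .
  qed
  also have "\<dots> = (\<Sum>n\<le>n0. \<Sum>j\<in>F. if w j \<in> U n then c j * (P * (4 * 4 ^ n)) else 0)"
    by (rule sum.swap)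
  also have "\<dots> = (\<Sum>n\<le>n0. P * (4 * 4 ^ n) * (\<Sum>j | j \<in> F \<and> w j \<in> U n. c j))"
    using F(1) by (intro sum.cong refl) (auto simp: sum.inter_filter sum_distrib_left intro!: sum.cong)
  also have "\<dots> \<le> (\<Sum>n\<le>n0. P * (4 * 4 ^ n) * (5 * (A / 2 ^ n)))"
    using P(1) by (intro sum_mono mult_left_mono Usum) auto
  also have "\<dots> = 20 * A * P * (\<Sum>n\<le>n0. 2 ^ n)"
    unfolding sum_distrib_left
  proof (intro sum.cong refl)
    fix n :: nat
    have "(4::real) ^ n = 2 ^ n * 2 ^ n" by (simp add: power_mult_distrib[symmetric])
    then show "P * (4 * 4 ^ n) * (5 * (A / 2 ^ n)) = 20 * A * P * 2 ^ n" by simp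
  qed
  also have "\<dots> \<le> 20 * A * (2 / 2 ^ n0) * (2 * 2 ^ n0)"
  proof (intro mult_mono)
    have "(\<Sum>n\<le>n0. (2::real) ^ n) = 2 ^ Suc n0 - 1"
      by (induction n0) auto
    then show "(\<Sum>n\<le>n0. (2::real) ^ n) \<le> 2 * 2 ^ n0" by simp
  qed (use A P in \<open>auto intro!: sum_nonneg\<close>)
  also have "\<dots> = 80 * A" by simp
  finally show ?thesis by (simp add: P_def)
qed

text \<open>The Carleson condition for the measure with mass \<open>1 - \<bar>w\<bar>\<close> at each point of
  the set, tested on dyadic boxes only. It is the form of the condition that survives the
  combinatorial constructions below.\<close>

definition dyadic_carleson :: "real \<Rightarrow> complex set \<Rightarrow> bool" where
  "dyadic_carleson A E \<longleftrightarrow>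
    (\<forall>F. finite F \<longrightarrow> F \<subseteq> E \<longrightarrow> (\<forall>n k. (\<Sum>w\<in>F \<inter> dyadic_box n k. 1 - cmod w) \<le> A / 2 ^ n))"

lemma dyadic_carlesonD:
  "dyadic_carleson A E \<Longrightarrow> finite F \<Longrightarrow> F \<subseteq> E \<Longrightarrow> (\<Sum>w\<in>F \<inter> dyadic_box n k. 1 - cmod w) \<le> A / 2 ^ n"
  by (auto simp: dyadic_carleson_def)

lemma dyadic_carleson_finiteI:
  assumes "finite E" "E \<subseteq> unit_disc" "\<And>n k. (\<Sum>w\<in>E \<inter> dyadic_box n k. 1 - cmod w) \<le> A / 2 ^ n"
  shows "dyadic_carleson A E"
  unfolding dyadic_carleson_def
proof (intro allI impI)
  fix F n k assume F: "finite F" "F \<subseteq> E"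
  have "(\<Sum>w\<in>F \<inter> dyadic_box n k. 1 - cmod w) \<le> (\<Sum>w\<in>E \<inter> dyadic_box n k. 1 - cmod w)"
    using assms(1,2) F by (intro sum_mono2) (auto intro: less_imp_le)
  then show "(\<Sum>w\<in>F \<inter> dyadic_box n k. 1 - cmod w) \<le> A / 2 ^ n" using assms(3)[of n k] by linarith
qed

lemma dyadic_carleson_subset: "dyadic_carleson A E \<Longrightarrow> E' \<subseteq> E \<Longrightarrow> dyadic_carleson A E'"
  by (auto simp: dyadic_carleson_def)

lemma dyadic_carleson_imp_kernel_bounded:
  assumes E: "E \<subseteq> unit_disc" and A: "dyadic_carleson A E"
  shows "kernel_bounded (160 * A) E (\<lambda>w. w)"
proof (rule kernel_boundedI)
  fix z F assume z: "cmod z < 1" and F: "finite F" "F \<subseteq> E"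
  let ?P = "\<lambda>w. (1 - (cmod z)\<^sup>2) / (cmod (1 - cnj z * w))\<^sup>2"
  have D: "cmod w < 1" if "w \<in> F" for w using that F E by auto
  have "(\<Sum>w\<in>F. hyp_kernel z w) \<le> (\<Sum>w\<in>F. 2 * ((1 - cmod w) * ?P w))"
  proof (rule sum_mono)
    fix w assume w: "w \<in> F"
    have "1 - (cmod w)\<^sup>2 \<le> 2 * (1 - cmod w)"
      using zero_le_power2[of "1 - cmod w"] by (simp add: power2_eq_square algebra_simps)
    moreover have "0 \<le> ?P w" using z by (simp add: abs_square_le_1)
    ultimately have "(1 - (cmod w)\<^sup>2) * ?P w \<le> 2 * (1 - cmod w) * ?P w" by (rule mult_right_mono)
    moreover have "hyp_kernel z w = (1 - (cmod w)\<^sup>2) * ?P w"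
      using hyp_kernel_eq[OF z less_imp_le[OF D[OF w]]] by simp
    ultimately show "hyp_kernel z w \<le> 2 * ((1 - cmod w) * ?P w)" by (simp only: mult.assoc)
  qed
  also have "\<dots> = 2 * (\<Sum>w\<in>F. (1 - cmod w) * ?P w)" by (simp only: sum_distrib_left)
  also have "\<dots> \<le> 2 * (80 * A)"
  proof (rule mult_left_mono[OF box_sums_imp_kernel_sum_bound[OF F(1) _ _ _ z]])
    fix n k
    show "(\<Sum>w | w \<in> F \<and> w \<in> dyadic_box n k. 1 - cmod w) \<le> A / 2 ^ n"
      using dyadic_carlesonD[OF A F, of n k] by (simp add: Int_def)
  qed (use D in \<open>auto intro: less_imp_le\<close>)
  finally show "(\<Sum>w\<in>F. hyp_kernel z w) \<le> 160 * A" by simp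
qed

section \<open>Carleson measures and kernel integrals\<close>

text \<open>The argument jumps across the nonnegative real axis, where it is 0; elsewhere it is continuous.\<close>

lemma turn_borel_measurable [measurable]: "turn \<in> borel_measurable borel"
proof -
  have "Arg2pi \<in> borel_measurable (restrict_space borel {w. w \<notin> \<real>\<^sub>\<ge>\<^sub>0})"
    by (intro borel_measurable_continuous_on_restrict continuous_at_imp_continuous_on ballI
        continuous_at_Arg2pi) auto
  moreover have "{w \<in> space borel. w \<in> \<real>\<^sub>\<ge>\<^sub>0} \<in> sets (borel :: complex measure)"
    using closed_nonneg_Reals_complex by (simp add: borel_closed)
  ultimately have "(\<lambda>w. if w \<in> \<real>\<^sub>\<ge>\<^sub>0 then 0 else Arg2pi w) \<in> borel_measurable (borel :: complex measure)"
    by (subst measurable_If_restrict_space_iff) auto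
  moreover have "(\<lambda>w. if w \<in> \<real>\<^sub>\<ge>\<^sub>0 then 0 else Arg2pi w) = Arg2pi"
    by (auto simp: fun_eq_iff Arg2pi_eq_0 nonneg_Reals_def)
  ultimately have [measurable]: "Arg2pi \<in> borel_measurable borel" by simp
  show ?thesis unfolding turn_def by measurable
qed

lemma disc_borel_sets_iff: "S \<in> sets disc_borel \<longleftrightarrow> S \<subseteq> unit_disc \<and> S \<in> sets borel"
  by (subst sets_restrict_space_iff) auto

lemma space_disc_borel: "sets \<mu> = sets disc_borel \<Longrightarrow> space \<mu> = unit_disc"
  using sets_eq_imp_space_eq[of \<mu> disc_borel] by (simp add: space_restrict_space)

lemma dyadic_box_sets: "dyadic_box n k \<in> sets disc_borel"
proof -
  have "dyadic_box n k = {w \<in> space borel. cmod w < 1 \<and> 1 - cmod w \<le> 1 / 2 ^ n \<and>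
      real k \<le> 2 ^ n * turn w \<and> 2 ^ n * turn w < real k + 1}"
    by (auto simp: dyadic_box_def dyadic_pos_eq_iff)
  also have "\<dots> \<in> sets borel"
    by (intro sets.sets_Collect_conj borel_measurable_less borel_measurable_le
        borel_measurable_const borel_measurable_norm borel_measurable_diff borel_measurable_times
        turn_borel_measurable)
  finally have "dyadic_box n k \<in> sets borel" .
  moreover have "dyadic_box n k \<subseteq> unit_disc" by (auto simp: dyadic_box_def)
  ultimately show ?thesis unfolding disc_borel_sets_iff by blast
qed

definition dyadic_arc :: "nat \<Rightarrow> nat \<Rightarrow> complex set" where
  "dyadic_arc n k = (\<lambda>t. cis (2 * pi * t)) ` {real k / 2 ^ n ..< (real k + 1) / 2 ^ n}"

lemma unit_circle_eq: "unit_circle = (\<lambda>t. cis (2 * pi * t)) ` {0..<1}"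
proof
  show "unit_circle \<subseteq> (\<lambda>t. cis (2 * pi * t)) ` {0..<1}"
  proof
    fix w :: complex assume "w \<in> unit_circle"
    then have "w = cis (2 * pi * turn w)" using turn_polar[of w] by simp
    then show "w \<in> (\<lambda>t. cis (2 * pi * t)) ` {0..<1}" using turn_bounds by (intro image_eqI[of _ _ "turn w"]) auto
  qed
qed auto

lemma unit_circleE:
  assumes "w \<in> unit_circle"
  obtains t where "0 \<le> t" "t < 1" "w = cis (2 * pi * t)"
  using assms unfolding unit_circle_eq by auto

lemma turn_cis_unit: "0 \<le> t \<Longrightarrow> t < 1 \<Longrightarrow> turn (cis (2 * pi * t)) = t"
  using turn_cis[of 1 t] by simp

lemma arclength_unit_circle: "normalized_arclength unit_circle = 1"
proof -
  have "{t \<in> {0..<1::real}. cis (2 * pi * t) \<in> unit_circle} = {0..<1}" by auto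
  then show ?thesis by (simp add: normalized_arclength_def)
qed

lemma dyadic_arc_0: "dyadic_arc 0 0 = unit_circle"
  by (simp add: dyadic_arc_def unit_circle_eq)

lemma dyadic_interval_subset:
  assumes "k < 2 ^ n" "real k / 2 ^ n \<le> t" "t < (real k + 1) / 2 ^ n"
  shows "0 \<le> t" "t < 1"
proof -
  have "real k + 1 \<le> 2 ^ n" using assms(1)
    by (metis Suc_eq_plus1 Suc_leI of_nat_1 of_nat_add of_nat_le_iff of_nat_numeral of_nat_power)
  then have "(real k + 1) / 2 ^ n \<le> 1" by simp
  then show "t < 1" using assms(3) by linarith
  have "0 \<le> real k / 2 ^ n" by simp
  then show "0 \<le> t" using assms(2) by linarith
qed

lemma arclength_dyadic_arc:
  assumes "k < 2 ^ n"
  shows "normalized_arclength (dyadic_arc n k) = 1 / 2 ^ n"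
proof -
  have "{t \<in> {0..<1}. cis (2 * pi * t) \<in> dyadic_arc n k} = {real k / 2 ^ n ..< (real k + 1) / 2 ^ n}"
  proof (intro equalityI subsetI)
    fix t assume t: "t \<in> {t \<in> {0..<1}. cis (2 * pi * t) \<in> dyadic_arc n k}"
    then obtain s where s: "real k / 2 ^ n \<le> s" "s < (real k + 1) / 2 ^ n" "cis (2 * pi * t) = cis (2 * pi * s)"
      by (auto simp: dyadic_arc_def)
    have "t = s"
    proof -
      have "turn (cis (2 * pi * t)) = t" using t by (intro turn_cis_unit) auto
      moreover have "turn (cis (2 * pi * s)) = s"
        using dyadic_interval_subset[OF assms s(1,2)] by (rule turn_cis_unit)
      ultimately show ?thesis using s(3) by metis
    qed
    then show "t \<in> {real k / 2 ^ n ..< (real k + 1) / 2 ^ n}" using s by auto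
  next
    fix t assume "t \<in> {real k / 2 ^ n ..< (real k + 1) / 2 ^ n}"
    then show "t \<in> {t \<in> {0..<1}. cis (2 * pi * t) \<in> dyadic_arc n k}"
      using dyadic_interval_subset[OF assms, of t] by (auto simp: dyadic_arc_def)
  qed
  moreover have "measure lborel {real k / 2 ^ n ..< (real k + 1) / 2 ^ n} = 1 / 2 ^ n"
    by (subst measure_lborel_Ico) (auto simp: divide_right_mono diff_divide_distrib[symmetric])
  ultimately show ?thesis by (simp only: normalized_arclength_def)
qed

lemma dyadic_arc_in_carleson_arcs:
  assumes "k < 2 ^ n"
  shows "dyadic_arc n k \<in> carleson_arcs"
proof -
  have "connected (dyadic_arc n k)"
    unfolding dyadic_arc_def by (intro connected_continuous_image continuous_intros) auto
  moreover have "(1::real) / 2 ^ n < 1 \<or> dyadic_arc n k = unit_circle"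
  proof (cases "n = 0")
    case True
    then show ?thesis using assms dyadic_arc_0 by simp
  next
    case False
    then have "(1::real) < 2 ^ n" by (intro one_less_power) auto
    then show ?thesis by simp
  qed
  ultimately show ?thesis
    unfolding carleson_arcs_def arclength_dyadic_arc[OF assms, symmetric]
    by (auto simp: dyadic_arc_def arclength_dyadic_arc[OF assms, unfolded dyadic_arc_def])
qed

lemma carleson_box_dyadic_arc:
  assumes "k < 2 ^ n"
  shows "carleson_box (dyadic_arc n k) = dyadic_box n k"
proof (cases "n = 0")
  case True
  then show ?thesis using assms by (simp add: carleson_box_def dyadic_arc_0 dyadic_box_0)
next
  case False
  then have lt: "(1::real) / 2 ^ n < 1" by (simp add: field_simps)
  then have ne: "dyadic_arc n k \<noteq> unit_circle"
    using arclength_dyadic_arc[OF assms] arclength_unit_circle by auto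
  show ?thesis
    unfolding carleson_box_def arclength_dyadic_arc[OF assms] if_not_P[OF ne]
  proof (intro equalityI subsetI)
    fix w assume "w \<in> {of_real r * \<zeta> |r \<zeta>. \<zeta> \<in> dyadic_arc n k \<and> 0 < r \<and> r < 1 \<and> 1 - r \<le> 1 / 2 ^ n}"
    then obtain r t where w: "w = of_real r * cis (2 * pi * t)" "real k / 2 ^ n \<le> t" "t < (real k + 1) / 2 ^ n"
      "0 < r" "r < 1" "1 - r \<le> 1 / 2 ^ n" by (auto simp: dyadic_arc_def)
    have "turn w = t" unfolding w(1)
      using w(4) dyadic_interval_subset[OF assms w(2,3)] by (intro turn_cis)
    moreover have "cmod w = r" using w(1,4) by (simp add: norm_mult)
    ultimately show "w \<in> dyadic_box n k"
      using w(2-6) by (simp add: dyadic_box_def dyadic_pos_eq_iff field_simps)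
  next
    fix w assume w: "w \<in> dyadic_box n k"
    have "0 < cmod w" using w lt by (auto simp: dyadic_box_def)
    moreover have "cis (2 * pi * turn w) \<in> dyadic_arc n k"
      unfolding dyadic_arc_def
      using w by (intro imageI) (simp add: dyadic_box_def dyadic_pos_eq_iff field_simps)
    ultimately show "w \<in> {of_real r * \<zeta> |r \<zeta>. \<zeta> \<in> dyadic_arc n k \<and> 0 < r \<and> r < 1 \<and> 1 - r \<le> 1 / 2 ^ n}"
      using turn_polar[of w] w unfolding dyadic_box_def
      by (intro CollectI exI[of _ "cmod w"] exI[of _ "cis (2 * pi * turn w)"]) auto
  qed
qed

lemma emeasure_dyadic_box_le:
  "emeasure \<mu> (dyadic_box n k) \<le> carleson_norm \<mu> * ennreal (1 / 2 ^ n)"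
proof (cases "k < 2 ^ n")
  case True
  have "emeasure \<mu> (carleson_box (dyadic_arc n k)) / ennreal (normalized_arclength (dyadic_arc n k))
      \<le> carleson_norm \<mu>"
    unfolding carleson_norm_def by (rule SUP_upper[OF dyadic_arc_in_carleson_arcs[OF True]])
  then have "emeasure \<mu> (dyadic_box n k) / ennreal (1 / 2 ^ n) \<le> carleson_norm \<mu>"
    by (simp only: carleson_box_dyadic_arc[OF True] arclength_dyadic_arc[OF True])
  then have "emeasure \<mu> (dyadic_box n k) / ennreal (1 / 2 ^ n) * ennreal (1 / 2 ^ n)
      \<le> carleson_norm \<mu> * ennreal (1 / 2 ^ n)" by (rule mult_right_mono) simp
  then show ?thesis
    by (subst (asm) ennreal_divide_times) (simp add: ennreal_divide_self)
next
  case False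
  then show ?thesis by (simp add: dyadic_box_empty)
qed

lemma cis_diff: "cis x - cis y = 2 * \<i> * of_real (sin ((x - y) / 2)) * cis ((x + y) / 2)"
proof (rule complex_eqI)
  have "cos x - cos y = - 2 * sin ((x + y) / 2) * sin ((x - y) / 2)"
  proof -
    have "sin ((y - x) / 2) = - sin ((x - y) / 2)"
      by (metis minus_diff_eq minus_divide_left sin_minus)
    then show ?thesis by (simp add: cos_diff_cos)
  qed
  then show "Re (cis x - cis y) = Re (2 * \<i> * of_real (sin ((x - y) / 2)) * cis ((x + y) / 2))"
    by simp
  have "sin x - sin y = 2 * sin ((x - y) / 2) * cos ((x + y) / 2)" by (simp add: sin_diff_sin)
  then show "Im (cis x - cis y) = Im (2 * \<i> * of_real (sin ((x - y) / 2)) * cis ((x + y) / 2))"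
    by simp
qed

lemma cmod_cis_diff_le: "cmod (cis x - cis y) \<le> \<bar>x - y\<bar>"
proof -
  have "cmod (cis x - cis y) = 2 * \<bar>sin ((x - y) / 2)\<bar>"
    by (simp add: cis_diff norm_mult)
  also have "\<dots> \<le> 2 * \<bar>(x - y) / 2\<bar>" by (intro mult_left_mono abs_sin_x_le_abs_x) auto
  finally show ?thesis by simp
qed

text \<open>If both open arcs between two points of \<open>I\<close> contained a point outside
  \<open>I\<close>, the line through these two missing points would separate \<open>I\<close>.\<close>

lemma connected_arc_cases:
  assumes I: "I \<subseteq> unit_circle" "connected I"
    and st: "0 \<le> s" "s < t" "t < 1" "cis (2 * pi * s) \<in> I" "cis (2 * pi * t) \<in> I"
  shows "(\<forall>u. s < u \<and> u < t \<longrightarrow> cis (2 * pi * u) \<in> I)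
    \<or> (\<forall>v. (0 \<le> v \<and> v < s) \<or> (t < v \<and> v < 1) \<longrightarrow> cis (2 * pi * v) \<in> I)"
proof (rule ccontr)
  assume "\<not> ?thesis"
  then obtain u v where u: "s < u" "u < t" "cis (2 * pi * u) \<notin> I"
    and v: "(0 \<le> v \<and> v < s) \<or> (t < v \<and> v < 1)" "cis (2 * pi * v) \<notin> I" by blast
  define L where "L = (\<lambda>w. Im ((w - cis (2 * pi * u)) * cnj (cis (2 * pi * v) - cis (2 * pi * u))))"
  have L: "L (cis (2 * pi * x)) = 4 * sin (pi * (x - u)) * sin (pi * (v - u)) * sin (pi * (x - v))" for x
  proof -
    have half: "(2 * pi * a - 2 * pi * b) / 2 = pi * (a - b)" "(2 * pi * a + 2 * pi * b) / 2 = pi * (a + b)"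
      for a b by (auto simp: field_simps)
    have "(cis (2 * pi * x) - cis (2 * pi * u)) * cnj (cis (2 * pi * v) - cis (2 * pi * u))
        = of_real (4 * sin (pi * (x - u)) * sin (pi * (v - u))) * (cis (pi * (x + u)) * cis (- (pi * (v + u))))"
      unfolding cis_diff half by (simp add: cis_cnj algebra_simps)
    also have "cis (pi * (x + u)) * cis (- (pi * (v + u))) = cis (pi * (x - v))"
      unfolding cis_mult by (simp add: algebra_simps)
    finally have e: "(cis (2 * pi * x) - cis (2 * pi * u)) * cnj (cis (2 * pi * v) - cis (2 * pi * u))
        = of_real (4 * sin (pi * (x - u)) * sin (pi * (v - u))) * cis (pi * (x - v))" .
    show ?thesis unfolding L_def e by simp
  qed
  have pos: "0 < sin (pi * a)" if "0 < a" "a < 1" for a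
    using that by (intro sin_gt_zero) auto
  have neg: "sin (pi * a) < 0" if "-1 < a" "a < 0" for a
    using pos[of "- a"] that by simp
  have uv: "0 \<le> u" "u < 1" "0 \<le> v" "v < 1" using st u v by auto
  have nz: "sin (pi * (x - y)) \<noteq> 0" if "0 \<le> x" "x < 1" "0 \<le> y" "y < 1" "x \<noteq> y" for x y
    using pos[of "x - y"] neg[of "x - y"] that by (cases "x < y") auto
  have "connected (L ` I)"
    unfolding L_def by (intro connected_continuous_image continuous_intros I)
  then have iv: "is_interval (L ` I)" by (simp add: is_interval_connected_1)
  have mem: "L (cis (2 * pi * s)) \<in> L ` I" "L (cis (2 * pi * t)) \<in> L ` I" using st by auto
  have "L (cis (2 * pi * s)) * L (cis (2 * pi * t)) < 0"
  proof -
    have "sin (pi * (s - u)) < 0" "0 < sin (pi * (t - u))"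
      using u uv st by (auto intro!: pos neg)
    then have 1: "sin (pi * (s - u)) * sin (pi * (t - u)) < 0" by (rule mult_neg_pos)
    have 2: "0 < sin (pi * (s - v)) * sin (pi * (t - v))"
      using v(1)
    proof
      assume "0 \<le> v \<and> v < s"
      then show ?thesis using st by (intro mult_pos_pos pos) auto
    next
      assume "t < v \<and> v < 1"
      then show ?thesis using st by (intro mult_neg_neg neg) auto
    qed
    have "sin (pi * (v - u)) \<noteq> 0" using uv u v by (intro nz) auto
    then have 3: "0 < (4 * sin (pi * (v - u)))\<^sup>2" by simp
    have "(sin (pi * (s - u)) * sin (pi * (t - u))) *
        ((4 * sin (pi * (v - u)))\<^sup>2 * (sin (pi * (s - v)) * sin (pi * (t - v)))) < 0"
      by (rule mult_neg_pos[OF 1 mult_pos_pos[OF 3 2]])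
    then show ?thesis unfolding L by (simp add: power2_eq_square mult_ac)
  qed
  then have "0 \<in> L ` I"
    using mem mem_is_interval_1_I[OF iv, of "L (cis (2 * pi * s))" "L (cis (2 * pi * t))" 0]
      mem_is_interval_1_I[OF iv, of "L (cis (2 * pi * t))" "L (cis (2 * pi * s))" 0]
    by (auto simp: mult_less_0_iff less_imp_le)
  then obtain w where w: "w \<in> I" "L w = 0" by auto
  then obtain x where x: "0 \<le> x" "x < 1" "w = cis (2 * pi * x)"
    using I(1) by (blast elim: unit_circleE)
  have "x \<noteq> u" "x \<noteq> v" using x w u v by auto
  then have "L w \<noteq> 0" unfolding x(3) L using nz uv x u v by auto
  then show False using w by simp
qed

text \<open>An arc contains one of the two arcs between any two of its points, so that its length controls its
  diameter.\<close>

lemma arc_diameter_le: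
  assumes I: "I \<subseteq> unit_circle" "connected I" "0 < normalized_arclength I" and ab: "a \<in> I" "b \<in> I"
  shows "cmod (a - b) \<le> 2 * pi * normalized_arclength I"
proof -
  define h where "h = normalized_arclength I"
  define T where "T = {t \<in> {0..<1}. cis (2 * pi * t) \<in> I}"
  have T: "T \<in> sets lborel"
  proof (rule ccontr)
    assume "T \<notin> sets lborel"
    then have "measure lborel T = 0" by (rule measure_notin_sets)
    then show False using I(3) by (simp add: normalized_arclength_def T_def)
  qed
  have T1: "T \<subseteq> {0..1}" by (auto simp: T_def)
  then have "emeasure lborel T \<le> emeasure lborel {0..1::real}" by (intro emeasure_mono) auto
  then have "T \<in> fmeasurable lborel" using T by (intro fmeasurableI) (auto simp: le_less_trans)
  then have hge: "measure lborel S \<le> h" if "S \<subseteq> T" "S \<in> sets lborel" for S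
    unfolding h_def normalized_arclength_def T_def[symmetric] using that by (intro measure_mono_fmeasurable)
  have main: "cmod (cis (2 * pi * s) - cis (2 * pi * t)) \<le> 2 * pi * h"
    if st: "0 \<le> s" "s < t" "t < 1" "cis (2 * pi * s) \<in> I" "cis (2 * pi * t) \<in> I" for s t
    using connected_arc_cases[OF I(1,2) st]
  proof
    assume "\<forall>u. s < u \<and> u < t \<longrightarrow> cis (2 * pi * u) \<in> I"
    then have "measure lborel {s<..<t} \<le> h" using st by (intro hge) (auto simp: T_def)
    then have "t - s \<le> h" using st by simp
    have "cmod (cis (2 * pi * s) - cis (2 * pi * t)) \<le> \<bar>2 * pi * s - 2 * pi * t\<bar>"
      by (rule cmod_cis_diff_le)
    also have "\<dots> = 2 * pi * (t - s)" using st by (simp add: algebra_simps abs_if)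
    also have "\<dots> \<le> 2 * pi * h" using \<open>t - s \<le> h\<close> by (intro mult_left_mono) auto
    finally show ?thesis .
  next
    assume "\<forall>v. (0 \<le> v \<and> v < s) \<or> (t < v \<and> v < 1) \<longrightarrow> cis (2 * pi * v) \<in> I"
    then have "measure lborel ({0..<s} \<union> {t<..<1}) \<le> h" using st by (intro hge) (auto simp: T_def)
    moreover have "measure lborel ({0..<s} \<union> {t<..<1}) = measure lborel {0..<s} + measure lborel {t<..<1}"
      using st by (intro measure_Union) auto
    ultimately have le: "s + (1 - t) \<le> h" using st by simp
    \<comment> \<open>Here \<open>I\<close> contains the arc through the point 1, which runs from
      \<open>t\<close> up to \<open>s + 1\<close>.\<close>
    have "cis (2 * pi * (s + 1)) = cis (2 * pi * s)"
      by (simp add: distrib_left cis_mult[symmetric])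
    then have "cmod (cis (2 * pi * s) - cis (2 * pi * t)) \<le> \<bar>2 * pi * (s + 1) - 2 * pi * t\<bar>"
      using cmod_cis_diff_le[of "2 * pi * (s + 1)" "2 * pi * t"] by simp
    also have "\<dots> = \<bar>2 * pi * (s + (1 - t))\<bar>" by (simp add: algebra_simps)
    also have "\<dots> = 2 * pi * (s + (1 - t))" using st by (intro abs_of_nonneg mult_nonneg_nonneg) auto
    also have "\<dots> \<le> 2 * pi * h" using le by (intro mult_left_mono) auto
    finally show ?thesis .
  qed
  obtain s where s: "0 \<le> s" "s < 1" "a = cis (2 * pi * s)"
    using ab(1) I(1) by (blast elim: unit_circleE)
  obtain t where t: "0 \<le> t" "t < 1" "b = cis (2 * pi * t)"
    using ab(2) I(1) by (blast elim: unit_circleE)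
  consider "s < t" | "t < s" | "s = t" by linarith
  then show ?thesis
  proof cases
    case 1
    then show ?thesis using main[of s t] s t ab by (simp add: h_def)
  next
    case 2
    then show ?thesis using main[of t s] s t ab by (simp add: h_def norm_minus_commute)
  next
    case 3
    then show ?thesis using s t I(3) by simp
  qed
qed

text \<open>For \<open>w\<close> on the unit circle this is the Poisson kernel of \<open>z\<close>; here
  \<open>w\<close> ranges over the disc.\<close>

abbreviation poisson_kernel :: "complex \<Rightarrow> complex \<Rightarrow> real" where
  "poisson_kernel z w \<equiv> (1 - (cmod z)\<^sup>2) / (cmod (1 - cnj z * w))\<^sup>2"

text \<open>For an arc of length \<open>h\<close> that contains \<open>\<zeta>\<close>, the kernel of
  \<open>(1 - h) \<zeta>\<close> is at least of order \<open>1 / h\<close> on the whole box,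
  because the box has diameter of order \<open>h\<close>.\<close>

lemma carleson_norm_le:
  assumes sets: "sets \<nu> = sets disc_borel"
    and K: "\<And>z. cmod z < 1 \<Longrightarrow> (\<integral>\<^sup>+ w. ennreal (poisson_kernel z w) \<partial>\<nu>) \<le> K"
  shows "carleson_norm \<nu> \<le> ennreal 100 * K"
  unfolding carleson_norm_def
proof (rule SUP_least)
  fix I assume "I \<in> carleson_arcs"
  then have I: "I \<subseteq> unit_circle" "connected I" "0 < normalized_arclength I"
    "normalized_arclength I < 1 \<or> I = unit_circle" by (auto simp: carleson_arcs_def)
  define h where "h = normalized_arclength I"
  have h0: "0 < h" using I by (simp add: h_def)
  show "emeasure \<nu> (carleson_box I) / ennreal (normalized_arclength I) \<le> ennreal 100 * K"
  proof (cases "carleson_box I \<in> sets \<nu>")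
    case False
    then show ?thesis by (simp add: emeasure_notin_sets)
  next
    case True
    have "\<exists>z. cmod z < 1 \<and> (\<forall>w\<in>carleson_box I. 1 / (100 * h) \<le> poisson_kernel z w)"
    proof (cases "I = unit_circle")
      case True
      then have "h = 1" by (simp add: h_def arclength_unit_circle)
      then show ?thesis by (intro exI[of _ 0]) simp
    next
      case False
      then have h1: "h < 1" using I by (auto simp: h_def)
      have "I \<noteq> {}"
      proof
        assume "I = {}"
        then show False using I(3) by (simp add: normalized_arclength_def)
      qed
      then obtain \<zeta> where \<zeta>: "\<zeta> \<in> I" by blast
      then have n\<zeta>: "cmod \<zeta> = 1" using I(1) by auto
      \<comment> \<open>The test point lies at the height of the box.\<close>
      define z where "z = of_real (1 - h) * \<zeta>"
      have nz: "cmod z = 1 - h" using n\<zeta> h1 unfolding z_def norm_mult norm_of_real by simp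
      have "1 / (100 * h) \<le> poisson_kernel z w" if "w \<in> carleson_box I" for w
      proof -
        from that False obtain r \<eta> where w: "w = of_real r * \<eta>" "\<eta> \<in> I" "0 < r" "r < 1" "1 - r \<le> h"
          by (auto simp: carleson_box_def h_def)
        have n\<eta>: "cmod \<eta> = 1" using w I(1) by auto
        have "1 - cnj z * w = (1 - (1 - h) * r) + (1 - h) * r * (cnj \<zeta> * (\<zeta> - \<eta>))"
        proof -
          have "cnj \<zeta> * \<zeta> = 1" using n\<zeta> complex_norm_square[of \<zeta>] by (simp add: mult.commute)
          then show ?thesis unfolding z_def w(1) by (simp add: algebra_simps)
        qed
        then have "cmod (1 - cnj z * w) \<le> cmod (of_real (1 - (1 - h) * r))
            + cmod (of_real ((1 - h) * r) * (cnj \<zeta> * (\<zeta> - \<eta>)))"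
          by (metis (no_types, lifting) norm_triangle_ineq of_real_1 of_real_diff of_real_mult)
        also have "\<dots> = \<bar>1 - (1 - h) * r\<bar> + (1 - h) * r * cmod (\<zeta> - \<eta>)"
          using h1 w(3) n\<zeta> by (simp only: norm_mult norm_of_real complex_mod_cnj) simp
        also have "\<dots> \<le> 2 * h + 1 * (2 * pi * h)"
        proof (intro add_mono mult_mono)
          have "(1 - h) * r \<le> 1 * 1" using h0 h1 w by (intro mult_mono) auto
          moreover have "1 - (1 - h) * r = (1 - r) + h * r" by (simp add: algebra_simps)
          moreover have "h * r \<le> h * 1" using h0 w by (intro mult_left_mono) auto
          ultimately show "\<bar>1 - (1 - h) * r\<bar> \<le> 2 * h" using w(5) by linarith
          show "(1 - h) * r \<le> 1" using \<open>(1 - h) * r \<le> 1 * 1\<close> by simp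
          show "cmod (\<zeta> - \<eta>) \<le> 2 * pi * h"
            unfolding h_def using arc_diameter_le[OF I(1-3) \<zeta> w(2)] .
        qed auto
        also have "\<dots> \<le> 10 * h"
          using h0 mult_right_mono[of pi 4 h] pi_less_4 by simp
        finally have le: "(cmod (1 - cnj z * w))\<^sup>2 \<le> (10 * h)\<^sup>2" by (intro power_mono) auto
        have wlt: "cmod w < 1" using w n\<eta> by (simp add: norm_mult)
        have pos: "0 < (cmod (1 - cnj z * w))\<^sup>2"
          using one_minus_cnj_mult_nonzero[of z w] wlt nz h0 by simp
        have "h * 1 \<le> h * (2 - h)" using h0 h1 by (intro mult_left_mono) auto
        then have "h \<le> 1 - (cmod z)\<^sup>2" unfolding nz by (simp add: power2_eq_square algebra_simps)
        then have "h / (10 * h)\<^sup>2 \<le> (1 - (cmod z)\<^sup>2) / (cmod (1 - cnj z * w))\<^sup>2"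
          using le pos h0 by (intro frac_le) auto
        then show ?thesis using h0 by (simp add: power2_eq_square)
      qed
      then show ?thesis using nz h0 by (intro exI[of _ z]) auto
    qed
    then obtain z where z: "cmod z < 1" "\<And>w. w \<in> carleson_box I \<Longrightarrow> 1 / (100 * h) \<le> poisson_kernel z w" by blast
    have "ennreal (1 / (100 * h)) * emeasure \<nu> (carleson_box I)
        = (\<integral>\<^sup>+ w. ennreal (1 / (100 * h)) * indicator (carleson_box I) w \<partial>\<nu>)"
      using True by (simp add: nn_integral_cmult_indicator)
    also have "\<dots> \<le> (\<integral>\<^sup>+ w. ennreal (poisson_kernel z w) \<partial>\<nu>)"
      by (intro nn_integral_mono) (auto simp: indicator_def intro!: ennreal_leI z)
    also have "\<dots> \<le> K" by (rule K[OF z(1)])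
    finally have "ennreal (100 * h) * (ennreal (1 / (100 * h)) * emeasure \<nu> (carleson_box I))
        \<le> ennreal (100 * h) * K" by (rule mult_left_mono) simp
    then have "emeasure \<nu> (carleson_box I) \<le> ennreal (100 * h) * K"
      using h0 by (simp add: mult.assoc[symmetric] ennreal_mult[symmetric])
    then have "emeasure \<nu> (carleson_box I) \<le> (ennreal 100 * K) * ennreal h"
      using h0 by (simp add: ennreal_mult mult_ac)
    then show ?thesis
      unfolding h_def[symmetric] using h0 by (intro divide_le_posI_ennreal) (auto simp: mult.commute)
  qed
qed

lemma self_map_measurable:
  assumes "continuous_on unit_disc \<Phi>" "\<Phi> ` unit_disc \<subseteq> unit_disc"
  shows "\<Phi> \<in> disc_borel \<rightarrow>\<^sub>M disc_borel"
  using assms by (intro measurable_restrict_space2 borel_measurable_continuous_on_restrict)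
    (auto simp: space_restrict_space)

lemma disc_weight_measurable:
  assumes "continuous_on unit_disc \<Phi>"
  shows "disc_weight \<Phi> \<in> borel_measurable disc_borel"
  unfolding disc_weight_def using assms
  by (intro borel_measurable_continuous_on_restrict continuous_intros) (auto simp: abs_square_eq_1)

lemma nn_integral_weighted_pushforward:
  assumes \<Phi>: "continuous_on unit_disc \<Phi>" "\<Phi> ` unit_disc \<subseteq> unit_disc"
    and sets: "sets \<mu> = sets disc_borel" and g: "g \<in> borel_measurable disc_borel"
  shows "(\<integral>\<^sup>+ w. g w \<partial>weighted_pushforward \<Phi> \<mu>) = (\<integral>\<^sup>+ w. ennreal (disc_weight \<Phi> w) * g (\<Phi> w) \<partial>\<mu>)"
proof -
  have m: "\<Phi> \<in> \<mu> \<rightarrow>\<^sub>M disc_borel"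
    using self_map_measurable[OF \<Phi>] measurable_cong_sets[OF sets refl] by blast
  have q: "disc_weight \<Phi> \<in> borel_measurable \<mu>"
    using disc_weight_measurable[OF \<Phi>(1)] measurable_cong_sets[OF sets refl] by blast
  have "(\<integral>\<^sup>+ w. g w \<partial>weighted_pushforward \<Phi> \<mu>)
      = (\<integral>\<^sup>+ w. g (\<Phi> w) \<partial>density \<mu> (\<lambda>z. ennreal (disc_weight \<Phi> z)))"
    unfolding weighted_pushforward_def using m g by (intro nn_integral_distr) auto
  also have "\<dots> = (\<integral>\<^sup>+ w. ennreal (disc_weight \<Phi> w) * g (\<Phi> w) \<partial>\<mu>)"
    using q measurable_compose[OF m g] by (intro nn_integral_density) auto
  finally show ?thesis .
qed

lemma sets_weighted_pushforward [simp]: "sets (weighted_pushforward \<Phi> \<mu>) = sets disc_borel"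
  by (simp add: weighted_pushforward_def)

lemma poisson_kernel_measurable: "cmod z < 1 \<Longrightarrow> poisson_kernel z \<in> borel_measurable disc_borel"
  using one_minus_cnj_mult_nonzero
  by (intro borel_measurable_continuous_on_restrict continuous_intros) (auto intro: less_imp_le)

section \<open>Bounded pushforwards preserve interpolating sequences\<close>

definition point_masses :: "'i set \<Rightarrow> ('i \<Rightarrow> complex) \<Rightarrow> complex measure" where
  "point_masses F \<Lambda> = distr (point_measure F (\<lambda>j. ennreal (1 - (cmod (\<Lambda> j))\<^sup>2))) disc_borel \<Lambda>"

lemma nn_integral_point_masses:
  assumes "finite F" "\<Lambda> ` F \<subseteq> unit_disc" "g \<in> borel_measurable disc_borel"
  shows "(\<integral>\<^sup>+ w. g w \<partial>point_masses F \<Lambda>) = (\<Sum>j\<in>F. ennreal (1 - (cmod (\<Lambda> j))\<^sup>2) * g (\<Lambda> j))"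
  unfolding point_masses_def using assms
  by (subst nn_integral_distr) (auto simp: nn_integral_point_measure_finite space_restrict_space)

lemma sets_point_masses [simp]: "sets (point_masses F \<Lambda>) = sets disc_borel"
  by (simp add: point_masses_def)

lemma carleson_norm_point_masses_le:
  assumes F: "finite F" "\<Lambda> ` F \<subseteq> unit_disc" and K: "kernel_bounded K F \<Lambda>"
  shows "carleson_norm (point_masses F \<Lambda>) \<le> ennreal 100 * ennreal K"
proof (rule carleson_norm_le)
  fix z :: complex assume z: "cmod z < 1"
  have m: "(\<lambda>w. ennreal (poisson_kernel z w)) \<in> borel_measurable disc_borel"
    using poisson_kernel_measurable[OF z] by simp
  have D: "cmod (\<Lambda> j) < 1" if "j \<in> F" for j using F that by auto
  have "(\<integral>\<^sup>+ w. ennreal (poisson_kernel z w) \<partial>point_masses F \<Lambda>)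
      = (\<Sum>j\<in>F. ennreal (1 - (cmod (\<Lambda> j))\<^sup>2) * ennreal (poisson_kernel z (\<Lambda> j)))"
    by (rule nn_integral_point_masses[OF F m])
  also have "\<dots> = (\<Sum>j\<in>F. ennreal (hyp_kernel z (\<Lambda> j)))"
  proof (rule sum.cong)
    fix j assume "j \<in> F"
    then have "cmod (\<Lambda> j) < 1" by (rule D)
    then show "ennreal (1 - (cmod (\<Lambda> j))\<^sup>2) * ennreal (poisson_kernel z (\<Lambda> j)) = ennreal (hyp_kernel z (\<Lambda> j))"
      using z by (subst ennreal_mult[symmetric]) (auto simp: hyp_kernel_eq abs_square_le_1 mult_ac less_imp_le)
  qed simp
  also have "\<dots> = ennreal (\<Sum>j\<in>F. hyp_kernel z (\<Lambda> j))"
    using D by (intro sum_ennreal hyp_kernel_nonneg z less_imp_le)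
  also have "\<dots> \<le> ennreal K" using F by (intro ennreal_leI kernel_boundedD[OF K z]) auto
  finally show "(\<integral>\<^sup>+ w. ennreal (poisson_kernel z w) \<partial>point_masses F \<Lambda>) \<le> ennreal K" .
qed simp

text \<open>Separation is carried over by the uniform continuity of the inverse map. For the kernel sums,
  apply the hypothesis on measures to the point masses
  \<open>1 - \<bar>\<Lambda> j\<bar>\<^sup>2\<close> at finitely many points
  \<open>\<Lambda> j\<close>: the weight turns them into the masses
  \<open>1 - \<bar>\<Phi> (\<Lambda> j)\<bar>\<^sup>2\<close> at the images, and the bounds do not
  depend on the number of points.\<close>

lemma bounded_pushforward_preserves_carleson:
  assumes \<Phi>: "continuous_on unit_disc \<Phi>" "\<Phi> ` unit_disc \<subseteq> unit_disc"
    and \<Psi>: "homeomorphism unit_disc unit_disc \<Phi> \<Psi>" "pseudohyp_uniformly_continuous \<Psi>"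
    and C: "C < \<infinity>" "\<And>\<mu>. carleson_measure \<mu> \<Longrightarrow> carleson_norm (weighted_pushforward \<Phi> \<mu>) \<le> C * carleson_norm \<mu>"
    and \<Lambda>: "carleson_sequence J \<Lambda>"
  shows "carleson_sequence J (\<Phi> \<circ> \<Lambda>)"
proof -
  have D: "\<Lambda> ` J \<subseteq> unit_disc" using \<Lambda> by (simp add: carleson_sequence_def)
  then have D\<Phi>: "(\<Phi> \<circ> \<Lambda>) ` J \<subseteq> unit_disc" using \<Phi>(2) by auto
  obtain \<delta> K where \<delta>: "0 < \<delta>" and sep: "pseudohyp_separated \<delta> J \<Lambda>" and K: "kernel_bounded K J \<Lambda>"
    using carleson_sequence_necessary[OF \<Lambda>] by blast
  obtain \<delta>' where \<delta>': "\<delta>' > 0" "\<And>z w. z \<in> unit_disc \<Longrightarrow> w \<in> unit_disc \<Longrightarrow>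
      pseudohyperbolic z w < \<delta>' \<Longrightarrow> pseudohyperbolic (\<Psi> z) (\<Psi> w) < \<delta>"
    using \<Psi>(2) \<delta> unfolding pseudohyp_uniformly_continuous_def by meson
  have sep': "pseudohyp_separated \<delta>' J (\<Phi> \<circ> \<Lambda>)"
    unfolding pseudohyp_separated_def
  proof (intro ballI impI)
    fix i j assume ij: "i \<in> J" "j \<in> J" "i \<noteq> j"
    have inv: "\<Psi> (\<Phi> (\<Lambda> k)) = \<Lambda> k" "\<Phi> (\<Lambda> k) \<in> unit_disc" if "k \<in> J" for k
      using that D D\<Phi> \<Psi>(1) by (auto simp: homeomorphism_def)
    show "\<delta>' \<le> pseudohyperbolic ((\<Phi> \<circ> \<Lambda>) i) ((\<Phi> \<circ> \<Lambda>) j)"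
    proof (rule ccontr)
      assume "\<not> ?thesis"
      then have "pseudohyperbolic (\<Psi> (\<Phi> (\<Lambda> i))) (\<Psi> (\<Phi> (\<Lambda> j))) < \<delta>"
        using inv ij by (intro \<delta>'(2)) auto
      then show False using inv ij pseudohyp_separatedD[OF sep ij] by simp
    qed
  qed
  define A where "A = enn2real (C * (ennreal 100 * ennreal K))"
  have "C * (ennreal 100 * ennreal K) < \<infinity>" using C(1) by (auto simp: ennreal_mult_less_top)
  then have A: "ennreal A = C * (ennreal 100 * ennreal K)" unfolding A_def by simp
  have "kernel_bounded (80 * A) J (\<Phi> \<circ> \<Lambda>)"
  proof (rule kernel_boundedI)
    fix z F assume z: "cmod z < 1" and F: "finite F" "F \<subseteq> J"
    have DF: "\<Lambda> ` F \<subseteq> unit_disc" using D F by auto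
    have D1: "cmod (\<Lambda> j) < 1" "cmod (\<Phi> (\<Lambda> j)) < 1" if "j \<in> F" for j
    proof -
      have "\<Lambda> j \<in> unit_disc" "\<Phi> (\<Lambda> j) \<in> unit_disc" using that DF \<Phi>(2) by blast+
      then show "cmod (\<Lambda> j) < 1" "cmod (\<Phi> (\<Lambda> j)) < 1" by auto
    qed
    let ?\<mu> = "point_masses F \<Lambda>"
    have KF: "kernel_bounded K F \<Lambda>" using K F(2) by (auto simp: kernel_bounded_def)
    have norm: "carleson_norm ?\<mu> \<le> ennreal 100 * ennreal K"
      by (rule carleson_norm_point_masses_le[OF F(1) DF KF])
    also have "\<dots> < \<infinity>" by (auto simp: ennreal_mult_less_top)
    finally have "carleson_measure ?\<mu>" by (simp add: carleson_measure_def)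
    then have "carleson_norm (weighted_pushforward \<Phi> ?\<mu>) \<le> C * carleson_norm ?\<mu>" by (rule C(2))
    also have "\<dots> \<le> ennreal A" unfolding A using norm by (intro mult_left_mono) auto
    finally have normA: "carleson_norm (weighted_pushforward \<Phi> ?\<mu>) \<le> ennreal A" .
    have "(\<Sum>j\<in>F. (1 - (cmod (\<Phi> (\<Lambda> j)))\<^sup>2) * poisson_kernel z (\<Phi> (\<Lambda> j))) \<le> 80 * A"
    proof (rule box_sums_imp_kernel_sum_bound[OF F(1) _ _ _ z])
      fix n k
      let ?B = "dyadic_box n k"
      have q: "(\<lambda>w. ennreal (disc_weight \<Phi> w) * indicator ?B (\<Phi> w)) \<in> borel_measurable disc_borel"
      proof -
        have "(\<lambda>w. indicator ?B (\<Phi> w) :: ennreal) \<in> borel_measurable disc_borel"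
          using borel_measurable_indicator[OF dyadic_box_sets]
          by (rule measurable_compose[OF self_map_measurable[OF \<Phi>]])
        then show ?thesis using disc_weight_measurable[OF \<Phi>(1)] by simp
      qed
      have "ennreal (\<Sum>j | j \<in> F \<and> \<Phi> (\<Lambda> j) \<in> ?B. 1 - (cmod (\<Phi> (\<Lambda> j)))\<^sup>2)
          = (\<Sum>j | j \<in> F \<and> \<Phi> (\<Lambda> j) \<in> ?B. ennreal (1 - (cmod (\<Phi> (\<Lambda> j)))\<^sup>2))"
        using D1 by (intro sum_ennreal[symmetric]) (auto simp: abs_square_le_1 less_imp_le)
      also have "\<dots> = (\<Sum>j\<in>F. ennreal (1 - (cmod (\<Phi> (\<Lambda> j)))\<^sup>2) * indicator ?B (\<Phi> (\<Lambda> j)))"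
        using F(1) by (intro sum.mono_neutral_cong_left) (auto simp: indicator_def)
      also have "\<dots> = (\<Sum>j\<in>F. ennreal (1 - (cmod (\<Lambda> j))\<^sup>2) *
          (ennreal (disc_weight \<Phi> (\<Lambda> j)) * indicator ?B (\<Phi> (\<Lambda> j))))"
      proof (rule sum.cong[OF refl])
        fix j assume j: "j \<in> F"
        have "0 < 1 - (cmod (\<Lambda> j))\<^sup>2" "0 \<le> 1 - (cmod (\<Phi> (\<Lambda> j)))\<^sup>2"
          using D1[OF j] by (auto simp: abs_square_less_1 abs_square_le_1)
        then have "ennreal (1 - (cmod (\<Lambda> j))\<^sup>2) * ennreal (disc_weight \<Phi> (\<Lambda> j)) = ennreal (1 - (cmod (\<Phi> (\<Lambda> j)))\<^sup>2)"
          by (subst ennreal_mult[symmetric]) (auto simp: disc_weight_def)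
        then show "ennreal (1 - (cmod (\<Phi> (\<Lambda> j)))\<^sup>2) * indicator ?B (\<Phi> (\<Lambda> j)) = ennreal (1 - (cmod (\<Lambda> j))\<^sup>2) *
          (ennreal (disc_weight \<Phi> (\<Lambda> j)) * indicator ?B (\<Phi> (\<Lambda> j)))"
          by (simp add: mult.assoc[symmetric])
      qed
      also have "\<dots> = (\<integral>\<^sup>+ w. ennreal (disc_weight \<Phi> w) * indicator ?B (\<Phi> w) \<partial>?\<mu>)"
        by (rule nn_integral_point_masses[OF F(1) DF q, symmetric])
      also have "\<dots> = (\<integral>\<^sup>+ w. indicator ?B w \<partial>weighted_pushforward \<Phi> ?\<mu>)"
        using dyadic_box_sets by (intro nn_integral_weighted_pushforward[OF \<Phi>, symmetric]) auto
      also have "\<dots> = emeasure (weighted_pushforward \<Phi> ?\<mu>) ?B"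
        using dyadic_box_sets by (intro nn_integral_indicator) simp
      also have "\<dots> \<le> carleson_norm (weighted_pushforward \<Phi> ?\<mu>) * ennreal (1 / 2 ^ n)"
        by (rule emeasure_dyadic_box_le)
      also have "\<dots> \<le> ennreal A * ennreal (1 / 2 ^ n)" by (intro mult_right_mono normA) auto
      also have "\<dots> = ennreal (A / 2 ^ n)" by (simp add: ennreal_mult[symmetric] A_def)
      finally show "(\<Sum>j | j \<in> F \<and> \<Phi> (\<Lambda> j) \<in> ?B. 1 - (cmod (\<Phi> (\<Lambda> j)))\<^sup>2) \<le> A / 2 ^ n"
        by (subst (asm) ennreal_le_iff) (auto simp: A_def)
    qed (use D1 in \<open>auto simp: abs_square_le_1 less_imp_le\<close>)
    also have "(\<Sum>j\<in>F. (1 - (cmod (\<Phi> (\<Lambda> j)))\<^sup>2) * poisson_kernel z (\<Phi> (\<Lambda> j))) = (\<Sum>j\<in>F. hyp_kernel z ((\<Phi> \<circ> \<Lambda>) j))"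
      using D1 z by (intro sum.cong) (auto simp: hyp_kernel_eq less_imp_le)
    finally show "(\<Sum>j\<in>F. hyp_kernel z ((\<Phi> \<circ> \<Lambda>) j)) \<le> 80 * A" .
  qed
  then show ?thesis by (rule carleson_sequence_sufficient[OF D\<Phi> \<delta>'(1) sep'])
qed

section \<open>Lacunary unions of finite blocks\<close>

text \<open>A dyadic box of level \<open>n\<close> sees a block in one of three ways. If the block lies beyond
  level \<open>n\<close> (\<open>n \<le> g m\<close>), its total mass is used, and these masses
  form a geometric series. If the block lies entirely above the box
  (\<open>g (m + 1) \<le> n\<close>), it does not meet the box. The intermediate case occurs for
  at most one block, and there the Carleson condition of that block is used.\<close>

lemma lacunary_union:
  fixes E :: "nat \<Rightarrow> complex set"
  assumes g: "strict_mono g" and A: "0 \<le> A"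
    and E: "\<And>m. finite (E m)" "\<And>m. E m \<subseteq> unit_disc"
    and sep: "\<And>m. pseudohyp_separated \<epsilon> (E m) (\<lambda>w. w)"
    and dyadic: "\<And>m. dyadic_carleson A (E m)"
    and total: "\<And>m. (\<Sum>w\<in>E m. 1 - cmod w) \<le> A / 2 ^ g m"
    and outer: "\<And>m w. w \<in> E m \<Longrightarrow> 1 - cmod w \<le> 1 / 2 ^ g m"
    and inner: "\<And>m w. w \<in> E m \<Longrightarrow> 2 / 2 ^ g (Suc m) \<le> 1 - cmod w"
  shows "disjoint_family E"
    and "pseudohyp_separated (min \<epsilon> (1/3)) (\<Union>m. E m) (\<lambda>w. w)"
    and "dyadic_carleson (3 * A) (\<Union>m. E m)"
proof -
  have D: "cmod w < 1" if "w \<in> E m" for w m using E(2)[of m] that by auto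
  have g_mono: "g m \<le> g m'" if "m \<le> m'" for m m'
    using g that by (simp add: strict_mono_less_eq)
  have half: "1 - cmod w' \<le> (1 - cmod w) / 2" if "m < m'" "w \<in> E m" "w' \<in> E m'" for m m' w w'
  proof -
    have "1 - cmod w' \<le> 1 / 2 ^ g m'" by (rule outer[OF that(3)])
    also have "\<dots> \<le> 1 / 2 ^ g (Suc m)"
      using that(1) by (intro divide_left_mono power_increasing g_mono) auto
    also have "\<dots> \<le> (1 - cmod w) / 2" using inner[OF that(2)] by simp
    finally show ?thesis .
  qed
  have disj: "E m \<inter> E m' = {}" if "m < m'" for m m'
    using half[OF that] D by fastforce
  show "disjoint_family E"
    unfolding disjoint_family_on_def
  proof (intro ballI impI)
    fix m m' :: nat assume "m \<noteq> m'"
    then show "E m \<inter> E m' = {}" using disj[of m m'] disj[of m' m] by (cases "m < m'") auto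
  qed
  then have disjoint: "\<And>m m'. m \<noteq> m' \<Longrightarrow> E m \<inter> E m' = {}" by (auto simp: disjoint_family_on_def)
  show "pseudohyp_separated (min \<epsilon> (1/3)) (\<Union>m. E m) (\<lambda>w. w)"
    unfolding pseudohyp_separated_def
  proof (intro ballI impI)
    fix z w assume "z \<in> (\<Union>m. E m)" "w \<in> (\<Union>m. E m)" and ne: "z \<noteq> w"
    then obtain m m' where m: "z \<in> E m" "w \<in> E m'" by blast
    consider "m = m'" | "m < m'" | "m' < m" by linarith
    then show "min \<epsilon> (1/3) \<le> pseudohyperbolic z w"
    proof cases
      case 1
      then show ?thesis using pseudohyp_separatedD[OF sep, of z m w] m ne by auto
    next
      case 2
      then show ?thesis
        using pseudohyperbolic_ge_radial[OF D[OF m(1)] D[OF m(2)] half[OF 2 m]] by linarith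
    next
      case 3
      then show ?thesis
        using pseudohyperbolic_ge_radial[OF D[OF m(2)] D[OF m(1)] half[OF 3 m(2,1)]]
        by (simp add: pseudohyperbolic_commute min.coboundedI2)
    qed
  qed
  show "dyadic_carleson (3 * A) (\<Union>m. E m)"
    unfolding dyadic_carleson_def
  proof (intro allI impI)
    fix F n k assume F: "finite F" "F \<subseteq> (\<Union>m. E m)"
    let ?B = "dyadic_box n k"
    have "\<exists>M. F \<subseteq> (\<Union>m<M. E m)"
      using F
    proof (induction F rule: finite_induct)
      case (insert w F)
      then obtain M where "F \<subseteq> (\<Union>m<M. E m)" by auto
      moreover obtain m where "w \<in> E m" using insert by auto
      ultimately show ?case
        by (intro exI[of _ "max M (Suc m)"]) (fastforce simp: less_max_iff_disj)
    qed auto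
    then obtain M where M: "F \<subseteq> (\<Union>m<M. E m)" by blast
    define a where "a m = (if n \<le> g m then (1/2) ^ g m else 0 :: real)" for m
    define b where "b m = (if g m < n \<and> n < g (Suc m) then (1/2) ^ n else 0 :: real)" for m
    have block: "(\<Sum>w\<in>E m \<inter> ?B. 1 - cmod w) \<le> A * a m + A * b m" for m
    proof -
      consider "n \<le> g m" | "g m < n" "n < g (Suc m)" | "g m < n" "g (Suc m) \<le> n" by linarith
      then show ?thesis
      proof cases
        case 1
        have "(\<Sum>w\<in>E m \<inter> ?B. 1 - cmod w) \<le> (\<Sum>w\<in>E m. 1 - cmod w)"
          using E(1)[of m] D[of _ m] by (intro sum_mono2) (auto intro: less_imp_le)
        also have "\<dots> \<le> A / 2 ^ g m" by (rule total)
        finally show ?thesis using 1 A by (simp add: a_def b_def power_one_over)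
      next
        case 2
        have "(\<Sum>w\<in>E m \<inter> ?B. 1 - cmod w) \<le> A / 2 ^ n"
          using dyadic_carlesonD[OF dyadic E(1) order_refl] .
        then show ?thesis using 2 by (simp add: a_def b_def power_one_over)
      next
        case 3
        have "w \<notin> ?B" if w: "w \<in> E m" for w
        proof
          assume "w \<in> ?B"
          then have "1 - cmod w \<le> 1 / 2 ^ n" by (simp add: dyadic_box_def)
          also have "\<dots> \<le> 1 / 2 ^ g (Suc m)"
            using 3 by (intro divide_left_mono power_increasing) auto
          also have "\<dots> < 2 / 2 ^ g (Suc m)" by (simp add: divide_strict_right_mono)
          finally show False using inner[OF w] by linarith
        qed
        then have "E m \<inter> ?B = {}" by blast
        then show ?thesis using A by (simp add: a_def b_def)
      qed
    qed
    have "(\<Sum>w\<in>F \<inter> ?B. 1 - cmod w) \<le> (\<Sum>w\<in>(\<Union>m<M. E m \<inter> ?B). 1 - cmod w)"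
      using M E(1) D by (intro sum_mono2) (auto intro: less_imp_le)
    also have "\<dots> = (\<Sum>m<M. \<Sum>w\<in>E m \<inter> ?B. 1 - cmod w)"
      using E(1) disjoint by (intro sum.UNION_disjoint) blast+
    also have "\<dots> \<le> (\<Sum>m<M. A * a m + A * b m)" by (intro sum_mono block)
    also have "\<dots> = A * ((\<Sum>m<M. a m) + (\<Sum>m<M. b m))"
      by (simp add: sum.distrib sum_distrib_left distrib_left)
    also have "\<dots> \<le> A * (2 * (1/2) ^ n + (1/2) ^ n)"
    proof (intro mult_left_mono add_mono A)
      have "(\<Sum>m<M. a m) = (\<Sum>m\<in>{m\<in>{..<M}. n \<le> g m}. (1/2) ^ g m)"
        unfolding a_def by (rule sum.inter_filter[symmetric]) simp
      also have "\<dots> = (\<Sum>i\<in>g ` {m\<in>{..<M}. n \<le> g m}. (1/2) ^ i)"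
        using strict_mono_imp_inj_on[OF g] by (subst sum.reindex) (auto intro: inj_on_subset)
      also have "\<dots> \<le> (1/2) ^ n / (1 - 1/2)" by (rule geometric_tail_bound) auto
      finally show "(\<Sum>m<M. a m) \<le> 2 * (1/2) ^ n" by simp
      define T where "T = {m\<in>{..<M}. g m < n \<and> n < g (Suc m)}"
      have "card T \<le> 1"
      proof (rule card_le_Suc0_iff_eq[THEN iffD2, unfolded One_nat_def[symmetric]])
        show "finite T" by (simp add: T_def)
        show "\<forall>x\<in>T. \<forall>y\<in>T. x = y"
        proof (intro ballI)
          fix x y assume "x \<in> T" "y \<in> T"
          then have "\<not> Suc x \<le> y" "\<not> Suc y \<le> x"
            using g_mono[of "Suc x" y] g_mono[of "Suc y" x] by (auto simp: T_def)
          then show "x = y" by linarith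
        qed
      qed
      moreover have "(\<Sum>m<M. b m) = (\<Sum>m\<in>T. (1/2) ^ n)"
        unfolding b_def T_def by (rule sum.inter_filter[symmetric]) simp
      ultimately show "(\<Sum>m<M. b m) \<le> (1/2) ^ n"
        using mult_right_mono[of "real (card T)" 1 "(1/2) ^ n"] by simp
    qed
    also have "\<dots> = 3 * A / 2 ^ n" by (simp add: power_one_over field_simps)
    finally show "(\<Sum>w\<in>F \<inter> ?B. 1 - cmod w) \<le> 3 * A / 2 ^ n" .
  qed
qed

text \<open>A finite set that is admissible as a building block of a lacunary union: its points lie within
  \<open>2 ^ - g\<close> of the circle, and its total mass is so small that it is harmless for
  boxes larger than \<open>2 ^ - g\<close>.\<close>

definition outer_block :: "real \<Rightarrow> real \<Rightarrow> nat \<Rightarrow> complex set \<Rightarrow> bool" where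
  "outer_block \<epsilon> A g E \<longleftrightarrow> finite E \<and> E \<subseteq> unit_disc \<and> pseudohyp_separated \<epsilon> E (\<lambda>w. w) \<and>
     dyadic_carleson A E \<and> (\<Sum>w\<in>E. 1 - cmod w) \<le> A / 2 ^ g \<and> (\<forall>w\<in>E. 1 - cmod w \<le> 1 / 2 ^ g)"

text \<open>Properness, the uniform continuity of the inverse and the uniform kernel bound all rest on this
  lemma: if bad finite blocks \<open>Q m\<close> exist arbitrarily close to the circle, then
  infinitely many of them can be united into one set that still satisfies Carleson's condition.\<close>

lemma lacunary_selection:
  assumes ex: "\<And>m g. \<exists>E. Q m E \<and> outer_block \<epsilon> A g E" and A: "0 \<le> A"
  obtains E :: "nat \<Rightarrow> complex set" where "\<And>m. Q m (E m)" "\<And>m. finite (E m)" "(\<Union>m. E m) \<subseteq> unit_disc"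
    "disjoint_family E" "pseudohyp_separated (min \<epsilon> (1/3)) (\<Union>m. E m) (\<lambda>w. w)"
    "dyadic_carleson (3 * A) (\<Union>m. E m)"
proof -
  have next_scale: "\<exists>g'>g. \<forall>w\<in>E. 2 / 2 ^ g' \<le> 1 - cmod w" if "outer_block \<epsilon> A g E" for g E
  proof -
    have E: "finite E" "\<And>w. w \<in> E \<Longrightarrow> cmod w < 1" using that by (auto simp: outer_block_def)
    define s where "s = Min (insert 1 ((\<lambda>w. 1 - cmod w) ` E))"
    have "0 < s" unfolding s_def using E by (subst Min_gr_iff) auto
    then obtain k where k: "(1/2::real) ^ k < s / 2" using real_arch_pow_inv[of "s / 2" "1/2"] by auto
    define g' where "g' = max k (Suc g)"
    have "(1/2::real) ^ g' \<le> (1/2) ^ k" unfolding g'_def by (intro power_decreasing) auto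
    then have "2 / 2 ^ g' \<le> s" using k by (simp add: power_one_over)
    moreover have "s \<le> 1 - cmod w" if "w \<in> E" for w
      unfolding s_def using E(1) that by (intro Min_le) auto
    ultimately show ?thesis by (intro exI[of _ g']) (force simp: g'_def)
  qed
  have "\<exists>f. \<forall>m. (Q m (snd (f m)) \<and> outer_block \<epsilon> A (fst (f m)) (snd (f m))) \<and>
      (fst (f m) < fst (f (Suc m)) \<and> (\<forall>w\<in>snd (f m). 2 / 2 ^ fst (f (Suc m)) \<le> 1 - cmod w))"
  proof (rule dependent_nat_choice, goal_cases)
    case 1
    then show ?case using ex[of 0 0] by auto
  next
    case (2 x m)
    obtain g' where "g' > fst x" "\<forall>w\<in>snd x. 2 / 2 ^ g' \<le> 1 - cmod w"
      using next_scale 2 by blast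
    moreover obtain E where "Q (Suc m) E" "outer_block \<epsilon> A g' E" using ex by blast
    ultimately show ?case by (intro exI[of _ "(g', E)"]) auto
  qed
  then obtain f where f: "\<And>m. Q m (snd (f m))" "\<And>m. outer_block \<epsilon> A (fst (f m)) (snd (f m))"
    "\<And>m. fst (f m) < fst (f (Suc m))"
    "\<And>m w. w \<in> snd (f m) \<Longrightarrow> 2 / 2 ^ fst (f (Suc m)) \<le> 1 - cmod w" by blast
  define E g where "E = (\<lambda>m. snd (f m))" and "g = (\<lambda>m. fst (f m))"
  have block: "outer_block \<epsilon> A (g m) (E m)" for m using f(2) by (simp add: E_def g_def)
  have "strict_mono g" using f(3) by (simp add: g_def strict_mono_Suc_iff)
  note union = lacunary_union[of g A E \<epsilon>, OF this A]
  show thesis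
  proof (rule that)
    show "Q m (E m)" for m using f(1) by (simp add: E_def)
    show "finite (E m)" for m using block by (simp add: outer_block_def)
    show "(\<Union>m. E m) \<subseteq> unit_disc" using block by (auto simp: outer_block_def)
    have inner: "2 / 2 ^ g (Suc m) \<le> 1 - cmod w" if "w \<in> E m" for m w
      using f(4) that by (simp add: E_def g_def)
    show "disjoint_family E" "pseudohyp_separated (min \<epsilon> (1/3)) (\<Union>m. E m) (\<lambda>w. w)"
      "dyadic_carleson (3 * A) (\<Union>m. E m)"
      using block inner by (auto simp: outer_block_def intro!: union)
  qed
qed

lemma dyadic_carleson_card:
  assumes "finite E" "E \<subseteq> unit_disc"
  shows "dyadic_carleson (real (card E)) E"
proof (rule dyadic_carleson_finiteI[OF assms])
  fix n k
  have "(\<Sum>w\<in>E \<inter> dyadic_box n k. 1 - cmod w) \<le> (\<Sum>w\<in>E \<inter> dyadic_box n k. 1 / 2 ^ n)"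
    by (intro sum_mono) (auto simp: dyadic_box_def)
  also have "\<dots> = real (card (E \<inter> dyadic_box n k)) * (1 / 2 ^ n)" by simp
  also have "\<dots> \<le> real (card E) * (1 / 2 ^ n)"
    using assms(1) by (intro mult_right_mono) (auto intro: card_mono)
  finally show "(\<Sum>w\<in>E \<inter> dyadic_box n k. 1 - cmod w) \<le> real (card E) / 2 ^ n" by simp
qed

lemma outer_block_few_points:
  assumes "finite E" "E \<subseteq> unit_disc" "pseudohyp_separated \<epsilon> E (\<lambda>w. w)"
    and "\<And>w. w \<in> E \<Longrightarrow> 1 - cmod w \<le> 1 / 2 ^ g"
  shows "outer_block \<epsilon> (real (card E)) g E"
proof -
  have "(\<Sum>w\<in>E. 1 - cmod w) \<le> (\<Sum>w\<in>E. 1 / 2 ^ g)" by (intro sum_mono assms)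
  then show ?thesis using assms dyadic_carleson_card by (simp add: outer_block_def)
qed

section \<open>Maps preserving interpolating sequences\<close>

locale carleson_preserving =
  fixes \<Phi> :: "complex \<Rightarrow> complex"
  assumes continuous: "continuous_on unit_disc \<Phi>"
    and self_map: "\<Phi> ` unit_disc \<subseteq> unit_disc"
    and preserving: "carleson_sequence J \<Lambda> \<Longrightarrow> carleson_sequence J (\<Phi> \<circ> \<Lambda>)"
begin

lemma in_disc: "cmod w < 1 \<Longrightarrow> cmod (\<Phi> w) < 1"
  using self_map by (metis imageI mem_ball_0 subsetD)

text \<open>The hypothesis on sequences, translated to countable sets of points by an enumeration and by
  Carleson's theorem in both directions.\<close>

lemma image_separated_kernel_bounded:
  assumes E: "countable E" "E \<subseteq> unit_disc"
    and sep: "0 < \<epsilon>" "pseudohyp_separated \<epsilon> E (\<lambda>w. w)" and A: "dyadic_carleson A E"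
  obtains \<delta> K where "0 < \<delta>" "pseudohyp_separated \<delta> E \<Phi>" "kernel_bounded K E \<Phi>"
proof -
  define J where "J = to_nat_on E ` E"
  define \<Lambda> where "\<Lambda> = from_nat_into E"
  define \<iota> where "\<iota> = to_nat_on E"
  have \<Lambda>: "\<Lambda> (\<iota> w) = w" if "w \<in> E" for w using that E(1) by (simp add: \<Lambda>_def \<iota>_def)
  have J: "J = \<iota> ` E" by (simp add: J_def \<iota>_def)
  have inj: "inj_on \<Lambda> J" unfolding J by (auto intro!: inj_onI simp: \<Lambda>)
  have inj\<iota>: "inj_on \<iota> E" unfolding \<iota>_def by (rule inj_on_to_nat_on[OF E(1)])
  have K: "kernel_bounded (160 * A) E (\<lambda>w. w)" by (rule dyadic_carleson_imp_kernel_bounded[OF E(2) A])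
  have "carleson_sequence J \<Lambda>"
  proof (rule carleson_sequence_sufficient[OF _ sep(1)])
    show "\<Lambda> ` J \<subseteq> unit_disc" using E(2) by (auto simp: J \<Lambda>)
    show "pseudohyp_separated \<epsilon> J \<Lambda>"
      unfolding pseudohyp_separated_def
    proof (intro ballI impI)
      fix i j assume "i \<in> J" "j \<in> J" "i \<noteq> j"
      then obtain z w where "z \<in> E" "w \<in> E" "i = \<iota> z" "j = \<iota> w" "z \<noteq> w" by (auto simp: J)
      then show "\<epsilon> \<le> pseudohyperbolic (\<Lambda> i) (\<Lambda> j)"
        using pseudohyp_separatedD[OF sep(2)] by (simp add: \<Lambda>)
    qed
    show "kernel_bounded (160 * A) J \<Lambda>"
    proof (rule kernel_boundedI)
      fix z F assume z: "cmod z < 1" and F: "finite F" "F \<subseteq> J"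
      have "(\<Sum>j\<in>F. hyp_kernel z (\<Lambda> j)) = (\<Sum>w\<in>\<Lambda> ` F. hyp_kernel z w)"
        using inj_on_subset[OF inj F(2)] by (subst sum.reindex) auto
      also have "\<dots> \<le> 160 * A"
        using F by (intro kernel_boundedD[OF K z]) (auto simp: J \<Lambda>)
      finally show "(\<Sum>j\<in>F. hyp_kernel z (\<Lambda> j)) \<le> 160 * A" .
    qed
  qed
  then have "carleson_sequence J (\<Phi> \<circ> \<Lambda>)" by (rule preserving)
  then obtain \<delta> K' where \<delta>: "0 < \<delta>" "pseudohyp_separated \<delta> J (\<Phi> \<circ> \<Lambda>)" "kernel_bounded K' J (\<Phi> \<circ> \<Lambda>)"
    by (rule carleson_sequence_necessary)
  show thesis
  proof (rule that[OF \<delta>(1)])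
    show "pseudohyp_separated \<delta> E \<Phi>"
      unfolding pseudohyp_separated_def
    proof (intro ballI impI)
      fix z w assume zw: "z \<in> E" "w \<in> E" "z \<noteq> w"
      then have "\<iota> z \<noteq> \<iota> w" using inj\<iota> by (auto dest: inj_onD)
      then show "\<delta> \<le> pseudohyperbolic (\<Phi> z) (\<Phi> w)"
        using pseudohyp_separatedD[OF \<delta>(2), of "\<iota> z" "\<iota> w"] zw by (simp add: J \<Lambda>)
    qed
    show "kernel_bounded K' E \<Phi>"
    proof (rule kernel_boundedI)
      fix z F assume z: "cmod z < 1" and F: "finite F" "F \<subseteq> E"
      have "(\<Sum>w\<in>F. hyp_kernel z (\<Phi> w)) = (\<Sum>w\<in>F. hyp_kernel z ((\<Phi> \<circ> \<Lambda>) (\<iota> w)))"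
        using F(2) by (intro sum.cong refl) (auto simp: \<Lambda> subset_iff)
      also have "\<dots> = (\<Sum>j\<in>\<iota> ` F. hyp_kernel z ((\<Phi> \<circ> \<Lambda>) j))"
        using inj_on_subset[OF inj\<iota> F(2)] by (subst sum.reindex) auto
      also have "\<dots> \<le> K'" using F by (intro kernel_boundedD[OF \<delta>(3) z]) (auto simp: J)
      finally show "(\<Sum>w\<in>F. hyp_kernel z (\<Phi> w)) \<le> K'" .
    qed
  qed
qed

text \<open>Otherwise some lacunary, hence interpolating, sequence would have infinitely many images in one
  disc of radius \<open>R < 1\<close>, each contributing at least \<open>1 - R\<^sup>2\<close> to
  the kernel sum at the origin.\<close>

lemma proper:
  assumes "R < 1"
  shows "\<exists>g. \<forall>z. cmod z < 1 \<longrightarrow> cmod (\<Phi> z) \<le> R \<longrightarrow> cmod z \<le> 1 - 1 / 2 ^ g"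
proof (rule ccontr)
  assume "\<not> ?thesis"
  then have not: "\<exists>z. cmod z < 1 \<and> cmod (\<Phi> z) \<le> R \<and> \<not> cmod z \<le> 1 - 1 / 2 ^ g" for g
    by blast
  have neg: "\<exists>z. cmod z < 1 \<and> cmod (\<Phi> z) \<le> R \<and> 1 - cmod z < 1 / 2 ^ g" for g :: nat
  proof -
    obtain z where "cmod z < 1" "cmod (\<Phi> z) \<le> R" "\<not> cmod z \<le> 1 - 1 / 2 ^ g" using not by blast
    then show ?thesis by (intro exI[of _ z]) linarith
  qed
  define Q where "Q = (\<lambda>(m::nat) E. \<exists>z. E = {z} \<and> cmod (\<Phi> z) \<le> R)"
  have "\<exists>E. Q m E \<and> outer_block 1 1 g E" for m g
  proof -
    obtain z where z: "cmod z < 1" "cmod (\<Phi> z) \<le> R" "1 - cmod z < 1 / 2 ^ g" using neg by blast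
    then have "outer_block 1 (real (card {z})) g {z}"
      by (intro outer_block_few_points) (auto simp: pseudohyp_separated_def)
    then show ?thesis using z(2) by (intro exI[of _ "{z}"]) (auto simp: Q_def)
  qed
  then obtain E where E: "\<And>m. Q m (E m)" "\<And>m. finite (E m)" "(\<Union>m. E m) \<subseteq> unit_disc"
    "disjoint_family E" "pseudohyp_separated (min 1 (1/3)) (\<Union>m. E m) (\<lambda>w. w)"
    "dyadic_carleson (3 * 1) (\<Union>m. E m)"
    by (rule lacunary_selection[of Q 1 1]) (simp, rule that)
  have "countable (\<Union>m. E m)" using E(2) by (auto intro: countable_finite)
  then obtain \<delta> K where K: "kernel_bounded K (\<Union>m. E m) \<Phi>"
    using image_separated_kernel_bounded[OF _ E(3) _ E(5,6)] by auto
  have R: "0 < 1 - R\<^sup>2" "0 \<le> R"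
  proof -
    obtain z where "cmod (\<Phi> z) \<le> R" using neg[of 0] by blast
    then show "0 \<le> R" using norm_ge_zero[of "\<Phi> z"] by linarith
    then show "0 < 1 - R\<^sup>2" using assms by (simp add: abs_square_less_1)
  qed
  have "real M * (1 - R\<^sup>2) \<le> K" for M
  proof -
    have "real M * (1 - R\<^sup>2) = (\<Sum>m<M. 1 - R\<^sup>2)" by simp
    also have "\<dots> \<le> (\<Sum>m<M. \<Sum>w\<in>E m. hyp_kernel 0 (\<Phi> w))"
    proof (rule sum_mono)
      fix m
      obtain z where z: "E m = {z}" "cmod (\<Phi> z) \<le> R" using E(1)[of m] by (auto simp: Q_def)
      have "(cmod (\<Phi> z))\<^sup>2 \<le> R\<^sup>2" using z(2) by (intro power_mono) auto
      then show "1 - R\<^sup>2 \<le> (\<Sum>w\<in>E m. hyp_kernel 0 (\<Phi> w))"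
        unfolding z(1) by (simp add: pseudohyperbolic_def)
    qed
    also have "\<dots> = (\<Sum>w\<in>(\<Union>m<M. E m). hyp_kernel 0 (\<Phi> w))"
      using E(2,4) by (intro sum.UNION_disjoint[symmetric]) (auto simp: disjoint_family_on_def)
    also have "\<dots> \<le> K" using E(2) by (intro kernel_boundedD[OF K]) auto
    finally show ?thesis .
  qed
  moreover obtain M :: nat where "K < real M * (1 - R\<^sup>2)" using R(1) by (metis reals_Archimedean3)
  ultimately show False by (meson not_le)
qed

lemma injective: "inj_on \<Phi> unit_disc"
proof (rule inj_onI, rule ccontr)
  fix z w assume zw: "z \<in> unit_disc" "w \<in> unit_disc" "\<Phi> z = \<Phi> w" "z \<noteq> w"
  let ?\<epsilon> = "pseudohyperbolic z w"
  have pos: "0 < ?\<epsilon>" using zw pseudohyperbolic_eq_0_iff[of z w] pseudohyperbolic_nonneg[of z w] by (simp add: less_le)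
  have sep: "pseudohyp_separated ?\<epsilon> {z, w} (\<lambda>w. w)"
    by (auto simp: pseudohyp_separated_def pseudohyperbolic_commute)
  have "dyadic_carleson (real (card {z, w})) {z, w}" using zw by (intro dyadic_carleson_card) auto
  then obtain \<delta> K where "0 < \<delta>" "pseudohyp_separated \<delta> {z, w} \<Phi>" "kernel_bounded K {z, w} \<Phi>"
    using zw image_separated_kernel_bounded[OF _ _ pos sep] by auto
  then show False using zw pseudohyp_separatedD[of \<delta> "{z, w}" \<Phi> z w] by simp
qed

text \<open>The image is open by invariance of domain and relatively closed by properness.\<close>

lemma surjective: "\<Phi> ` unit_disc = unit_disc"
proof -
  have "open (\<Phi> ` unit_disc)" by (rule invariance_of_domain[OF continuous open_ball injective])
  then have op: "openin (top_of_set unit_disc) (\<Phi> ` unit_disc)"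
    using self_map by (simp add: openin_open_eq)
  have "y \<in> \<Phi> ` unit_disc" if y: "y \<in> unit_disc" "y \<in> closure (\<Phi> ` unit_disc)" for y
  proof -
    define R where "R = (1 + cmod y) / 2"
    have R: "R < 1" using y(1) by (simp add: R_def)
    obtain g where g: "\<And>z. cmod z < 1 \<Longrightarrow> cmod (\<Phi> z) \<le> R \<Longrightarrow> cmod z \<le> 1 - 1 / 2 ^ g"
      using proper[OF R] by blast
    define C where "C = cball (0::complex) (1 - 1 / 2 ^ g)"
    have C: "C \<subseteq> unit_disc"
    proof
      fix x assume "x \<in> C"
      then have "cmod x \<le> 1 - 1 / 2 ^ g" by (simp add: C_def)
      moreover have "(0::real) < 1 / 2 ^ g" by simp
      ultimately have "cmod x < 1" by linarith
      then show "x \<in> unit_disc" by simp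
    qed
    have "compact (\<Phi> ` C)"
      by (intro compact_continuous_image continuous_on_subset[OF continuous C]) (simp add: C_def)
    then have clC: "closed (\<Phi> ` C)" by (rule compact_imp_closed)
    have "y \<in> closure (\<Phi> ` C)"
      unfolding closure_approachable
    proof (intro allI impI)
      fix e :: real assume e: "0 < e"
      have "0 < min e ((1 - cmod y) / 2)" using e y(1) by simp
      then obtain x where x: "x \<in> unit_disc" "dist (\<Phi> x) y < min e ((1 - cmod y) / 2)"
        using y(2) unfolding closure_approachable by blast
      have "cmod (\<Phi> x) \<le> cmod (\<Phi> x - y) + cmod y" using norm_triangle_ineq[of "\<Phi> x - y" y] by simp
      also have "\<dots> \<le> R" using x(2) by (simp add: R_def dist_norm field_simps)
      finally have "x \<in> C" using g x(1) by (simp add: C_def)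
      then show "\<exists>y'\<in>\<Phi> ` C. dist y' y < e" using x(2) by auto
    qed
    then have "y \<in> \<Phi> ` C" using clC by (simp add: closure_closed)
    then show ?thesis using C by blast
  qed
  then have "unit_disc \<inter> closure (\<Phi> ` unit_disc) \<subseteq> \<Phi> ` unit_disc" by (intro subsetI) simp
  then have "\<Phi> ` unit_disc = unit_disc \<inter> closure (\<Phi> ` unit_disc)"
    using Int_greatest[OF self_map closure_subset] by (rule equalityI[rotated])
  then have "closedin (top_of_set unit_disc) (\<Phi> ` unit_disc)"
    by (metis closed_closure closedin_closed_Int)
  then show ?thesis
    using connected_clopen[of unit_disc] op by auto
qed

lemma homeomorphism_inverse: "\<exists>\<Psi>. homeomorphism unit_disc unit_disc \<Phi> \<Psi>"
proof -
  obtain \<Psi> where "homeomorphism unit_disc (\<Phi> ` unit_disc) \<Phi> \<Psi>"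
    using invariance_of_domain_homeomorphism[OF open_ball continuous _ injective] by auto
  then show ?thesis unfolding surjective by blast
qed

text \<open>Pairs that violate uniform continuity of the inverse must approach the circle, because on compact
  sets the inverse is uniformly continuous.\<close>

lemma bad_pair_near_circle:
  assumes \<Psi>: "homeomorphism unit_disc unit_disc \<Phi> \<Psi>" and \<epsilon>: "0 < \<epsilon>"
    and not: "\<And>\<delta>. 0 < \<delta> \<Longrightarrow> \<exists>a\<in>unit_disc. \<exists>b\<in>unit_disc. pseudohyperbolic a b < \<delta> \<and> \<epsilon> \<le> pseudohyperbolic (\<Psi> a) (\<Psi> b)"
    and \<delta>: "0 < \<delta>"
  shows "\<exists>z w. cmod z < 1 \<and> cmod w < 1 \<and> 1 - cmod z \<le> 1 / 2 ^ g \<and> 1 - cmod w \<le> 1 / 2 ^ g \<and>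
    \<epsilon> \<le> pseudohyperbolic z w \<and> pseudohyperbolic (\<Phi> z) (\<Phi> w) < \<delta>"
proof -
  have compact_bound: "\<exists>s<1. \<forall>x\<in>X. cmod x \<le> s" if X: "compact X" "X \<subseteq> unit_disc" for X
  proof (cases "X = {}")
    case False
    then obtain x where "x \<in> X" "\<forall>y\<in>X. cmod y \<le> cmod x"
      using continuous_attains_sup[OF X(1) False, of cmod] continuous_on_norm_id by blast
    then show ?thesis using X(2) by (intro exI[of _ "cmod x"]) auto
  qed (auto intro: exI[of _ 0])
  have inv: "\<Phi> (\<Psi> a) = a" "\<Psi> a \<in> unit_disc" if "a \<in> unit_disc" for a
    using \<Psi> that by (auto simp: homeomorphism_def)
  define C where "C = cball (0::complex) (1 - 1 / 2 ^ g)"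
  have C: "C \<subseteq> unit_disc"
  proof
    fix x assume "x \<in> C"
    then have "cmod x \<le> 1 - 1 / 2 ^ g" by (simp add: C_def)
    moreover have "(0::real) < 1 / 2 ^ g" by simp
    ultimately have "cmod x < 1" by linarith
    then show "x \<in> unit_disc" by simp
  qed
  have "compact (\<Phi> ` C)"
    by (intro compact_continuous_image continuous_on_subset[OF continuous C]) (simp add: C_def)
  moreover have "\<Phi> ` C \<subseteq> unit_disc" using C self_map by blast
  ultimately have "\<exists>R<1. \<forall>x\<in>\<Phi> ` C. cmod x \<le> R" by (rule compact_bound)
  then obtain R where R: "R < 1" "\<And>x. x \<in> C \<Longrightarrow> cmod (\<Phi> x) \<le> R" by auto
  define C' where "C' = cball (0::complex) ((1 + R) / 2)"
  have C': "compact C'" "C' \<subseteq> unit_disc" using R(1) by (auto simp: C'_def)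
  have cont\<Psi>: "continuous_on C' \<Psi>"
    using \<Psi> C'(2) by (auto simp: homeomorphism_def intro: continuous_on_subset)
  have "compact (\<Psi> ` C')" by (rule compact_continuous_image[OF cont\<Psi> C'(1)])
  moreover have "\<Psi> ` C' \<subseteq> unit_disc" using C'(2) inv by blast
  ultimately have "\<exists>s<1. \<forall>x\<in>\<Psi> ` C'. cmod x \<le> s" by (rule compact_bound)
  then obtain s where s: "s < 1" "\<And>a. a \<in> C' \<Longrightarrow> cmod (\<Psi> a) \<le> s" by auto
  have "uniformly_continuous_on C' \<Psi>" by (rule compact_uniformly_continuous[OF cont\<Psi> C'(1)])
  moreover have "0 < \<epsilon> * (1 - s)" using \<epsilon> s by simp
  ultimately obtain d where d: "0 < d"
    "\<And>a b. a \<in> C' \<Longrightarrow> b \<in> C' \<Longrightarrow> dist b a < d \<Longrightarrow> dist (\<Psi> b) (\<Psi> a) < \<epsilon> * (1 - s)"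
    unfolding uniformly_continuous_on_def by meson
  \<comment> \<open>Euclidean distance is at most twice pseudohyperbolic distance; if
    \<open>\<Psi> a\<close> were in \<open>C\<close>, then \<open>a\<close> and \<open>b\<close>
    would both be in \<open>C'\<close> and their inverse images too close together.\<close>
  define \<eta> where "\<eta> = min \<delta> (min (d / 2) ((1 - R) / 4))"
  have "0 < \<eta>" using \<delta> d R by (simp add: \<eta>_def)
  then obtain a b where ab: "a \<in> unit_disc" "b \<in> unit_disc" "pseudohyperbolic a b < \<eta>"
    "\<epsilon> \<le> pseudohyperbolic (\<Psi> a) (\<Psi> b)" using not by blast
  have outside: "\<Psi> a \<notin> C" if ab: "a \<in> unit_disc" "b \<in> unit_disc" "pseudohyperbolic a b < \<eta>"
    "\<epsilon> \<le> pseudohyperbolic (\<Psi> a) (\<Psi> b)" for a b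
  proof
    assume "\<Psi> a \<in> C"
    then have a: "cmod a \<le> R" using R(2)[of "\<Psi> a"] inv ab(1) by simp
    have diff: "cmod (a - b) < 2 * \<eta>"
      using cmod_diff_le_pseudohyperbolic[of a b] ab by auto
    have "cmod b \<le> cmod a + cmod (a - b)" using norm_triangle_ineq2[of b a] by (simp add: norm_minus_commute)
    moreover have "\<eta> \<le> (1 - R) / 4" unfolding \<eta>_def by linarith
    then have "4 * \<eta> \<le> 1 - R" by simp
    ultimately have "2 * cmod b \<le> 1 + R" using a diff by linarith
    then have "cmod b \<le> (1 + R) / 2" by simp
    moreover have "cmod a \<le> (1 + R) / 2" using a R(1) by simp
    ultimately have C'ab: "a \<in> C'" "b \<in> C'" by (auto simp: C'_def)
    have "dist b a < d" using diff by (simp add: \<eta>_def dist_norm norm_minus_commute)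
    then have lt: "cmod (\<Psi> a - \<Psi> b) < \<epsilon> * (1 - s)" using d(2)[OF C'ab] by (simp add: dist_norm norm_minus_commute)
    have "cmod (\<Psi> b) < 1" using inv(2)[OF ab(2)] by simp
    then have ge: "1 - s \<le> cmod (1 - cnj (\<Psi> a) * \<Psi> b)"
      using one_minus_cmod_mult_le[of "\<Psi> b" "\<Psi> a"] s(2)[OF C'ab(1)] by linarith
    have "pseudohyperbolic (\<Psi> a) (\<Psi> b) \<le> cmod (\<Psi> a - \<Psi> b) / (1 - s)"
      unfolding pseudohyperbolic_def norm_divide using ge s(1) by (intro divide_left_mono mult_pos_pos) auto
    also have "\<dots> < \<epsilon>" using lt s(1) by (simp add: pos_divide_less_eq)
    finally show False using ab(4) by simp
  qed
  have "\<Psi> a \<notin> C" by (rule outside[OF ab])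
  moreover have "\<Psi> b \<notin> C"
    using ab by (intro outside[of b a]) (auto simp: pseudohyperbolic_commute)
  moreover have "pseudohyperbolic a b < \<delta>" using ab(3) by (simp add: \<eta>_def)
  ultimately show ?thesis
    using inv[OF ab(1)] inv[OF ab(2)] ab(4)
    by (intro exI[of _ "\<Psi> a"] exI[of _ "\<Psi> b"]) (auto simp: C_def)
qed

text \<open>A lacunary union of bad pairs is an interpolating set whose image is not separated.\<close>

lemma inverse_uniformly_continuous:
  assumes \<Psi>: "homeomorphism unit_disc unit_disc \<Phi> \<Psi>"
  shows "pseudohyp_uniformly_continuous \<Psi>"
proof (rule ccontr)
  assume "\<not> ?thesis"
  then obtain \<epsilon> where \<epsilon>: "0 < \<epsilon>" and not: "\<And>\<delta>. 0 < \<delta> \<Longrightarrow> \<exists>a\<in>unit_disc. \<exists>b\<in>unit_disc.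
      pseudohyperbolic a b < \<delta> \<and> \<epsilon> \<le> pseudohyperbolic (\<Psi> a) (\<Psi> b)"
    unfolding pseudohyp_uniformly_continuous_def by (metis not_le)
  define Q where "Q = (\<lambda>(m::nat) E. \<exists>z w. E = {z, w} \<and> z \<noteq> w \<and> pseudohyperbolic (\<Phi> z) (\<Phi> w) < 1 / (real m + 1))"
  have "\<exists>E. Q m E \<and> outer_block \<epsilon> 2 g E" for m g
  proof -
    have "0 < 1 / (real m + 1)" by simp
    then obtain z w where zw: "cmod z < 1" "cmod w < 1" "1 - cmod z \<le> 1 / 2 ^ g" "1 - cmod w \<le> 1 / 2 ^ g"
      "\<epsilon> \<le> pseudohyperbolic z w" "pseudohyperbolic (\<Phi> z) (\<Phi> w) < 1 / (real m + 1)"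
      using bad_pair_near_circle[OF \<Psi> \<epsilon> not] by meson
    have ne: "z \<noteq> w" using zw(5) \<epsilon> by auto
    have "outer_block \<epsilon> (real (card {z, w})) g {z, w}"
      using zw by (intro outer_block_few_points) (auto simp: pseudohyp_separated_def pseudohyperbolic_commute)
    then show ?thesis using zw ne by (intro exI[of _ "{z, w}"]) (auto simp: Q_def)
  qed
  then obtain E where E: "\<And>m. Q m (E m)" "\<And>m. finite (E m)" "(\<Union>m. E m) \<subseteq> unit_disc"
    "disjoint_family E" "pseudohyp_separated (min \<epsilon> (1/3)) (\<Union>m. E m) (\<lambda>w. w)"
    "dyadic_carleson (3 * 2) (\<Union>m. E m)"
    by (rule lacunary_selection[of Q \<epsilon> 2]) (simp, rule that)
  have "countable (\<Union>m. E m)" using E(2) by (auto intro: countable_finite)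
  then obtain \<delta> K where \<delta>: "0 < \<delta>" "pseudohyp_separated \<delta> (\<Union>m. E m) \<Phi>"
    using image_separated_kernel_bounded[OF _ E(3) _ E(5,6)] \<epsilon> by auto
  obtain m :: nat where m: "1 / \<delta> < real m" using reals_Archimedean2 by blast
  obtain z w where zw: "E m = {z, w}" "z \<noteq> w" "pseudohyperbolic (\<Phi> z) (\<Phi> w) < 1 / (real m + 1)"
    using E(1)[of m] by (auto simp: Q_def)
  have "\<delta> \<le> pseudohyperbolic (\<Phi> z) (\<Phi> w)"
    using zw by (intro pseudohyp_separatedD[OF \<delta>(2)]) blast+
  then have "\<delta> < 1 / (real m + 1)" using zw(3) by linarith
  then have "\<delta> * real m + \<delta> < 1" by (simp add: field_simps)
  moreover have "1 < \<delta> * real m" using m \<delta>(1) by (simp add: field_simps)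
  ultimately show False using \<delta>(1) by linarith
qed

text \<open>A gliding hump that makes the loss of constants uniform. From a bad set \<open>E\<close> drop the
  points with \<open>1 - \<bar>w\<bar> > 2 ^ - g\<close>; there are at most
  \<open>3 * 2 ^ g\<close> of them, each contributing at most 1. The remaining points lie in the
  \<open>2 ^ g\<close> boxes of level \<open>g\<close>, and one of these boxes carries a
  proportional share of the sum. As \<open>E\<close> may be chosen as bad as desired after
  \<open>g\<close> is known, this share is still large, while the points in one box have small
  total mass and form an outer block.\<close>

lemma uniform_kernel_bound:
  "\<exists>K. \<forall>E \<zeta>. finite E \<longrightarrow> E \<subseteq> unit_disc \<longrightarrow> pseudohyp_separated (1/3) E (\<lambda>w. w) \<longrightarrow>
     dyadic_carleson 3 E \<longrightarrow> cmod \<zeta> < 1 \<longrightarrow> (\<Sum>w\<in>E. hyp_kernel \<zeta> (\<Phi> w)) \<le> K"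
proof (rule ccontr)
  assume "\<not> ?thesis"
  then have neg: "\<exists>E \<zeta>. finite E \<and> E \<subseteq> unit_disc \<and> pseudohyp_separated (1/3) E (\<lambda>w. w) \<and>
     dyadic_carleson 3 E \<and> cmod \<zeta> < 1 \<and> K < (\<Sum>w\<in>E. hyp_kernel \<zeta> (\<Phi> w))" for K
    by (metis not_le)
  define Q where "Q = (\<lambda>(m::nat) E. \<exists>\<zeta>. cmod \<zeta> < 1 \<and> real m < (\<Sum>w\<in>E. hyp_kernel \<zeta> (\<Phi> w)))"
  have "\<exists>E. Q m E \<and> outer_block (1/3) 3 g E" for m g
  proof -
    obtain E \<zeta> where E: "finite E" "E \<subseteq> unit_disc" "pseudohyp_separated (1/3) E (\<lambda>w. w)"
      "dyadic_carleson 3 E" and \<zeta>: "cmod \<zeta> < 1"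
      and large: "3 * 2 ^ g + 2 ^ g * real m < (\<Sum>w\<in>E. hyp_kernel \<zeta> (\<Phi> w))"
      using neg by blast
    \<comment> \<open>The points too far from the circle, which are few.\<close>
    define E0 where "E0 = {w \<in> E. 1 / 2 ^ g < 1 - cmod w}"
    have E0: "finite E0" "E0 \<subseteq> E" using E(1) by (auto simp: E0_def)
    have "real (card E0) * (1 / 2 ^ g) \<le> (\<Sum>w\<in>E0. 1 - cmod w)"
      using sum_bounded_below[of E0 "1 / 2 ^ g" "\<lambda>w. 1 - cmod w"] by (auto simp: E0_def)
    also have "\<dots> = (\<Sum>w\<in>E0 \<inter> dyadic_box 0 0. 1 - cmod w)"
      using E0(2) E(2) by (intro sum.cong) (auto simp: dyadic_box_0)
    also have "\<dots> \<le> 3 / 2 ^ 0" by (rule dyadic_carlesonD[OF E(4) E0])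
    finally have cardE0: "real (card E0) \<le> 3 * 2 ^ g" by (simp add: field_simps)
    have "E = E0 \<union> (\<Union>k<2 ^ g. E \<inter> dyadic_box g k)"
      using E(2) dyadic_pos_less by (fastforce simp: E0_def dyadic_box_def)
    then have "(\<Sum>w\<in>E. hyp_kernel \<zeta> (\<Phi> w))
        = (\<Sum>w\<in>E0 \<union> (\<Union>k<2 ^ g. E \<inter> dyadic_box g k). hyp_kernel \<zeta> (\<Phi> w))" by simp
    also have "\<dots> = (\<Sum>w\<in>E0. hyp_kernel \<zeta> (\<Phi> w)) + (\<Sum>w\<in>(\<Union>k<2 ^ g. E \<inter> dyadic_box g k). hyp_kernel \<zeta> (\<Phi> w))"
      using E(1) E0(1) by (intro sum.union_disjoint) (auto simp: E0_def dyadic_box_def)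
    also have "(\<Sum>w\<in>(\<Union>k<2 ^ g. E \<inter> dyadic_box g k). hyp_kernel \<zeta> (\<Phi> w))
        = (\<Sum>k<2 ^ g. \<Sum>w\<in>E \<inter> dyadic_box g k. hyp_kernel \<zeta> (\<Phi> w))"
      using E(1) by (intro sum.UNION_disjoint) (auto simp: dyadic_box_def)
    also have "(\<Sum>w\<in>E0. hyp_kernel \<zeta> (\<Phi> w)) \<le> (\<Sum>w\<in>E0. 1)" by (intro sum_mono hyp_kernel_le_1)
    finally have upper: "(\<Sum>w\<in>E. hyp_kernel \<zeta> (\<Phi> w))
        \<le> 3 * 2 ^ g + (\<Sum>k<2 ^ g. \<Sum>w\<in>E \<inter> dyadic_box g k. hyp_kernel \<zeta> (\<Phi> w))"
      using cardE0 by simp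
    have "\<exists>k<2 ^ g. real m < (\<Sum>w\<in>E \<inter> dyadic_box g k. hyp_kernel \<zeta> (\<Phi> w))"
    proof (rule ccontr)
      assume "\<not> ?thesis"
      then have "(\<Sum>k<2 ^ g. \<Sum>w\<in>E \<inter> dyadic_box g k. hyp_kernel \<zeta> (\<Phi> w)) \<le> (\<Sum>k<(2::nat) ^ g. real m)"
        by (intro sum_mono) (metis lessThan_iff not_less)
      then show False using upper large by simp
    qed
    then obtain k where k: "real m < (\<Sum>w\<in>E \<inter> dyadic_box g k. hyp_kernel \<zeta> (\<Phi> w))" by blast
    define B where "B = E \<inter> dyadic_box g k"
    have "Q m B" using k \<zeta> by (auto simp: Q_def B_def)
    moreover have "outer_block (1/3) 3 g B"
      unfolding outer_block_def
    proof (intro conjI ballI)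
      show "finite B" using E(1) by (simp add: B_def)
      show "B \<subseteq> unit_disc" using E(2) by (auto simp: B_def)
      show "pseudohyp_separated (1/3) B (\<lambda>w. w)" using E(3) by (auto simp: B_def pseudohyp_separated_def)
      show "dyadic_carleson 3 B" by (rule dyadic_carleson_subset[OF E(4)]) (simp add: B_def)
      show "(\<Sum>w\<in>B. 1 - cmod w) \<le> 3 / 2 ^ g"
        unfolding B_def by (rule dyadic_carlesonD[OF E(4,1) order_refl])
      show "1 - cmod w \<le> 1 / 2 ^ g" if "w \<in> B" for w using that by (simp add: B_def dyadic_box_def)
    qed
    ultimately show ?thesis by blast
  qed
  then obtain E where E: "\<And>m. Q m (E m)" "\<And>m. finite (E m)" "(\<Union>m. E m) \<subseteq> unit_disc"
    "disjoint_family E" "pseudohyp_separated (min (1/3) (1/3)) (\<Union>m. E m) (\<lambda>w. w)"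
    "dyadic_carleson (3 * 3) (\<Union>m. E m)"
    by (rule lacunary_selection[of Q "1/3" 3]) (simp, rule that)
  have "countable (\<Union>m. E m)" using E(2) by (auto intro: countable_finite)
  then obtain \<delta> K where K: "kernel_bounded K (\<Union>m. E m) \<Phi>"
    using image_separated_kernel_bounded[OF _ E(3) _ E(5,6)] by auto
  obtain m :: nat where m: "K < real m" using reals_Archimedean2 by blast
  obtain \<zeta> where \<zeta>: "cmod \<zeta> < 1" "real m < (\<Sum>w\<in>E m. hyp_kernel \<zeta> (\<Phi> w))"
    using E(1)[of m] by (auto simp: Q_def)
  have "(\<Sum>w\<in>E m. hyp_kernel \<zeta> (\<Phi> w)) \<le> K" using E(2) by (intro kernel_boundedD[OF K \<zeta>(1)]) auto
  then show False using \<zeta>(2) m by linarith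
qed

end

section \<open>Rounding fractional dyadic families\<close>

text \<open>Nodes \<open>(n, k)\<close> stand for dyadic intervals of length \<open>2 ^ - n\<close>, with
  children \<open>(n + 1, 2 k)\<close> and \<open>(n + 1, 2 k + 1)\<close>. The sum of
  \<open>f\<close> times length over the subtree of depth \<open>d\<close> is defined recursively,
  so that the rounding argument becomes a telescoping induction.\<close>

primrec tree_sum :: "(nat \<Rightarrow> nat \<Rightarrow> real) \<Rightarrow> nat \<Rightarrow> nat \<Rightarrow> nat \<Rightarrow> real" where
  "tree_sum f 0 n k = f n k / 2 ^ n"
| "tree_sum f (Suc d) n k = f n k / 2 ^ n + tree_sum f d (Suc n) (2 * k) + tree_sum f d (Suc n) (2 * k + 1)"

definition descendants :: "nat \<Rightarrow> nat \<Rightarrow> nat \<Rightarrow> (nat \<times> nat) set" where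
  "descendants d n k = {(m, l). n \<le> m \<and> m \<le> n + d \<and> l div 2 ^ (m - n) = k}"

lemma descendants_0: "descendants 0 n k = {(n, k)}"
  by (auto simp: descendants_def)

lemma descendants_Suc:
  "descendants (Suc d) n k
    = insert (n, k) (descendants d (Suc n) (2 * k) \<union> descendants d (Suc n) (2 * k + 1))"
proof -
  have child: "l div 2 ^ (m - n) = k \<longleftrightarrow> l div 2 ^ (m - Suc n) = 2 * k \<or> l div 2 ^ (m - Suc n) = 2 * k + 1"
    if "Suc n \<le> m" for m l :: nat
  proof -
    have "m - n = Suc (m - Suc n)" using that by simp
    then have "l div 2 ^ (m - n) = l div (2 ^ (m - Suc n) * 2)" by (simp only: power_Suc2)
    then have "l div 2 ^ (m - n) = (l div 2 ^ (m - Suc n)) div 2" by (simp only: div_mult2_eq)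
    moreover have "q div 2 = k \<longleftrightarrow> q = 2 * k \<or> q = 2 * k + 1" for q by presburger
    ultimately show ?thesis by (simp only:)
  qed
  show ?thesis
  proof (intro set_eqI)
    fix x :: "nat \<times> nat"
    obtain m l where x: "x = (m, l)" by (cases x)
    consider "m = n" | "Suc n \<le> m" | "m < n" by linarith
    then show "x \<in> descendants (Suc d) n k \<longleftrightarrow>
        x \<in> insert (n, k) (descendants d (Suc n) (2 * k) \<union> descendants d (Suc n) (2 * k + 1))"
    proof cases
      case 2
      then show ?thesis using child[OF 2, of l] by (auto simp: x descendants_def)
    qed (auto simp: x descendants_def)
  qed
qed

lemma finite_descendants: "finite (descendants d n k)"
  by (induction d arbitrary: n k) (simp_all add: descendants_0 descendants_Suc)

lemma tree_sum_eq: "tree_sum f d n k = (\<Sum>(m, l)\<in>descendants d n k. f m l / 2 ^ m)"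
proof (induction d arbitrary: n k)
  case 0
  then show ?case by (simp add: descendants_0)
next
  case (Suc d)
  let ?L = "descendants d (Suc n) (2 * k)" and ?R = "descendants d (Suc n) (2 * k + 1)"
  have "(n, k) \<notin> ?L \<union> ?R" by (auto simp: descendants_def)
  moreover have "?L \<inter> ?R = {}" by (auto simp: descendants_def)
  ultimately show ?case
    by (simp add: Suc descendants_Suc finite_descendants sum.union_disjoint)
qed

lemma tree_sum_add: "tree_sum (\<lambda>n k. f n k + g n k) d n k = tree_sum f d n k + tree_sum g d n k"
  by (induction d arbitrary: n k) (simp_all add: add_divide_distrib)

lemma tree_sum_mono:
  "(\<And>n k. f n k \<le> g n k) \<Longrightarrow> tree_sum f d n k \<le> tree_sum g d n k"
  by (induction d arbitrary: n k) (auto intro!: add_mono divide_right_mono)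

lemma tree_sum_const: "tree_sum (\<lambda>n k. x) d n k = (real d + 1) * x / 2 ^ n"
proof (induction d arbitrary: n k)
  case (Suc d)
  show ?case unfolding tree_sum.simps Suc by (simp add: field_simps)
qed simp

primrec ancestor_sum :: "(nat \<Rightarrow> nat \<Rightarrow> nat) \<Rightarrow> nat \<Rightarrow> nat \<Rightarrow> nat" where
  "ancestor_sum p 0 k = 0"
| "ancestor_sum p (Suc n) k = ancestor_sum p n (k div 2) + p n (k div 2)"

text \<open>Think of fractions \<open>p / N\<close> attached to the nodes and accumulated along branches. A
  node is selected when the accumulated sum, shifted by \<open>\<theta> / N\<close>, passes an
  integer there. Along every branch the number of selected nodes then agrees with the accumulated
  fraction up to 1, and a random shift selects the node with probability \<open>p / N\<close> as
  long as \<open>p \<le> N\<close>.\<close>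

definition selection :: "(nat \<Rightarrow> nat \<Rightarrow> nat) \<Rightarrow> nat \<Rightarrow> nat \<Rightarrow> nat \<Rightarrow> nat \<Rightarrow> nat" where
  "selection p N \<theta> n k =
    (ancestor_sum p n k + p n k + \<theta>) div N - (ancestor_sum p n k + \<theta>) div N"

text \<open>Hermite's identity for natural numbers.\<close>

lemma sum_shifted_div:
  assumes "0 < N"
  shows "(\<Sum>\<theta><N. (x + \<theta>) div N) = (x::nat)"
proof (induction x)
  case 0
  then show ?case by simp
next
  case (Suc x)
  have "(\<Sum>\<theta><N. (Suc x + \<theta>) div N) + x div N = (\<Sum>\<theta><Suc N. (x + \<theta>) div N)"
    by (subst sum.lessThan_Suc_shift) simp
  also have "\<dots> = x + (x + N) div N" using Suc by simp
  finally show ?case using assms by simp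
qed

lemma sum_selection:
  assumes "0 < N"
  shows "(\<Sum>\<theta><N. selection p N \<theta> n k) = p n k"
proof -
  let ?H = "ancestor_sum p n k"
  have "(\<Sum>\<theta><N. selection p N \<theta> n k)
      = (\<Sum>\<theta><N. (?H + p n k + \<theta>) div N) - (\<Sum>\<theta><N. (?H + \<theta>) div N)"
    unfolding selection_def by (rule sum_subtractf_nat) (auto intro: div_le_mono)
  then show ?thesis by (simp add: sum_shifted_div[OF assms])
qed

lemma selection_le_1:
  assumes "0 < N" "p n k \<le> N"
  shows "selection p N \<theta> n k \<le> 1"
proof -
  have "(ancestor_sum p n k + p n k + \<theta>) div N \<le> (ancestor_sum p n k + \<theta> + N) div N"
    using assms(2) by (intro div_le_mono) simp
  then show ?thesis using assms(1) by (simp add: selection_def)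
qed

text \<open>The deviation \<open>e\<close> of the selected count from the accumulated fraction depends only on
  the accumulated sum. The value of that sum after a node is its value before each of the two
  children, whose lengths add up to the length of the node. Hence the deviations telescope along
  the tree, and only one of them, at most the length of the root, remains.\<close>

lemma tree_sum_selection_le:
  assumes N: "0 < N"
  shows "tree_sum (\<lambda>n k. real (selection p N \<theta> n k)) d n k
    \<le> tree_sum (\<lambda>n k. real (p n k) / real N) d n k + 1 / 2 ^ n"
proof -
  define e where "e x = real ((x + \<theta>) div N) - real x / real N" for x
  have upper: "e x \<le> real \<theta> / real N" for x
    using of_nat_div_le_of_nat[of "x + \<theta>" N, where 'a = real] by (simp add: e_def add_divide_distrib)
  have lower: "real \<theta> / real N - e x \<le> 1" for x
  proof -
    have "x + \<theta> \<le> ((x + \<theta>) div N + 1) * N"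
      using dividend_less_div_times[OF N, of "x + \<theta>"] by (simp add: algebra_simps)
    then have "real (x + \<theta>) \<le> real (((x + \<theta>) div N + 1) * N)" by (simp only: of_nat_le_iff)
    then have "real (x + \<theta>) / real N \<le> real ((x + \<theta>) div N) + 1"
      using N by (simp add: field_simps)
    then show ?thesis by (simp add: e_def add_divide_distrib)
  qed
  have sel: "real (selection p N \<theta> n k)
      = real (p n k) / real N + e (ancestor_sum p n k + p n k) - e (ancestor_sum p n k)" for n k
  proof -
    have "(ancestor_sum p n k + \<theta>) div N \<le> (ancestor_sum p n k + p n k + \<theta>) div N"
      by (intro div_le_mono) simp
    then show ?thesis by (simp add: selection_def e_def of_nat_diff add_divide_distrib)
  qed
  have "tree_sum (\<lambda>n k. real (selection p N \<theta> n k)) d n k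
      \<le> tree_sum (\<lambda>n k. real (p n k) / real N) d n k
        + (real \<theta> / real N - e (ancestor_sum p n k)) / 2 ^ n" for n k
  proof (induction d arbitrary: n k)
    case 0
    show ?case
      using upper[of "ancestor_sum p n k + p n k"] unfolding tree_sum.simps sel add_divide_distrib[symmetric]
      by (intro divide_right_mono) auto
  next
    case (Suc d)
    let ?h = "ancestor_sum p n k + p n k"
    let ?T = "tree_sum (\<lambda>n k. real (p n k) / real N) d (Suc n)"
    have child: "ancestor_sum p (Suc n) (2 * k) = ?h" "ancestor_sum p (Suc n) (2 * k + 1) = ?h"
      by simp_all
    have "tree_sum (\<lambda>n k. real (selection p N \<theta> n k)) (Suc d) n k
        \<le> real (selection p N \<theta> n k) / 2 ^ n
          + (?T (2 * k) + (real \<theta> / real N - e ?h) / 2 ^ Suc n)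
          + (?T (2 * k + 1) + (real \<theta> / real N - e ?h) / 2 ^ Suc n)"
      using Suc[of "Suc n" "2 * k"] Suc[of "Suc n" "2 * k + 1"] unfolding child tree_sum.simps by linarith
    also have "\<dots> = tree_sum (\<lambda>n k. real (p n k) / real N) (Suc d) n k
        + (real \<theta> / real N - e (ancestor_sum p n k)) / 2 ^ n"
      unfolding sel tree_sum.simps by (simp add: add_divide_distrib diff_divide_distrib)
    finally show ?case .
  qed
  also have "(real \<theta> / real N - e (ancestor_sum p n k)) / 2 ^ n \<le> 1 / 2 ^ n"
    using lower by (intro divide_right_mono) auto
  finally show ?thesis by simp
qed

text \<open>A fractional family with the Carleson property can be replaced by a set of nodes without lowering
  a given linear functional with nonnegative coefficients: averaging over the shifts
  \<open>\<theta>\<close> shows that one of them does at least as well as the fractions. The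
  choice \<open>N = G + 1\<close> makes the error of rounding up to multiples of
  \<open>1 / N\<close>, summed over all \<open>G + 1\<close> levels, at most the length of the
  root.\<close>

lemma carleson_rounding:
  fixes c a :: "nat \<Rightarrow> nat \<Rightarrow> real"
  assumes c: "\<And>n k. 0 \<le> c n k" "\<And>n k d. tree_sum c d n k \<le> 1 / 2 ^ n"
    and a: "\<And>n k. 0 \<le> a n k"
  obtains S where "S \<subseteq> descendants G 0 0"
    "(\<Sum>(n, k)\<in>descendants G 0 0. c n k * a n k) \<le> (\<Sum>(n, k)\<in>S. a n k)"
    "\<And>n k. (\<Sum>(m, l)\<in>{(m, l)\<in>S. n \<le> m \<and> l div 2 ^ (m - n) = k}. 1 / 2 ^ m) \<le> (3 :: real) / 2 ^ n"
proof -
  define N where "N = Suc G"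
  have N: "0 < N" by (simp add: N_def)
  define p where "p n k = nat \<lceil>real N * c n k\<rceil>" for n k
  have c1: "c n k \<le> 1" for n k using c(2)[of 0 n k] by (simp add: divide_le_cancel)
  have p_lower: "real N * c n k \<le> real (p n k)" for n k
    unfolding p_def by (rule real_nat_ceiling_ge)
  have p_upper: "real (p n k) \<le> real N * c n k + 1" for n k
  proof -
    have "0 \<le> real N * c n k" using c(1) by simp
    then show ?thesis unfolding p_def by linarith
  qed
  have pN: "p n k \<le> N" for n k
  proof -
    have "real N * c n k \<le> real N * 1" using c1 by (intro mult_left_mono) auto
    then have "\<lceil>real N * c n k\<rceil> \<le> int N" by (simp add: ceiling_le_iff)
    then show ?thesis unfolding p_def by (simp only: nat_le_iff)
  qed
  define T where "T = descendants G 0 0"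
  have finT: "finite T" by (simp add: T_def finite_descendants)
  define X where "X = (\<Sum>(n, k)\<in>T. c n k * a n k)"
  have "\<exists>\<theta><N. X \<le> (\<Sum>(n, k)\<in>T. real (selection p N \<theta> n k) * a n k)"
  proof (rule ccontr)
    assume "\<not> ?thesis"
    then have "(\<Sum>\<theta><N. \<Sum>(n, k)\<in>T. real (selection p N \<theta> n k) * a n k) < (\<Sum>\<theta><N. X)"
      using N by (intro sum_strict_mono) (auto simp: not_le)
    also have "(\<Sum>\<theta><N. X) = (\<Sum>(n, k)\<in>T. real N * c n k * a n k)"
      by (simp add: X_def sum_distrib_left case_prod_beta mult.assoc)
    also have "\<dots> \<le> (\<Sum>(n, k)\<in>T. real (p n k) * a n k)"
      using p_lower a by (intro sum_mono) (auto intro!: mult_right_mono)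
    also have "\<dots> = (\<Sum>(n, k)\<in>T. \<Sum>\<theta><N. real (selection p N \<theta> n k) * a n k)"
      by (intro sum.cong refl) (auto simp: sum_distrib_right[symmetric] of_nat_sum[symmetric] sum_selection[OF N])
    also have "\<dots> = (\<Sum>\<theta><N. \<Sum>(n, k)\<in>T. real (selection p N \<theta> n k) * a n k)"
      unfolding case_prod_beta by (rule sum.swap)
    finally show False by simp
  qed
  then obtain \<theta> where \<theta>: "X \<le> (\<Sum>(n, k)\<in>T. real (selection p N \<theta> n k) * a n k)" by blast
  define S where "S = {(n, k)\<in>T. selection p N \<theta> n k = 1}"
  have sel01: "selection p N \<theta> n k = Suc 0" if "0 < selection p N \<theta> n k" for n k
    using selection_le_1[of N p n k \<theta>, OF N pN] that by linarith
  show thesis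
  proof (rule that)
    show "S \<subseteq> descendants G 0 0" by (auto simp: S_def T_def)
    have "(\<Sum>(n, k)\<in>T. real (selection p N \<theta> n k) * a n k) = (\<Sum>(n, k)\<in>S. a n k)"
      unfolding S_def
      by (rule sum.mono_neutral_cong_right[OF finT]) (auto intro: sel01)
    then show "(\<Sum>(n, k)\<in>descendants G 0 0. c n k * a n k) \<le> (\<Sum>(n, k)\<in>S. a n k)"
      using \<theta> by (simp add: X_def T_def)
    fix n k
    let ?S = "{(m, l)\<in>S. n \<le> m \<and> l div 2 ^ (m - n) = k}"
    show "(\<Sum>(m, l)\<in>?S. 1 / 2 ^ m) \<le> (3 :: real) / 2 ^ n"
    proof (cases "n \<le> G")
      case False
      then have empty: "?S = {}" by (auto simp: S_def T_def descendants_def)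
      show ?thesis unfolding empty by simp
    next
      case True
      define d where "d = G - n"
      have "(\<Sum>(m, l)\<in>?S. 1 / 2 ^ m) = (\<Sum>(m, l)\<in>?S. real (selection p N \<theta> m l) / 2 ^ m)"
        by (intro sum.cong) (auto simp: S_def)
      also have "\<dots> \<le> (\<Sum>(m, l)\<in>descendants d n k. real (selection p N \<theta> m l) / 2 ^ m)"
        using True by (intro sum_mono2 finite_descendants)
          (auto simp: S_def T_def descendants_def d_def)
      also have "\<dots> = tree_sum (\<lambda>n k. real (selection p N \<theta> n k)) d n k"
        by (simp add: tree_sum_eq)
      also have "\<dots> \<le> tree_sum (\<lambda>n k. real (p n k) / real N) d n k + 1 / 2 ^ n"
        by (rule tree_sum_selection_le[OF N])
      also have "tree_sum (\<lambda>n k. real (p n k) / real N) d n k \<le> tree_sum (\<lambda>n k. c n k + 1 / real N) d n k"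
        using p_upper N by (intro tree_sum_mono) (simp add: field_simps)
      also have "\<dots> \<le> 1 / 2 ^ n + 1 / 2 ^ n"
      proof -
        have "(real d + 1) * (1 / real N) \<le> 1" by (simp add: d_def N_def field_simps)
        then have "tree_sum (\<lambda>n k. 1 / real N) d n k \<le> 1 / 2 ^ n"
          unfolding tree_sum_const by (rule divide_right_mono) simp
        then show ?thesis unfolding tree_sum_add using c(2)[of d n k] by linarith
      qed
      finally show ?thesis by simp
    qed
  qed
qed

section \<open>Bounding the pushforward\<close>

text \<open>The half of a dyadic box that is away from the circle. These halves partition the disc, and those
  in the subtree of a node partition its dyadic box.\<close>

definition whitney_box :: "nat \<Rightarrow> nat \<Rightarrow> complex set" where
  "whitney_box n k = {w \<in> dyadic_box n k. 1 / 2 ^ Suc n < 1 - cmod w}"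

lemma whitney_box_sets: "whitney_box n k \<in> sets disc_borel"
proof -
  have "{w \<in> space borel. cmod w < 1 \<and> 1 / 2 ^ Suc n < 1 - cmod w} \<in> sets (borel :: complex measure)"
    by measurable
  then have "{w. cmod w < 1 \<and> 1 / 2 ^ Suc n < 1 - cmod w} \<in> sets disc_borel"
    unfolding disc_borel_sets_iff by auto
  moreover have "whitney_box n k = dyadic_box n k \<inter> {w. cmod w < 1 \<and> 1 / 2 ^ Suc n < 1 - cmod w}"
    by (auto simp: whitney_box_def dyadic_box_def)
  ultimately show ?thesis using dyadic_box_sets sets.Int by metis
qed

lemma whitney_boxD:
  assumes "w \<in> whitney_box n k"
  shows "cmod w < 1" "1 / 2 ^ Suc n < 1 - cmod w" "1 - cmod w \<le> 1 / 2 ^ n" "dyadic_pos n w = k"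
  using assms by (auto simp: whitney_box_def dyadic_box_def)

lemma whitney_level_le:
  assumes "w \<in> whitney_box m l" "1 - cmod w \<le> 1 / 2 ^ n"
  shows "n \<le> m"
proof (rule ccontr)
  assume "\<not> n \<le> m"
  then have "(1::real) / 2 ^ n \<le> 1 / 2 ^ Suc m" by (intro divide_left_mono power_increasing) auto
  then show False using whitney_boxD(2)[OF assms(1)] assms(2) by linarith
qed

lemma whitney_box_unique:
  assumes "w \<in> whitney_box m l" "w \<in> whitney_box n k"
  shows "m = n \<and> l = k"
proof -
  have "m = n"
    using whitney_level_le[OF assms(1) whitney_boxD(3)[OF assms(2)]]
      whitney_level_le[OF assms(2) whitney_boxD(3)[OF assms(1)]] by simp
  then show ?thesis using whitney_boxD(4)[OF assms(1)] whitney_boxD(4)[OF assms(2)] by simp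
qed

lemma whitney_box_exists:
  assumes "cmod w < 1"
  obtains n where "w \<in> whitney_box n (dyadic_pos n w)"
  using exists_dyadic_scale[of "1 - cmod w"] assms by (auto simp: whitney_box_def dyadic_box_def)

lemma whitney_box_in_dyadic_box:
  assumes "w \<in> whitney_box m l"
  shows "w \<in> dyadic_box n k \<longleftrightarrow> n \<le> m \<and> l div 2 ^ (m - n) = k"
proof
  assume w: "w \<in> dyadic_box n k"
  then have "n \<le> m" using whitney_level_le[OF assms] by (simp add: dyadic_box_def)
  then show "n \<le> m \<and> l div 2 ^ (m - n) = k"
    using dyadic_pos_div[of n m w] whitney_boxD(4)[OF assms] w by (auto simp: dyadic_box_def)
next
  assume nm: "n \<le> m \<and> l div 2 ^ (m - n) = k"
  then have "(1::real) / 2 ^ m \<le> 1 / 2 ^ n" by (intro divide_left_mono power_increasing) auto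
  then show "w \<in> dyadic_box n k"
    using dyadic_pos_div[of n m w] whitney_boxD[OF assms] nm by (auto simp: dyadic_box_def)
qed

text \<open>Splitting the boxes by the parities of \<open>n\<close> and \<open>k\<close> removes adjacent
  boxes from each class, in the radial as well as in the angular direction. As
  \<open>2 ^ n\<close> is even for \<open>0 < n\<close>, this is also true across the point 1.\<close>

lemma whitney_points_separated:
  assumes v: "v \<in> whitney_box n k" "v' \<in> whitney_box n' k'"
    and same: "n mod 2 = n' mod 2" "k mod 2 = k' mod 2" and ne: "(n, k) \<noteq> (n', k')"
  shows "1/3 \<le> pseudohyperbolic v v'"
proof -
  have radial: "1/3 \<le> pseudohyperbolic v v'"
    if v: "v \<in> whitney_box n k" "v' \<in> whitney_box n' k'" and lt: "n < n'" "n mod 2 = n' mod 2" for v v' n k n' k'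
  proof (rule pseudohyperbolic_ge_radial)
    have "Suc (Suc n) \<le> n'" using lt by presburger
    then have "(1::real) / 2 ^ n' \<le> 1 / 2 ^ Suc (Suc n)" by (intro divide_left_mono power_increasing) auto
    then show "1 - cmod v' \<le> (1 - cmod v) / 2"
      using whitney_boxD(2)[OF v(1)] whitney_boxD(3)[OF v(2)] by simp
  qed (use whitney_boxD(1) v in auto)
  have angular: "1/3 \<le> pseudohyperbolic v v'"
    if v: "v \<in> whitney_box n k" "v' \<in> whitney_box n k'" and lt: "k < k'" "k mod 2 = k' mod 2" for v v' k k'
  proof -
    have k': "k' < 2 ^ n" using dyadic_pos_less[of n v'] whitney_boxD(4)[OF v(2)] by simp
    have n: "n \<noteq> 0" using k' lt(1) by (cases n) auto
    then have "even ((2::nat) ^ n)" by simp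
    then have "k + 2 \<le> k'" "k' + 2 \<le> 2 ^ n + k" using lt k' by presburger+
    then have kk: "real k + 2 \<le> real k'" "real k' + 2 \<le> 2 ^ n + real k"
      by (simp_all only: of_nat_le_iff[symmetric, where 'a = real]) simp_all
    have b: "real k \<le> 2 ^ n * turn v" "2 ^ n * turn v < real k + 1"
      "real k' \<le> 2 ^ n * turn v'" "2 ^ n * turn v' < real k' + 1"
      using dyadic_pos_bounds[of n v] dyadic_pos_bounds[of n v'] whitney_boxD(4) v by auto
    have "2 ^ n * (1 / 2 ^ n) \<le> 2 ^ n * (turn v' - turn v)"
      using b kk by (simp add: right_diff_distrib)
    then have low: "1 / 2 ^ n \<le> turn v' - turn v" by (subst (asm) mult_le_cancel_left_pos) auto
    have "2 ^ n * (turn v' - turn v) \<le> 2 ^ n * (1 - 1 / 2 ^ n)"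
      using b kk by (simp add: right_diff_distrib)
    then have high: "turn v' - turn v \<le> 1 - 1 / 2 ^ n" by (subst (asm) mult_le_cancel_left_pos) auto
    have pos: "(0::real) < 1 / 2 ^ n" by simp
    have "(1::real) / 2 ^ n \<le> 1 / 2 ^ 1" using n by (intro divide_left_mono power_increasing) auto
    then have "(1::real) / 2 ^ n \<le> 1 / 2" by simp
    then have "1/2 \<le> cmod v" "1/2 \<le> cmod v'"
      using whitney_boxD(3)[OF v(1)] whitney_boxD(3)[OF v(2)] by linarith+
    moreover have "\<bar>turn v' - turn v\<bar> = turn v' - turn v" using low pos by linarith
    ultimately show ?thesis
      using whitney_boxD(1,3)[OF v(1)] whitney_boxD(1,3)[OF v(2)] low high pos
      by (intro pseudohyperbolic_ge_angular[of _ "1 / 2 ^ n"]) auto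
  qed
  consider "n < n'" | "n' < n" | "n = n'" "k < k'" | "n = n'" "k' < k"
    using ne by (metis nat_neq_iff)
  then show ?thesis
  proof cases
    case 1
    then show ?thesis using radial[OF v] same by simp
  next
    case 2
    then show ?thesis using radial[OF v(2,1)] same by (simp add: pseudohyperbolic_commute)
  next
    case 3
    then show ?thesis using angular[of v k v' k'] v same by simp
  next
    case 4
    then show ?thesis using angular[of v' k' v k] v same by (simp add: pseudohyperbolic_commute)
  qed
qed

lemma tree_sum_whitney_le:
  assumes sets: "sets \<mu> = sets disc_borel" and N: "0 < N" "carleson_norm \<mu> \<le> ennreal N"
  shows "tree_sum (\<lambda>n k. 2 ^ n * measure \<mu> (whitney_box n k) / N) d n k \<le> 1 / 2 ^ n"
proof -
  have box: "emeasure \<mu> (dyadic_box n k) \<le> ennreal (N / 2 ^ n)" for n k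
  proof -
    have "emeasure \<mu> (dyadic_box n k) \<le> carleson_norm \<mu> * ennreal (1 / 2 ^ n)"
      by (rule emeasure_dyadic_box_le)
    also have "\<dots> \<le> ennreal N * ennreal (1 / 2 ^ n)" using N by (intro mult_right_mono) auto
    also have "\<dots> = ennreal (N / 2 ^ n)" using N by (simp add: ennreal_mult[symmetric])
    finally show ?thesis .
  qed
  interpret finite_measure \<mu>
  proof
    have "emeasure \<mu> (space \<mu>) \<le> ennreal (N / 2 ^ 0)"
      using box[of 0 0] by (simp add: dyadic_box_0 space_disc_borel[OF sets])
    then show "emeasure \<mu> (space \<mu>) \<noteq> \<infinity>" by (auto simp: top_unique)
  qed
  have "tree_sum (\<lambda>n k. 2 ^ n * measure \<mu> (whitney_box n k) / N) d n k
      = (\<Sum>(m, l)\<in>descendants d n k. measure \<mu> (whitney_box m l)) / N"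
    unfolding tree_sum_eq sum_divide_distrib by (intro sum.cong) auto
  also have "(\<Sum>(m, l)\<in>descendants d n k. measure \<mu> (whitney_box m l))
      = measure \<mu> (\<Union>(m, l)\<in>descendants d n k. whitney_box m l)"
    using whitney_box_sets whitney_box_unique sets finite_descendants
    by (subst finite_measure_finite_Union) (auto simp: disjoint_family_on_def case_prod_beta prod_eq_iff)
  also have "\<dots> \<le> measure \<mu> (dyadic_box n k)"
  proof (rule finite_measure_mono)
    show "(\<Union>(m, l)\<in>descendants d n k. whitney_box m l) \<subseteq> dyadic_box n k"
      using whitney_box_in_dyadic_box by (fastforce simp: descendants_def)
    show "dyadic_box n k \<in> sets \<mu>" using dyadic_box_sets sets by simp
  qed
  also have "\<dots> \<le> N / 2 ^ n"
    using box[of n k] N by (simp add: emeasure_eq_measure)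
  finally show ?thesis using N by (simp add: field_simps divide_right_mono)
qed

context carleson_preserving
begin

text \<open>One point in each selected box, split into the four parity classes, each of which satisfies the
  hypotheses of the uniform bound.\<close>

lemma selected_points_bound:
  assumes K: "\<And>E. finite E \<Longrightarrow> E \<subseteq> unit_disc \<Longrightarrow> pseudohyp_separated (1/3) E (\<lambda>w. w) \<Longrightarrow>
      dyadic_carleson 3 E \<Longrightarrow> (\<Sum>w\<in>E. hyp_kernel \<zeta> (\<Phi> w)) \<le> K"
    and S: "finite S" "\<And>n k. (\<Sum>(m, l)\<in>{(m, l)\<in>S. n \<le> m \<and> l div 2 ^ (m - n) = k}. 1 / 2 ^ m) \<le> (3 :: real) / 2 ^ n"
    and v: "\<And>n k. (n, k) \<in> S \<Longrightarrow> v n k \<in> whitney_box n k"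
  shows "(\<Sum>(n, k)\<in>S. hyp_kernel \<zeta> (\<Phi> (v n k))) \<le> 4 * K"
proof -
  define V where "V = (\<lambda>(n, k). v n k)"
  define S' where "S' i j = {(n, k)\<in>S. n mod 2 = i \<and> k mod 2 = j}" for i j :: nat
  have V: "V (n, k) \<in> whitney_box n k" if "(n, k) \<in> S" for n k using v that by (simp add: V_def)
  have inj: "inj_on V S"
  proof (rule inj_onI)
    fix x y assume xy: "x \<in> S" "y \<in> S" "V x = V y"
    obtain n k n' k' where e: "x = (n, k)" "y = (n', k')" by (metis prod.exhaust)
    have "V x \<in> whitney_box n k" unfolding e(1) using xy e by (intro V) simp
    moreover have "V x \<in> whitney_box n' k'" unfolding xy(3) e(2) using xy e by (intro V) simp
    ultimately show "x = y" using whitney_box_unique e by blast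
  qed
  have cls: "(\<Sum>x\<in>S' i j. hyp_kernel \<zeta> (\<Phi> (V x))) \<le> K" for i j
  proof -
    have sub: "S' i j \<subseteq> S" by (auto simp: S'_def)
    have fin: "finite (S' i j)" using sub S(1) by (rule finite_subset)
    have "(\<Sum>x\<in>S' i j. hyp_kernel \<zeta> (\<Phi> (V x))) = (\<Sum>w\<in>V ` S' i j. hyp_kernel \<zeta> (\<Phi> w))"
      using inj_on_subset[OF inj sub] by (subst sum.reindex) auto
    also have "\<dots> \<le> K"
    proof (rule K)
      show "finite (V ` S' i j)" using fin by simp
      show disc: "V ` S' i j \<subseteq> unit_disc"
        using V whitney_boxD(1) sub by fastforce
      show "pseudohyp_separated (1/3) (V ` S' i j) (\<lambda>w. w)"
        unfolding pseudohyp_separated_def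
      proof (intro ballI impI)
        fix z w assume "z \<in> V ` S' i j" "w \<in> V ` S' i j" "z \<noteq> w"
        then obtain n k n' k' where e: "(n, k) \<in> S' i j" "(n', k') \<in> S' i j" "z = V (n, k)" "w = V (n', k')"
          "(n, k) \<noteq> (n', k')" by (metis (no_types, lifting) imageE prod.exhaust)
        then show "1/3 \<le> pseudohyperbolic z w"
          using V sub by (intro whitney_points_separated[of z n k w n' k']) (auto simp: S'_def)
      qed
      show "dyadic_carleson 3 (V ` S' i j)"
      proof (rule dyadic_carleson_finiteI[OF _ disc])
        show "finite (V ` S' i j)" using fin by simp
        fix n k
        let ?S = "{x \<in> S' i j. V x \<in> dyadic_box n k}"
        have "(\<Sum>w\<in>V ` S' i j \<inter> dyadic_box n k. 1 - cmod w) = (\<Sum>w\<in>V ` ?S. 1 - cmod w)"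
          by (intro sum.cong) auto
        also have "\<dots> = (\<Sum>x\<in>?S. 1 - cmod (V x))"
          using inj_on_subset[OF inj, of ?S] sub by (subst sum.reindex) auto
        also have "\<dots> \<le> (\<Sum>(m, l)\<in>?S. 1 / 2 ^ m)"
          using sub by (intro sum_mono) (auto intro!: whitney_boxD(3)[OF V])
        also have "\<dots> \<le> (\<Sum>(m, l)\<in>{(m, l)\<in>S. n \<le> m \<and> l div 2 ^ (m - n) = k}. 1 / 2 ^ m)"
        proof (rule sum_mono2)
          show "finite {(m, l)\<in>S. n \<le> m \<and> l div 2 ^ (m - n) = k}"
            by (rule finite_subset[OF _ S(1)]) auto
          show "?S \<subseteq> {(m, l)\<in>S. n \<le> m \<and> l div 2 ^ (m - n) = k}"
          proof clarify
            fix m l assume ml: "(m, l) \<in> S' i j" "V (m, l) \<in> dyadic_box n k"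
            then have "V (m, l) \<in> whitney_box m l" using sub by (intro V) blast
            then show "(m, l) \<in> S \<and> n \<le> m \<and> l div 2 ^ (m - n) = k"
              using whitney_box_in_dyadic_box ml sub by blast
          qed
        qed auto
        also have "\<dots> \<le> 3 / 2 ^ n" by (rule S(2))
        finally show "(\<Sum>w\<in>V ` S' i j \<inter> dyadic_box n k. 1 - cmod w) \<le> 3 / 2 ^ n" .
      qed
    qed
    finally show ?thesis .
  qed
  have "S = (\<Union>x\<in>{0, 1} \<times> {0, 1}. S' (fst x) (snd x))"
    unfolding S'_def by (auto simp: case_prod_beta)
  then have "(\<Sum>x\<in>S. hyp_kernel \<zeta> (\<Phi> (V x)))
      = (\<Sum>x\<in>(\<Union>y\<in>{0, 1} \<times> {0, 1}. S' (fst y) (snd y)). hyp_kernel \<zeta> (\<Phi> (V x)))" by simp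
  also have "\<dots> = (\<Sum>y\<in>{0, 1} \<times> {0, 1}. \<Sum>x\<in>S' (fst y) (snd y). hyp_kernel \<zeta> (\<Phi> (V x)))"
    using S(1) by (intro sum.UNION_disjoint) (auto simp: S'_def intro: finite_subset[OF _ S(1)])
  also have "\<dots> \<le> (\<Sum>y\<in>{0, 1::nat} \<times> {0, 1::nat}. K)" by (intro sum_mono cls)
  also have "\<dots> = 4 * K" by (simp add: card_cartesian_product)
  finally show ?thesis by (simp add: V_def case_prod_beta)
qed

text \<open>The integral of the kernel with respect to the pushforward is the integral of
  \<open>hyp_kernel \<zeta> (\<Phi> w) / (1 - \<bar>w\<bar>\<^sup>2)\<close> with respect to
  \<open>\<mu>\<close>. On a Whitney box the denominator is comparable to \<open>2 ^ - n\<close>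
  and the numerator is at most twice its value at a suitable point, so the integral is at most a
  constant times \<open>\<Sum> c n k * A n k\<close>, where the fractions \<open>c n k\<close> are
  the normalized masses of the boxes. Rounding replaces the fractions by a set of boxes, whose
  chosen points obey the uniform bound.\<close>

lemma pushforward_kernel_bound:
  assumes K: "\<And>E. finite E \<Longrightarrow> E \<subseteq> unit_disc \<Longrightarrow> pseudohyp_separated (1/3) E (\<lambda>w. w) \<Longrightarrow>
      dyadic_carleson 3 E \<Longrightarrow> (\<Sum>w\<in>E. hyp_kernel \<zeta> (\<Phi> w)) \<le> K"
    and \<zeta>: "cmod \<zeta> < 1"
    and sets: "sets \<mu> = sets disc_borel" and N: "0 < N" "carleson_norm \<mu> \<le> ennreal N"
  shows "(\<integral>\<^sup>+ w. ennreal (poisson_kernel \<zeta> w) \<partial>weighted_pushforward \<Phi> \<mu>) \<le> ennreal (16 * K * N)"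
proof -
  define a where "a w = hyp_kernel \<zeta> (\<Phi> w)" for w
  have a_pos: "0 < a w" if "cmod w < 1" for w
    unfolding a_def using hyp_kernel_pos[OF \<zeta> in_disc[OF that]] .
  have a_le: "a w \<le> 1" for w unfolding a_def by (rule hyp_kernel_le_1)
  define f where "f w = a w / (1 - (cmod w)\<^sup>2)" for w
  have f_eq: "ennreal (disc_weight \<Phi> w) * ennreal (poisson_kernel \<zeta> (\<Phi> w)) = ennreal (f w)" if w: "cmod w < 1" for w
  proof -
    have "0 < 1 - (cmod w)\<^sup>2" "0 < 1 - (cmod (\<Phi> w))\<^sup>2" "0 < 1 - (cmod \<zeta>)\<^sup>2"
      using w in_disc[OF w] \<zeta> by (auto simp: abs_square_less_1)
    then show ?thesis
      using in_disc[OF w] \<zeta>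
      by (subst ennreal_mult[symmetric])
         (auto simp: f_def a_def disc_weight_def hyp_kernel_eq mult_ac)
  qed
  have m: "(\<lambda>w. ennreal (poisson_kernel \<zeta> w)) \<in> borel_measurable disc_borel"
    using poisson_kernel_measurable[OF \<zeta>] by simp
  have space: "space \<mu> = unit_disc" by (rule space_disc_borel[OF sets])
  have "(\<lambda>w. ennreal (disc_weight \<Phi> w) * ennreal (poisson_kernel \<zeta> (\<Phi> w))) \<in> borel_measurable disc_borel"
    using disc_weight_measurable[OF continuous]
      measurable_compose[OF self_map_measurable[OF continuous self_map] m] by simp
  then have "(\<lambda>w. ennreal (disc_weight \<Phi> w) * ennreal (poisson_kernel \<zeta> (\<Phi> w))) \<in> borel_measurable \<mu>"
    using measurable_cong_sets[OF sets refl] by blast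
  then have fm: "(\<lambda>w. ennreal (f w)) \<in> borel_measurable \<mu>"
    by (subst (asm) measurable_cong[of \<mu> _ "\<lambda>w. ennreal (f w)"]) (auto simp: space f_eq)
  have int_eq: "(\<integral>\<^sup>+ w. ennreal (poisson_kernel \<zeta> w) \<partial>weighted_pushforward \<Phi> \<mu>) = (\<integral>\<^sup>+ w. ennreal (f w) \<partial>\<mu>)"
    unfolding nn_integral_weighted_pushforward[OF continuous self_map sets m]
    by (intro nn_integral_cong) (auto simp: space f_eq)
  have "\<exists>v. whitney_box n k \<noteq> {} \<longrightarrow> v \<in> whitney_box n k \<and> (\<forall>w\<in>whitney_box n k. a w \<le> 2 * a v)" for n k
  proof (cases "whitney_box n k = {}")
    case False
    define s where "s = Sup (a ` whitney_box n k)"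
    have bdd: "bdd_above (a ` whitney_box n k)" using a_le by (auto intro!: bdd_aboveI[of _ 1])
    have le_s: "a w \<le> s" if "w \<in> whitney_box n k" for w
      unfolding s_def using bdd that by (intro cSup_upper) auto
    obtain w where "w \<in> whitney_box n k" using False by blast
    then have "0 < s" using le_s[of w] a_pos[OF whitney_boxD(1), of w n k] by linarith
    then have "\<exists>y\<in>a ` whitney_box n k. s / 2 < y"
      unfolding s_def using False by (intro less_cSupD) auto
    then obtain v where v: "v \<in> whitney_box n k" "s / 2 < a v" by blast
    have "a w \<le> 2 * a v" if "w \<in> whitney_box n k" for w using le_s[OF that] v(2) by linarith
    then show ?thesis using v(1) by blast
  qed simp
  then obtain v where v: "\<And>n k. whitney_box n k \<noteq> {} \<Longrightarrow> v n k \<in> whitney_box n k"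
    "\<And>n k w. w \<in> whitney_box n k \<Longrightarrow> a w \<le> 2 * a (v n k)" by (metis empty_iff)
  define A where "A n k = (if whitney_box n k = {} then 0 else a (v n k))" for n k
  have A0: "0 \<le> A n k" for n k
    unfolding A_def using a_pos[OF whitney_boxD(1)[OF v(1)], of n k] by (auto intro: less_imp_le)
  define c where "c n k = 2 ^ n * measure \<mu> (whitney_box n k) / N" for n k
  have c: "0 \<le> c n k" "tree_sum c d n k \<le> 1 / 2 ^ n" for n k d
    using N tree_sum_whitney_le[OF sets N, of d n k] by (auto simp: c_def[abs_def])
  have em: "emeasure \<mu> (whitney_box n k) = ennreal (measure \<mu> (whitney_box n k))" for n k
  proof -
    have "whitney_box n k \<subseteq> dyadic_box 0 0" by (auto simp: whitney_box_def dyadic_box_def)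
    then have "emeasure \<mu> (whitney_box n k) \<le> emeasure \<mu> (dyadic_box 0 0)"
      using dyadic_box_sets sets by (intro emeasure_mono) auto
    also have "\<dots> \<le> carleson_norm \<mu> * ennreal (1 / 2 ^ 0)" by (rule emeasure_dyadic_box_le)
    also have "\<dots> \<le> ennreal N" using N by simp
    finally show ?thesis by (intro emeasure_eq_ennreal_measure) (auto simp: top_unique)
  qed
  define U where "U G = (\<Union>(n, k)\<in>descendants G 0 0. whitney_box n k)" for G
  have U_sets: "U G \<in> sets \<mu>" for G
    unfolding U_def using finite_descendants whitney_box_sets sets by (intro sets.finite_UN) auto
  have bound: "(\<integral>\<^sup>+ w. ennreal (f w) * indicator (U G) w \<partial>\<mu>) \<le> ennreal (16 * K * N)" for G
  proof -
    have "(\<integral>\<^sup>+ w. ennreal (f w) * indicator (U G) w \<partial>\<mu>)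
        \<le> (\<integral>\<^sup>+ w. (\<Sum>(n, k)\<in>descendants G 0 0. ennreal (4 * 2 ^ n * A n k) * indicator (whitney_box n k) w) \<partial>\<mu>)"
    proof (rule nn_integral_mono)
      fix w
      show "ennreal (f w) * indicator (U G) w
          \<le> (\<Sum>(n, k)\<in>descendants G 0 0. ennreal (4 * 2 ^ n * A n k) * indicator (whitney_box n k) w)"
      proof (cases "w \<in> U G")
        case True
        then obtain n k where nk: "(n, k) \<in> descendants G 0 0" "w \<in> whitney_box n k" by (auto simp: U_def)
        have wD: "cmod w < 1" "1 / 2 ^ Suc n < 1 - cmod w" using whitney_boxD[OF nk(2)] by auto
        have "(cmod w)\<^sup>2 \<le> cmod w" using wD(1) by (simp add: power2_eq_square mult_left_le)
        then have ge: "1 / 2 ^ Suc n \<le> 1 - (cmod w)\<^sup>2" using wD(2) by linarith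
        have pos: "0 < 1 - (cmod w)\<^sup>2" using wD(1) by (simp add: abs_square_less_1)
        have "f w \<le> a w / (1 / 2 ^ Suc n)"
          unfolding f_def using ge pos a_pos[OF wD(1)]
          by (intro divide_left_mono mult_pos_pos) auto
        also have "\<dots> \<le> 4 * 2 ^ n * A n k"
          using v(2)[OF nk(2)] nk(2) by (auto simp: A_def)
        finally have "ennreal (f w) * indicator (U G) w \<le> ennreal (4 * 2 ^ n * A n k) * indicator (whitney_box n k) w"
          using True nk(2) by (simp add: ennreal_leI)
        also have "\<dots> \<le> (\<Sum>(n, k)\<in>descendants G 0 0. ennreal (4 * 2 ^ n * A n k) * indicator (whitney_box n k) w)"
          using member_le_sum[OF nk(1), of "\<lambda>(n, k). ennreal (4 * 2 ^ n * A n k) * indicator (whitney_box n k) w"]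
            finite_descendants by simp
        finally show ?thesis .
      qed simp
    qed
    also have "\<dots> = (\<Sum>(n, k)\<in>descendants G 0 0. ennreal (4 * 2 ^ n * A n k) * emeasure \<mu> (whitney_box n k))"
      using whitney_box_sets sets
      by (subst nn_integral_sum) (auto simp: case_prod_beta nn_integral_cmult_indicator)
    also have "\<dots> = (\<Sum>(n, k)\<in>descendants G 0 0. ennreal (4 * N * (c n k * A n k)))"
    proof (intro sum.cong refl, clarify)
      fix n k
      show "ennreal (4 * 2 ^ n * A n k) * emeasure \<mu> (whitney_box n k) = ennreal (4 * N * (c n k * A n k))"
        unfolding em using A0 N by (subst ennreal_mult[symmetric]) (auto simp: c_def)
    qed
    also have "\<dots> = ennreal (\<Sum>(n, k)\<in>descendants G 0 0. 4 * N * (c n k * A n k))"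
      unfolding case_prod_beta using A0 c(1) N by (intro sum_ennreal) auto
    also have "(\<Sum>(n, k)\<in>descendants G 0 0. 4 * N * (c n k * A n k))
        = 4 * N * (\<Sum>(n, k)\<in>descendants G 0 0. c n k * A n k)"
      by (simp add: case_prod_beta sum_distrib_left)
    also have "ennreal \<dots> \<le> ennreal (4 * N * (4 * K))"
    proof (intro ennreal_leI mult_left_mono)
      obtain S where S: "S \<subseteq> descendants G 0 0"
        "(\<Sum>(n, k)\<in>descendants G 0 0. c n k * A n k) \<le> (\<Sum>(n, k)\<in>S. A n k)"
        "\<And>n k. (\<Sum>(m, l)\<in>{(m, l)\<in>S. n \<le> m \<and> l div 2 ^ (m - n) = k}. 1 / 2 ^ m) \<le> (3 :: real) / 2 ^ n"
        by (rule carleson_rounding[OF c A0]) (rule that)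
      have finS: "finite S" using S(1) finite_descendants by (rule finite_subset)
      define S' where "S' = {(n, k)\<in>S. whitney_box n k \<noteq> {}}"
      have S'S: "S' \<subseteq> S" by (auto simp: S'_def)
      have "(\<Sum>(n, k)\<in>S. A n k) = (\<Sum>(n, k)\<in>S'. hyp_kernel \<zeta> (\<Phi> (v n k)))"
        unfolding S'_def by (rule sum.mono_neutral_cong_right[OF finS]) (auto simp: A_def a_def split: if_splits)
      also have "\<dots> \<le> 4 * K"
      proof (rule selected_points_bound[OF K])
        show "finite S'" using S'S finS by (rule finite_subset)
        fix n k
        have "(\<Sum>(m, l)\<in>{(m, l)\<in>S'. n \<le> m \<and> l div 2 ^ (m - n) = k}. 1 / 2 ^ m)
            \<le> (\<Sum>(m, l)\<in>{(m, l)\<in>S. n \<le> m \<and> l div 2 ^ (m - n) = k}. (1 :: real) / 2 ^ m)"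
        proof (rule sum_mono2)
          show "finite {(m, l)\<in>S. n \<le> m \<and> l div 2 ^ (m - n) = k}"
            by (rule finite_subset[OF _ finS]) auto
        qed (use S'S in auto)
        then show "(\<Sum>(m, l)\<in>{(m, l)\<in>S'. n \<le> m \<and> l div 2 ^ (m - n) = k}. 1 / 2 ^ m) \<le> (3 :: real) / 2 ^ n"
          using S(3)[of n k] by (rule order_trans)
        show "v n k \<in> whitney_box n k" if "(n, k) \<in> S'" using v(1) that by (auto simp: S'_def)
      qed auto
      finally show "(\<Sum>(n, k)\<in>descendants G 0 0. c n k * A n k) \<le> 4 * K" using S(2) by linarith
    qed (use N in auto)
    also have "4 * N * (4 * K) = 16 * K * N" by simp
    finally show ?thesis .
  qed
  have incU: "incseq U"
    unfolding U_def by (intro incseq_SucI UN_mono) (auto simp: descendants_def)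
  have UD: "(\<Union>G. U G) = unit_disc"
  proof (intro equalityI subsetI)
    fix w assume "w \<in> (\<Union>G. U G)"
    then show "w \<in> unit_disc" using whitney_boxD(1) by (fastforce simp: U_def)
  next
    fix w assume "w \<in> unit_disc"
    then obtain n where n: "w \<in> whitney_box n (dyadic_pos n w)" using whitney_box_exists[of w] by auto
    have "(n, dyadic_pos n w) \<in> descendants n 0 0" using dyadic_pos_less[of n w] by (simp add: descendants_def)
    then show "w \<in> (\<Union>G. U G)" using n by (auto simp: U_def)
  qed
  have "(\<integral>\<^sup>+ w. ennreal (f w) \<partial>\<mu>) = emeasure (density \<mu> (\<lambda>w. ennreal (f w))) unit_disc"
    using fm space sets.top[of \<mu>] by (subst emeasure_density) (auto intro!: nn_integral_cong)
  also have "\<dots> = (SUP G. emeasure (density \<mu> (\<lambda>w. ennreal (f w))) (U G))"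
    unfolding UD[symmetric] using U_sets by (intro SUP_emeasure_incseq[symmetric] incU) auto
  also have "\<dots> \<le> ennreal (16 * K * N)"
    using bound fm U_sets by (intro SUP_least) (auto simp: emeasure_density)
  finally show ?thesis unfolding int_eq .
qed

text \<open>Letting \<open>N\<close> decrease to the Carleson norm also covers measures of norm 0.\<close>

lemma bounded_pushforward:
  "\<exists>C :: ennreal. C < \<infinity> \<and>
     (\<forall>\<mu>. carleson_measure \<mu> \<longrightarrow> carleson_norm (weighted_pushforward \<Phi> \<mu>) \<le> C * carleson_norm \<mu>)"
proof -
  obtain K where K: "\<And>E \<zeta>. finite E \<Longrightarrow> E \<subseteq> unit_disc \<Longrightarrow> pseudohyp_separated (1/3) E (\<lambda>w. w) \<Longrightarrow>
     dyadic_carleson 3 E \<Longrightarrow> cmod \<zeta> < 1 \<Longrightarrow> (\<Sum>w\<in>E. hyp_kernel \<zeta> (\<Phi> w)) \<le> K"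
    using uniform_kernel_bound by blast
  have K0: "0 \<le> K"
    using K[of "{}" 0] by (simp add: pseudohyp_separated_def dyadic_carleson_def)
  have "carleson_norm (weighted_pushforward \<Phi> \<mu>) \<le> ennreal (1600 * K) * carleson_norm \<mu>"
    if \<mu>: "carleson_measure \<mu>" for \<mu>
  proof -
    have sets: "sets \<mu> = sets disc_borel" and fin: "carleson_norm \<mu> < \<infinity>"
      using \<mu> by (auto simp: carleson_measure_def)
    define r where "r = enn2real (carleson_norm \<mu>)"
    have r: "carleson_norm \<mu> = ennreal r" "0 \<le> r" using fin by (simp_all add: r_def)
    show ?thesis
    proof (rule ennreal_le_epsilon)
      fix e :: real assume e: "0 < e"
      define N where "N = r + e / (1600 * K + 1)"
      have N: "0 < N" "r \<le> N" using r(2) e K0 by (auto simp: N_def add_nonneg_pos)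
      have "carleson_norm (weighted_pushforward \<Phi> \<mu>) \<le> ennreal 100 * ennreal (16 * K * N)"
      proof (rule carleson_norm_le)
        show "sets (weighted_pushforward \<Phi> \<mu>) = sets disc_borel" by simp
        fix z :: complex assume z: "cmod z < 1"
        show "(\<integral>\<^sup>+ w. ennreal (poisson_kernel z w) \<partial>weighted_pushforward \<Phi> \<mu>) \<le> ennreal (16 * K * N)"
          using r(1) N by (intro pushforward_kernel_bound[OF K[OF _ _ _ _ z] z sets]) (auto intro: ennreal_leI)
      qed
      also have "\<dots> = ennreal (1600 * K * N)"
        using K0 N by (subst ennreal_mult[symmetric]) auto
      also have "1600 * K * N \<le> 1600 * K * r + e"
      proof -
        have "1600 * K * (e / (1600 * K + 1)) \<le> e"
          using K0 e by (simp add: field_simps)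
        then show ?thesis by (simp add: N_def distrib_left)
      qed
      then have "ennreal (1600 * K * N) \<le> ennreal (1600 * K * r + e)" by (rule ennreal_leI)
      also have "\<dots> = ennreal (1600 * K) * carleson_norm \<mu> + ennreal e"
        using K0 r e by (simp add: ennreal_mult ennreal_plus)
      finally show "carleson_norm (weighted_pushforward \<Phi> \<mu>) \<le> ennreal (1600 * K) * carleson_norm \<mu> + ennreal e" .
    qed
  qed
  then show ?thesis by (intro exI[of _ "ennreal (1600 * K)"]) auto
qed

end

theorem theorem2p8:
  fixes \<Phi> :: "complex \<Rightarrow> complex"
  assumes "continuous_on unit_disc \<Phi>"
    and "\<Phi> ` unit_disc \<subseteq> unit_disc"
  shows "(\<forall>(J :: nat set) (\<Lambda> :: nat \<Rightarrow> complex).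
            carleson_sequence J \<Lambda> \<longrightarrow> carleson_sequence J (\<Phi> \<circ> \<Lambda>))
     \<longleftrightarrow>
         ((\<exists>\<Psi>. homeomorphism unit_disc unit_disc \<Phi> \<Psi> \<and> pseudohyp_uniformly_continuous \<Psi>) \<and>
          (\<exists>C :: ennreal. C < \<infinity> \<and>
             (\<forall>\<mu>. carleson_measure \<mu> \<longrightarrow>
                  carleson_norm (weighted_pushforward \<Phi> \<mu>) \<le> C * carleson_norm \<mu>)))"
proof (intro iffI allI impI, goal_cases)
  case 1
  then interpret carleson_preserving \<Phi>
    using assms by unfold_locales blast+
  show ?case
    using homeomorphism_inverse inverse_uniformly_continuous bounded_pushforward by blast
next
  case (2 J \<Lambda>)
  then show ?case
    using bounded_pushforward_preserves_carleson[OF assms] by blast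
qed

end
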